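(* The assignments $\mathfrak{Tot}(A):=\mathrm{Tot}(A)$ on twisted complexes $A$ and, for twisted complexes $A,B$, $$\mathfrak{Tot}_{A,B}:\underline{tC_R}(A,B)\to\underline{fC_R}(\mathrm{Tot}(A),\mathrm{Tot}(B)),\qquad f\mapsto\mathrm{Tot}(f),$$ define a $\mathrm{vbC}_R$-enriched functor $\mathfrak{Tot}:\underline{tC_R}\to\underline{fC_R}$ which restricts to an isomorphism onto its image $\underline{sfC_R}$, the full enriched subcategory on split filtered complexes. Furthermore, this functor restricts to a $\mathrm{bgMod}_R$-enriched functor $\mathfrak{Tot}:\underline{bgMod_R}\to\underline{fMod_R}$ which also restricts to an isomorphism onto its image $\underline{sfMod_R}$, the full enriched subcategory on split filtered modules.
   Context: $R$ is a commutative ring with unit. Bigraded modules $A=\{A_i^j\}$ are $(\mathbb Z,\mathbb Z)$-bigraded $R$-modules; a map of bidegree $(p,q)$ sends $A_i^j$ to $A_{i+p}^{j+q}$. An element of bidegree $(i,j)$ has total degree $j-i$, denoted $|\cdot|$ (an element $f$ of bidegree $(u,v)$ of a hom-object below has $|f|=v-u$). $\langle(x_1,x_2),(y_1,y_2)\rangle=x_1y_1+x_2y_2$. $\mathrm{bgMod}_R$ is the symmetric monoidal category of bigraded modules and bidegree $(0,0)$ maps, with $(A\otimes B)_i^j=\bigoplus_{p,q}A_p^q\otimes B_{i-p}^{j-q}$, symmetry $a\otimes b\mapsto(-1)^{\langle a,b\rangle}b\otimes a$. $\mathrm{vbC}_R$ is the symmetric monoidal category of vertical bicomplexes: bigraded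 modules with a differential $d$ of bidegree $(0,1)$, $d^2=0$; tensor differential $d\otimes1+1\otimes d$ with the Koszul sign rule $(f\otimes g)(a\otimes c)=(-1)^{\langle g,a\rangle}f(a)\otimes g(c)$. A twisted complex $(A,d_m)$ is a bigraded module with maps $d_m$, $m\ge0$, of bidegree $(-m,-m+1)$ with $\sum_{i+j=m}(-1)^id_id_j=0$ for all $m$. A filtered complex is a cochain complex $(K,d)$ with an exhaustive increasing filtration $F_pK^n$ with $d(F_pK^n)\subset F_pK^{n+1}$; a filtered module is a graded module with such a filtration. $\underline{bgMod_R}$: objects are bigraded modules; the hom-object is the bigraded module $\underline{bgMod_R}(A,B)_u^v$ of sequences $f=(f_0,f_1,\dots)$ with $f_j:A\to B$ of bidegree $(u-j,v-j)$; composition $c(f,g)_m=\sum_{i+j=m}(-1)^{i|g|}f_ig_j$; unit $(1_A,0,0,\dots)$. $\underline{tC_R}$: objects are twisted complexes; $\underline{tC_R}(A,B)$ is the bigraded module $\underline{bgMod_R}(A,B)$ with differential $\delta(f)=c(d^B,f)-(-1)^{\langle f,d^A\rangle}c(f,d^A)$, i.e. $(\delta f)_m=\sum_{i+j=m}(-1)^{i|f|}d_i^Bf_j-(-1)^{v+i}f_id_j^A$ for $f$ of bidegree $(u,v)$, where $d^A=(d^A_i)_i$ has bidegree $(0,1)$; same composition and units. Bigraded modules are viewed as twisted complexes with zero structure maps. $\underline{fMod_R}$: objects are filtered modules; $\underline{fMod_R}(K,L)_u^v=\{f:K\to L\mid f(F_qK^m)\subset F_{q+u}L^{m+v-u}\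 \forall m,q\}$; composition $c(f,g)=(-1)^{u|g|}fg$ for $f$ of bidegree $(u,v)$; unit $1_K$. $\underline{fC_R}$: objects are filtered complexes; $\underline{fC_R}(K,L)$ is $\underline{fMod_R}(K,L)$ with differential $\delta(f)=d^Lf-(-1)^{|f|}fd^K$; same composition and units. $\mathrm{Tot}(A)^n=\prod_{i\le0}A_i^{n+i}\oplus\bigoplus_{i>0}A_i^{n+i}$, with column filtration $F_p\mathrm{Tot}(A)^n=\prod_{i\le p}A_i^{n+i}$ and, for a twisted complex, differential $d(a)_j=\sum_{m\ge0}(-1)^{mn}d_m(a_{j+m})$ for $a\in\mathrm{Tot}(A)^n$. A filtered module (complex) is split if its underlying filtered graded module is $\mathrm{Tot}(A)$ with the column filtration for a bigraded module $A$ (which is part of the data). For $f\in\underline{bgMod_R}(A,B)_u^v$, $\mathrm{Tot}(f)\in\underline{fMod_R}(\mathrm{Tot}(A),\mathrm{Tot}(B))_u^v$ is given on $a\in\mathrm{Tot}(A)^n$ by $(\mathrm{Tot}(f)(a))_{j+u}=\sum_{m\ge0}(-1)^{(m+u)n}f_m(a_{j+m})$. *)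

theory Defs
  imports "HOL-Algebra.AbelCoset" "HOL-Algebra.Module" HOL.Hull
begin

section \<open>Modules\<close>

text \<open>
  The fields \<^term>\<open>mult\<close> and \<^term>\<open>one\<close> of a record of type \<open>('r, 'a) module\<close> play no role in
  the locale \<^locale>\<open>module\<close>; they are left unspecified in all modules constructed here.
\<close>

definition mk_module ::
  "'a set \<Rightarrow> 'a \<Rightarrow> ('a \<Rightarrow> 'a \<Rightarrow> 'a) \<Rightarrow> ('r \<Rightarrow> 'a \<Rightarrow> 'a) \<Rightarrow> ('r, 'a) module" where
  "mk_module S z p s =
     \<lparr>carrier = S, mult = undefined, one = undefined, zero = z, add = p, smult = s\<rparr>"

text \<open>\<open>sign_pow M n x\<close> is \<open>(-1)\<^sup>n x\<close> in the module \<open>M\<close>.\<close>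

definition sign_pow :: "('r, 'a) module \<Rightarrow> int \<Rightarrow> 'a \<Rightarrow> 'a" where
  "sign_pow M n x = (if even n then x else \<ominus>\<^bsub>M\<^esub> x)"

text \<open>
  All maps are extensional (equal to \<^term>\<open>undefined\<close> outside the carrier of their source), so
  that equality of HOL functions is equality of maps.
\<close>

definition lin :: "'r ring \<Rightarrow> ('r, 'a) module \<Rightarrow> ('r, 'b) module \<Rightarrow> ('a \<Rightarrow> 'b) set" where
  "lin R M N = {f \<in> carrier M \<rightarrow>\<^sub>E carrier N.
     (\<forall>x \<in> carrier M. \<forall>y \<in> carrier M. f (x \<oplus>\<^bsub>M\<^esub> y) = f x \<oplus>\<^bsub>N\<^esub> f y) \<and>
     (\<forall>r \<in> carrier R. \<forall>x \<in> carrier M. f (r \<odot>\<^bsub>M\<^esub> x) = r \<odot>\<^bsub>N\<^esub> f x)}"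

definition free_mod :: "'r ring \<Rightarrow> 's set \<Rightarrow> ('r, 's \<Rightarrow> 'r) module" where
  "free_mod R S = mk_module
     {x. (\<forall>s. x s \<in> carrier R) \<and> (\<forall>s. s \<notin> S \<longrightarrow> x s = \<zero>\<^bsub>R\<^esub>) \<and> finite {s. x s \<noteq> \<zero>\<^bsub>R\<^esub>}}
     (\<lambda>s. \<zero>\<^bsub>R\<^esub>) (\<lambda>x y s. x s \<oplus>\<^bsub>R\<^esub> y s) (\<lambda>r x s. r \<otimes>\<^bsub>R\<^esub> x s)"

definition free_gen :: "'r ring \<Rightarrow> 's \<Rightarrow> 's \<Rightarrow> 'r" where
  "free_gen R s = (\<lambda>t. if t = s then \<one>\<^bsub>R\<^esub> else \<zero>\<^bsub>R\<^esub>)"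

definition quot_mod :: "('r, 'a) module \<Rightarrow> 'a set \<Rightarrow> ('r, 'a set) module" where
  "quot_mod M H = mk_module (a_rcosets\<^bsub>M\<^esub> H) H (\<lambda>X Y. X <+>\<^bsub>M\<^esub> Y)
     (\<lambda>r X. \<Union>x \<in> X. H +>\<^bsub>M\<^esub> (r \<odot>\<^bsub>M\<^esub> x))"

definition tensor_rel ::
  "'r ring \<Rightarrow> ('r, 'a) module \<Rightarrow> ('r, 'b) module \<Rightarrow> ('a \<times> 'b \<Rightarrow> 'r) set" where
  "tensor_rel R M N = (let F = free_mod R (carrier M \<times> carrier N); e = free_gen R in
     (\<lambda>H. submodule H R F) hull
      ({e (a \<oplus>\<^bsub>M\<^esub> a', b) \<ominus>\<^bsub>F\<^esub> (e (a, b) \<oplus>\<^bsub>F\<^esub> e (a', b)) | a a' b.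
          a \<in> carrier M \<and> a' \<in> carrier M \<and> b \<in> carrier N} \<union>
       {e (a, b \<oplus>\<^bsub>N\<^esub> b') \<ominus>\<^bsub>F\<^esub> (e (a, b) \<oplus>\<^bsub>F\<^esub> e (a, b')) | a b b'.
          a \<in> carrier M \<and> b \<in> carrier N \<and> b' \<in> carrier N} \<union>
       {e (r \<odot>\<^bsub>M\<^esub> a, b) \<ominus>\<^bsub>F\<^esub> (r \<odot>\<^bsub>F\<^esub> e (a, b)) | r a b.
          r \<in> carrier R \<and> a \<in> carrier M \<and> b \<in> carrier N} \<union>
       {e (a, r \<odot>\<^bsub>N\<^esub> b) \<ominus>\<^bsub>F\<^esub> (r \<odot>\<^bsub>F\<^esub> e (a, b)) | r a b.
          r \<in> carrier R \<and> a \<in> carrier M \<and> b \<in> carrier N}))"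

definition tensor ::
  "'r ring \<Rightarrow> ('r, 'a) module \<Rightarrow> ('r, 'b) module \<Rightarrow> ('r, ('a \<times> 'b \<Rightarrow> 'r) set) module" where
  "tensor R M N = quot_mod (free_mod R (carrier M \<times> carrier N)) (tensor_rel R M N)"

definition pure ::
  "'r ring \<Rightarrow> ('r, 'a) module \<Rightarrow> ('r, 'b) module \<Rightarrow> 'a \<Rightarrow> 'b \<Rightarrow> ('a \<times> 'b \<Rightarrow> 'r) set" where
  "pure R M N a b =
     tensor_rel R M N +>\<^bsub>free_mod R (carrier M \<times> carrier N)\<^esub> free_gen R (a, b)"

definition direct_sum :: "('i \<Rightarrow> ('r, 'a) module) \<Rightarrow> ('r, 'i \<Rightarrow> 'a) module" where
  "direct_sum M = mk_module
     {x. (\<forall>i. x i \<in> carrier (M i)) \<and> finite {i. x i \<noteq> \<zero>\<^bsub>M i\<^esub>}}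
     (\<lambda>i. \<zero>\<^bsub>M i\<^esub>) (\<lambda>x y i. x i \<oplus>\<^bsub>M i\<^esub> y i) (\<lambda>r x i. r \<odot>\<^bsub>M i\<^esub> x i)"


section \<open>The monoidal category of bigraded modules\<close>

text \<open>\<open>A i j\<close> is \<open>A\<^sub>i\<^sup>j\<close>, with lower index \<open>i\<close> and upper index \<open>j\<close>; likewise for maps.\<close>

type_synonym ('r, 'a) bgmod = "int \<Rightarrow> int \<Rightarrow> ('r, 'a) module"
type_synonym ('a, 'b) bgmap = "int \<Rightarrow> int \<Rightarrow> 'a \<Rightarrow> 'b"
type_synonym ('r, 'a, 'b) tens = "int \<times> int \<Rightarrow> ('a \<times> 'b \<Rightarrow> 'r) set"

definition bigraded_module :: "'r ring \<Rightarrow> ('r, 'a) bgmod \<Rightarrow> bool" where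
  "bigraded_module R A \<longleftrightarrow> (\<forall>i j. module R (A i j))"

definition bg_maps ::
  "'r ring \<Rightarrow> ('r, 'a) bgmod \<Rightarrow> ('r, 'b) bgmod \<Rightarrow> int \<Rightarrow> int \<Rightarrow> ('a, 'b) bgmap set" where
  "bg_maps R A B p q = {f. \<forall>i j. f i j \<in> lin R (A i j) (B (i + p) (j + q))}"

definition bg_id :: "('r, 'a) bgmod \<Rightarrow> ('a, 'a) bgmap" where
  "bg_id A = (\<lambda>i j. \<lambda>x \<in> carrier (A i j). x)"

text \<open>\<open>g \<circ> f\<close> for \<open>f\<close> of bidegree \<open>(0, 0)\<close> and source \<open>A\<close>.\<close>

definition bg_comp :: "('r, 'a) bgmod \<Rightarrow> ('b, 'c) bgmap \<Rightarrow> ('a, 'b) bgmap \<Rightarrow> ('a, 'c) bgmap" where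
  "bg_comp A g f = (\<lambda>i j. compose (carrier (A i j)) (g i j) (f i j))"

definition bg_tensor ::
  "'r ring \<Rightarrow> ('r, 'a) bgmod \<Rightarrow> ('r, 'b) bgmod \<Rightarrow> ('r, ('r, 'a, 'b) tens) bgmod" where
  "bg_tensor R A B =
     (\<lambda>i j. direct_sum (\<lambda>(p, q). tensor R (A p q) (B (i - p) (j - q))))"

text \<open>The element \<open>a \<otimes> b\<close> for \<open>a\<close> of bidegree \<open>(p, q)\<close> and \<open>b\<close> of bidegree \<open>(s, t)\<close>.\<close>

definition bg_pure ::
  "'r ring \<Rightarrow> ('r, 'a) bgmod \<Rightarrow> ('r, 'b) bgmod \<Rightarrow> int \<Rightarrow> int \<Rightarrow> int \<Rightarrow> int \<Rightarrow> 'a \<Rightarrow> 'b \<Rightarrow> ('r, 'a, 'b) tens" where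
  "bg_pure R A B p q s t a b = (\<lambda>(k, l).
     if k = p \<and> l = q then pure R (A p q) (B s t) a b
     else \<zero>\<^bsub>tensor R (A k l) (B (p + s - k) (q + t - l))\<^esub>)"

text \<open>
  The unique map \<open>A \<otimes> B \<rightarrow> C\<close> of bidegree \<open>(u, v)\<close> with \<open>a \<otimes> b \<mapsto> \<phi> p q s t a b\<close>
  for \<open>a\<close> of bidegree \<open>(p, q)\<close> and \<open>b\<close> of bidegree \<open>(s, t)\<close>.
\<close>

definition bg_lift ::
  "'r ring \<Rightarrow> ('r, 'a) bgmod \<Rightarrow> ('r, 'b) bgmod \<Rightarrow> ('r, 'c) bgmod \<Rightarrow> int \<Rightarrow> int \<Rightarrow>
   (int \<Rightarrow> int \<Rightarrow> int \<Rightarrow> int \<Rightarrow> 'a \<Rightarrow> 'b \<Rightarrow> 'c) \<Rightarrow> (('r, 'a, 'b) tens, 'c) bgmap" where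
  "bg_lift R A B C u v \<phi> = (THE h. h \<in> bg_maps R (bg_tensor R A B) C u v \<and>
     (\<forall>p q s t. \<forall>a \<in> carrier (A p q). \<forall>b \<in> carrier (B s t).
        h (p + s) (q + t) (bg_pure R A B p q s t a b) = \<phi> p q s t a b))"

text \<open>
  \<open>f \<otimes> g\<close> for \<open>f : A \<rightarrow> A'\<close> of bidegree \<open>(p, q)\<close> and \<open>g : B \<rightarrow> B'\<close> of bidegree \<open>(s, t)\<close>,
  with the Koszul sign \<open>(-1)\<close> to the power \<open>\<langle>g, a\<rangle> = s i + t j\<close> for \<open>a\<close> of bidegree \<open>(i, j)\<close>.
\<close>

definition bg_tens ::
  "'r ring \<Rightarrow> ('r, 'a) bgmod \<Rightarrow> ('r, 'b) bgmod \<Rightarrow> ('r, 'c) bgmod \<Rightarrow> ('r, 'd) bgmod \<Rightarrow>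
   int \<Rightarrow> int \<Rightarrow> int \<Rightarrow> int \<Rightarrow> ('a, 'c) bgmap \<Rightarrow> ('b, 'd) bgmap \<Rightarrow>
   (('r, 'a, 'b) tens, ('r, 'c, 'd) tens) bgmap" where
  "bg_tens R A B A' B' p q s t f g = bg_lift R A B (bg_tensor R A' B') (p + s) (q + t)
     (\<lambda>i j k l a b.
        sign_pow (bg_tensor R A' B' (i + p + (k + s)) (j + q + (l + t))) (s * i + t * j)
          (bg_pure R A' B' (i + p) (j + q) (k + s) (l + t) (f i j a) (g k l b)))"

definition bg_unit :: "'r ring \<Rightarrow> ('r, 'r) bgmod" where
  "bg_unit R = (\<lambda>i j. mk_module (if i = 0 \<and> j = 0 then carrier R else {\<zero>\<^bsub>R\<^esub>})
     \<zero>\<^bsub>R\<^esub> (\<lambda>x y. x \<oplus>\<^bsub>R\<^esub> y) (\<lambda>r x. r \<otimes>\<^bsub>R\<^esub> x))"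

definition bg_associator ::
  "'r ring \<Rightarrow> ('r, 'a) bgmod \<Rightarrow> ('r, 'b) bgmod \<Rightarrow> ('r, 'c) bgmod \<Rightarrow>
   (('r, ('r, 'a, 'b) tens, 'c) tens, ('r, 'a, ('r, 'b, 'c) tens) tens) bgmap" where
  "bg_associator R A B C = (THE h.
     h \<in> bg_maps R (bg_tensor R (bg_tensor R A B) C) (bg_tensor R A (bg_tensor R B C)) 0 0 \<and>
     (\<forall>p q s t k l. \<forall>a \<in> carrier (A p q). \<forall>b \<in> carrier (B s t). \<forall>c \<in> carrier (C k l).
        h (p + s + k) (q + t + l)
          (bg_pure R (bg_tensor R A B) C (p + s) (q + t) k l (bg_pure R A B p q s t a b) c) =
        bg_pure R A (bg_tensor R B C) p q (s + k) (t + l) a (bg_pure R B C s t k l b c)))"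

definition bg_left_unitor :: "'r ring \<Rightarrow> ('r, 'a) bgmod \<Rightarrow> (('r, 'r, 'a) tens, 'a) bgmap" where
  "bg_left_unitor R A = (THE h. h \<in> bg_maps R (bg_tensor R (bg_unit R) A) A 0 0 \<and>
     (\<forall>i j. \<forall>r \<in> carrier R. \<forall>a \<in> carrier (A i j).
        h i j (bg_pure R (bg_unit R) A 0 0 i j r a) = r \<odot>\<^bsub>A i j\<^esub> a))"

definition bg_right_unitor :: "'r ring \<Rightarrow> ('r, 'a) bgmod \<Rightarrow> (('r, 'a, 'r) tens, 'a) bgmap" where
  "bg_right_unitor R A = (THE h. h \<in> bg_maps R (bg_tensor R A (bg_unit R)) A 0 0 \<and>
     (\<forall>i j. \<forall>r \<in> carrier R. \<forall>a \<in> carrier (A i j).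
        h i j (bg_pure R A (bg_unit R) i j 0 0 a r) = r \<odot>\<^bsub>A i j\<^esub> a))"

text \<open>The map \<open>R \<rightarrow> H\<close> out of the monoidal unit given by an element \<open>e\<close> of bidegree \<open>(0, 0)\<close>.\<close>

definition bg_elem :: "'r ring \<Rightarrow> ('r, 'a) bgmod \<Rightarrow> 'a \<Rightarrow> ('r, 'a) bgmap" where
  "bg_elem R H e = (\<lambda>i j. \<lambda>r \<in> carrier (bg_unit R i j).
     if i = 0 \<and> j = 0 then r \<odot>\<^bsub>H 0 0\<^esub> e else \<zero>\<^bsub>H i j\<^esub>)"

definition bg_zero :: "('r, 'a) bgmod \<Rightarrow> ('r, 'b) bgmod \<Rightarrow> int \<Rightarrow> int \<Rightarrow> ('a, 'b) bgmap" where
  "bg_zero A B p q = (\<lambda>i j. \<lambda>x \<in> carrier (A i j). \<zero>\<^bsub>B (i + p) (j + q)\<^esub>)"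


section \<open>The monoidal category of vertical bicomplexes\<close>

type_synonym ('r, 'a) vbc = "('r, 'a) bgmod \<times> ('a, 'a) bgmap"

definition vertical_bicomplex :: "'r ring \<Rightarrow> ('r, 'a) vbc \<Rightarrow> bool" where
  "vertical_bicomplex R X \<longleftrightarrow> (case X of (A, d) \<Rightarrow>
     bigraded_module R A \<and> d \<in> bg_maps R A A 0 1 \<and>
     (\<forall>i j. \<forall>x \<in> carrier (A i j). d i (j + 1) (d i j x) = \<zero>\<^bsub>A i (j + 1 + 1)\<^esub>))"

definition vb_maps :: "'r ring \<Rightarrow> ('r, 'a) vbc \<Rightarrow> ('r, 'b) vbc \<Rightarrow> ('a, 'b) bgmap set" where
  "vb_maps R X Y = (case (X, Y) of ((A, d), (B, d')) \<Rightarrow>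
     {f \<in> bg_maps R A B 0 0.
        \<forall>i j. \<forall>x \<in> carrier (A i j). d' i j (f i j x) = f i (j + 1) (d i j x)})"

definition vb_tensor ::
  "'r ring \<Rightarrow> ('r, 'a) vbc \<Rightarrow> ('r, 'b) vbc \<Rightarrow> ('r, ('r, 'a, 'b) tens) vbc" where
  "vb_tensor R X Y = (case (X, Y) of ((A, d), (B, d')) \<Rightarrow>
     (bg_tensor R A B,
      \<lambda>i j. \<lambda>x \<in> carrier (bg_tensor R A B i j).
        bg_tens R A B A B 0 1 0 0 d (bg_id B) i j x
          \<oplus>\<^bsub>bg_tensor R A B i (j + 1)\<^esub>
        bg_tens R A B A B 0 0 0 1 (bg_id A) d' i j x))"

definition vb_unit :: "'r ring \<Rightarrow> ('r, 'r) vbc" where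
  "vb_unit R = (bg_unit R, bg_zero (bg_unit R) (bg_unit R) 0 1)"


section \<open>Enriched categories and functors\<close>

text \<open>\<open>Comp C X Y Z : Hom C Y Z \<otimes> Hom C X Y \<rightarrow> Hom C X Z\<close>.\<close>

record ('o, 'r, 'h) bg_cat =
  Ob :: "'o set"
  Hom :: "'o \<Rightarrow> 'o \<Rightarrow> ('r, 'h) bgmod"
  Comp :: "'o \<Rightarrow> 'o \<Rightarrow> 'o \<Rightarrow> (('r, 'h, 'h) tens, 'h) bgmap"
  Unit :: "'o \<Rightarrow> ('r, 'h) bgmap"

definition bg_category :: "'r ring \<Rightarrow> ('o, 'r, 'h, 'z) bg_cat_scheme \<Rightarrow> bool" where
  "bg_category R C \<longleftrightarrow>
     (\<forall>X \<in> Ob C. \<forall>Y \<in> Ob C. bigraded_module R (Hom C X Y)) \<and>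
     (\<forall>X \<in> Ob C. \<forall>Y \<in> Ob C. \<forall>Z \<in> Ob C.
        Comp C X Y Z \<in> bg_maps R (bg_tensor R (Hom C Y Z) (Hom C X Y)) (Hom C X Z) 0 0) \<and>
     (\<forall>X \<in> Ob C. Unit C X \<in> bg_maps R (bg_unit R) (Hom C X X) 0 0) \<and>
     (\<forall>X \<in> Ob C. \<forall>Y \<in> Ob C. \<forall>Z \<in> Ob C. \<forall>W \<in> Ob C.
        (let P = Hom C Z W; Q = Hom C Y Z; S = Hom C X Y;
             T = bg_tensor R (bg_tensor R P Q) S in
         bg_comp T (Comp C X Y W)
           (bg_tens R (bg_tensor R P Q) S (Hom C Y W) S 0 0 0 0 (Comp C Y Z W) (bg_id S)) =
         bg_comp T (Comp C X Z W)
           (bg_comp T (bg_tens R P (bg_tensor R Q S) P (Hom C X Z) 0 0 0 0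
                         (bg_id P) (Comp C X Y Z))
              (bg_associator R P Q S)))) \<and>
     (\<forall>X \<in> Ob C. \<forall>Y \<in> Ob C. (let H = Hom C X Y in
         bg_comp (bg_tensor R (bg_unit R) H) (Comp C X Y Y)
           (bg_tens R (bg_unit R) H (Hom C Y Y) H 0 0 0 0 (Unit C Y) (bg_id H)) =
         bg_left_unitor R H \<and>
         bg_comp (bg_tensor R H (bg_unit R)) (Comp C X X Y)
           (bg_tens R H (bg_unit R) H (Hom C X X) 0 0 0 0 (bg_id H) (Unit C X)) =
         bg_right_unitor R H))"

text \<open>
  Forgetting differentials is a faithful strict monoidal functor from vertical bicomplexes to
  bigraded modules. So a category enriched in vertical bicomplexes consists of a category
  enriched in bigraded modules and differentials on its hom-objects, for which composition and
  units are morphisms of vertical bicomplexes.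
\<close>

record ('o, 'r, 'h) vb_cat = "('o, 'r, 'h) bg_cat" +
  HDiff :: "'o \<Rightarrow> 'o \<Rightarrow> ('h, 'h) bgmap"

definition VHom :: "('o, 'r, 'h, 'z) vb_cat_scheme \<Rightarrow> 'o \<Rightarrow> 'o \<Rightarrow> ('r, 'h) vbc" where
  "VHom C X Y = (Hom C X Y, HDiff C X Y)"

definition vb_category :: "'r ring \<Rightarrow> ('o, 'r, 'h) vb_cat \<Rightarrow> bool" where
  "vb_category R C \<longleftrightarrow> bg_category R C \<and>
     (\<forall>X \<in> Ob C. \<forall>Y \<in> Ob C. vertical_bicomplex R (VHom C X Y)) \<and>
     (\<forall>X \<in> Ob C. \<forall>Y \<in> Ob C. \<forall>Z \<in> Ob C.
        Comp C X Y Z \<in> vb_maps R (vb_tensor R (VHom C Y Z) (VHom C X Y)) (VHom C X Z)) \<and>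
     (\<forall>X \<in> Ob C. Unit C X \<in> vb_maps R (vb_unit R) (VHom C X X))"

record ('o, 'p, 'h, 'k) efunctor =
  FOb :: "'o \<Rightarrow> 'p"
  FHom :: "'o \<Rightarrow> 'o \<Rightarrow> ('h, 'k) bgmap"

definition bg_functor ::
  "'r ring \<Rightarrow> ('o, 'r, 'h, 'y) bg_cat_scheme \<Rightarrow> ('p, 'r, 'k, 'z) bg_cat_scheme \<Rightarrow>
   ('o, 'p, 'h, 'k) efunctor \<Rightarrow> bool" where
  "bg_functor R C D F \<longleftrightarrow> bg_category R C \<and> bg_category R D \<and>
     (\<forall>X \<in> Ob C. FOb F X \<in> Ob D) \<and>
     (\<forall>X \<in> Ob C. \<forall>Y \<in> Ob C.
        FHom F X Y \<in> bg_maps R (Hom C X Y) (Hom D (FOb F X) (FOb F Y)) 0 0) \<and>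
     (\<forall>X \<in> Ob C. \<forall>Y \<in> Ob C. \<forall>Z \<in> Ob C.
        (let T = bg_tensor R (Hom C Y Z) (Hom C X Y) in
         bg_comp T (FHom F X Z) (Comp C X Y Z) =
         bg_comp T (Comp D (FOb F X) (FOb F Y) (FOb F Z))
           (bg_tens R (Hom C Y Z) (Hom C X Y)
              (Hom D (FOb F Y) (FOb F Z)) (Hom D (FOb F X) (FOb F Y)) 0 0 0 0
              (FHom F Y Z) (FHom F X Y)))) \<and>
     (\<forall>X \<in> Ob C. bg_comp (bg_unit R) (FHom F X X) (Unit C X) = Unit D (FOb F X))"

definition vb_functor ::
  "'r ring \<Rightarrow> ('o, 'r, 'h) vb_cat \<Rightarrow> ('p, 'r, 'k) vb_cat \<Rightarrow>
   ('o, 'p, 'h, 'k) efunctor \<Rightarrow> bool" where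
  "vb_functor R C D F \<longleftrightarrow> vb_category R C \<and> vb_category R D \<and> bg_functor R C D F \<and>
     (\<forall>X \<in> Ob C. \<forall>Y \<in> Ob C.
        FHom F X Y \<in> vb_maps R (VHom C X Y) (VHom D (FOb F X) (FOb F Y)))"

text \<open>\<open>G\<close> is inverse to \<open>F\<close>: both composites are the identity on objects and on hom-objects.\<close>

definition mutually_inverse ::
  "('o, 'r, 'h, 'y) bg_cat_scheme \<Rightarrow> ('p, 'r, 'k, 'z) bg_cat_scheme \<Rightarrow>
   ('o, 'p, 'h, 'k) efunctor \<Rightarrow> ('p, 'o, 'k, 'h) efunctor \<Rightarrow> bool" where
  "mutually_inverse C D F G \<longleftrightarrow>
     (\<forall>X \<in> Ob C. FOb G (FOb F X) = X) \<and>
     (\<forall>X \<in> Ob D. FOb F (FOb G X) = X) \<and>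
     (\<forall>X \<in> Ob C. \<forall>Y \<in> Ob C.
        bg_comp (Hom C X Y) (FHom G (FOb F X) (FOb F Y)) (FHom F X Y) = bg_id (Hom C X Y)) \<and>
     (\<forall>X \<in> Ob D. \<forall>Y \<in> Ob D.
        bg_comp (Hom D X Y) (FHom F (FOb G X) (FOb G Y)) (FHom G X Y) = bg_id (Hom D X Y))"

definition bg_isomorphism ::
  "'r ring \<Rightarrow> ('o, 'r, 'h, 'y) bg_cat_scheme \<Rightarrow> ('p, 'r, 'k, 'z) bg_cat_scheme \<Rightarrow>
   ('o, 'p, 'h, 'k) efunctor \<Rightarrow> bool" where
  "bg_isomorphism R C D F \<longleftrightarrow> bg_functor R C D F \<and>
     (\<exists>G. bg_functor R D C G \<and> mutually_inverse C D F G)"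

definition vb_isomorphism ::
  "'r ring \<Rightarrow> ('o, 'r, 'h) vb_cat \<Rightarrow> ('p, 'r, 'k) vb_cat \<Rightarrow>
   ('o, 'p, 'h, 'k) efunctor \<Rightarrow> bool" where
  "vb_isomorphism R C D F \<longleftrightarrow> vb_functor R C D F \<and>
     (\<exists>G. vb_functor R D C G \<and> mutually_inverse C D F G)"

text \<open>
  The full enriched subcategory on objects of \<open>C\<close> equipped with additional data: the objects are
  the elements of \<open>S\<close>, and \<open>U\<close> forgets the additional data.
\<close>

definition bg_full_on ::
  "('o, 'r, 'h) bg_cat \<Rightarrow> 'p set \<Rightarrow> ('p \<Rightarrow> 'o) \<Rightarrow> ('p, 'r, 'h) bg_cat" where
  "bg_full_on C S U =
     \<lparr>Ob = S, Hom = \<lambda>X Y. Hom C (U X) (U Y), Comp = \<lambda>X Y Z. Comp C (U X) (U Y) (U Z),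
      Unit = \<lambda>X. Unit C (U X)\<rparr>"

definition vb_full_on ::
  "('o, 'r, 'h) vb_cat \<Rightarrow> 'p set \<Rightarrow> ('p \<Rightarrow> 'o) \<Rightarrow> ('p, 'r, 'h) vb_cat" where
  "vb_full_on C S U =
     \<lparr>Ob = S, Hom = \<lambda>X Y. Hom C (U X) (U Y), Comp = \<lambda>X Y Z. Comp C (U X) (U Y) (U Z),
      Unit = \<lambda>X. Unit C (U X), HDiff = \<lambda>X Y. HDiff C (U X) (U Y)\<rparr>"

text \<open>
  \<open>J\<close> identifies the category \<open>C\<close> enriched in bigraded modules with a full subcategory of the
  category \<open>D\<close> enriched in vertical bicomplexes, all of whose hom-objects have zero differential.
\<close>

definition full_zero_embedding ::
  "('o, 'r, 'h) bg_cat \<Rightarrow> ('p, 'r, 'h) vb_cat \<Rightarrow> ('o \<Rightarrow> 'p) \<Rightarrow> bool" where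
  "full_zero_embedding C D J \<longleftrightarrow> inj_on J (Ob C) \<and> J ` Ob C \<subseteq> Ob D \<and>
     (\<forall>X \<in> Ob C. Unit D (J X) = Unit C X) \<and>
     (\<forall>X \<in> Ob C. \<forall>Y \<in> Ob C. Hom D (J X) (J Y) = Hom C X Y \<and>
        HDiff D (J X) (J Y) = bg_zero (Hom C X Y) (Hom C X Y) 0 1) \<and>
     (\<forall>X \<in> Ob C. \<forall>Y \<in> Ob C. \<forall>Z \<in> Ob C. Comp D (J X) (J Y) (J Z) = Comp C X Y Z)"


section \<open>Bigraded modules and twisted complexes as enriched categories\<close>

type_synonym ('a, 'b) bgseq = "nat \<Rightarrow> ('a, 'b) bgmap"

definition bg_hom ::
  "'r ring \<Rightarrow> ('r, 'a) bgmod \<Rightarrow> ('r, 'b) bgmod \<Rightarrow> ('r, ('a, 'b) bgseq) bgmod" where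
  "bg_hom R A B = (\<lambda>u v. mk_module
     {f. \<forall>m. f m \<in> bg_maps R A B (u - int m) (v - int m)}
     (\<lambda>m. bg_zero A B (u - int m) (v - int m))
     (\<lambda>f g m i j. \<lambda>x \<in> carrier (A i j).
        f m i j x \<oplus>\<^bsub>B (i + (u - int m)) (j + (v - int m))\<^esub> g m i j x)
     (\<lambda>r f m i j. \<lambda>x \<in> carrier (A i j).
        r \<odot>\<^bsub>B (i + (u - int m)) (j + (v - int m))\<^esub> f m i j x))"

text \<open>
  The composite \<open>c(f, g)\<close> of \<open>g : A \<rightarrow> B\<close> of bidegree \<open>(u', v')\<close> and \<open>f : B \<rightarrow> C\<close> of bidegree
  \<open>(u, v)\<close>, given in degree \<open>m\<close> by the sum over \<open>k \<le> m\<close> of \<open>(-1)\<^bsup>k (v' - u')\<^esup> f\<^sub>k g\<^bsub>m - k\<^esub>\<close>.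
\<close>

definition bg_hom_comp ::
  "('r, 'a) bgmod \<Rightarrow> ('r, 'c) bgmod \<Rightarrow> int \<Rightarrow> int \<Rightarrow> int \<Rightarrow> int \<Rightarrow>
   ('b, 'c) bgseq \<Rightarrow> ('a, 'b) bgseq \<Rightarrow> ('a, 'c) bgseq" where
  "bg_hom_comp A C u v u' v' f g = (\<lambda>m i j. \<lambda>x \<in> carrier (A i j).
     (let M = C (i + (u + u' - int m)) (j + (v + v' - int m)) in
      \<Oplus>\<^bsub>M\<^esub> k \<in> {..m}. sign_pow M (int k * (v' - u'))
        (f k (i + (u' - int (m - k))) (j + (v' - int (m - k))) (g (m - k) i j x))))"

definition bg_hom_id :: "('r, 'a) bgmod \<Rightarrow> ('a, 'a) bgseq" where
  "bg_hom_id A = (\<lambda>m. if m = 0 then bg_id A else bg_zero A A (- int m) (- int m))"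

definition bgMod_cat :: "'r ring \<Rightarrow> (('r, 'a) bgmod, 'r, ('a, 'a) bgseq) bg_cat" where
  "bgMod_cat R =
     \<lparr>Ob = {A. bigraded_module R A},
      Hom = bg_hom R,
      Comp = \<lambda>A B C. bg_lift R (bg_hom R B C) (bg_hom R A B) (bg_hom R A C) 0 0
        (\<lambda>u v u' v' f g. bg_hom_comp A C u v u' v' f g),
      Unit = \<lambda>A. bg_elem R (bg_hom R A A) (bg_hom_id A)\<rparr>"

record ('r, 'a) tcomplex =
  tmod :: "('r, 'a) bgmod"
  tdiff :: "('a, 'a) bgseq"

definition twisted_complex :: "'r ring \<Rightarrow> ('r, 'a) tcomplex \<Rightarrow> bool" where
  "twisted_complex R T \<longleftrightarrow> (let A = tmod T; d = tdiff T in
     bigraded_module R A \<and>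
     (\<forall>m. d m \<in> bg_maps R A A (- int m) (- int m + 1)) \<and>
     (\<forall>m p q. \<forall>x \<in> carrier (A p q). (let M = A (p - int m) (q - int m + 2) in
        (\<Oplus>\<^bsub>M\<^esub> i \<in> {..m}. sign_pow M (int i)
           (d i (p - int (m - i)) (q - int (m - i) + 1) (d (m - i) p q x))) = \<zero>\<^bsub>M\<^esub>)))"

definition tC_diff ::
  "'r ring \<Rightarrow> ('r, 'a) tcomplex \<Rightarrow> ('r, 'b) tcomplex \<Rightarrow>
   (('a, 'b) bgseq, ('a, 'b) bgseq) bgmap" where
  "tC_diff R S T = (let A = tmod S; B = tmod T; H = bg_hom R A B in
     (\<lambda>u v. \<lambda>f \<in> carrier (H u v).
       bg_hom_comp A B 0 1 u v (tdiff T) f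
         \<ominus>\<^bsub>H u (v + 1)\<^esub>
       sign_pow (H u (v + 1)) v (bg_hom_comp A B u v 0 1 f (tdiff S))))"

definition tC :: "'r ring \<Rightarrow> (('r, 'a) tcomplex, 'r, ('a, 'a) bgseq) vb_cat" where
  "tC R =
     \<lparr>Ob = {T. twisted_complex R T},
      Hom = \<lambda>S T. Hom (bgMod_cat R) (tmod S) (tmod T),
      Comp = \<lambda>S T V. Comp (bgMod_cat R) (tmod S) (tmod T) (tmod V),
      Unit = \<lambda>T. Unit (bgMod_cat R) (tmod T),
      HDiff = tC_diff R\<rparr>"

definition tC_of_bgmod :: "('r, 'a) bgmod \<Rightarrow> ('r, 'a) tcomplex" where
  "tC_of_bgmod A = \<lparr>tmod = A, tdiff = \<lambda>m. bg_zero A A (- int m) (- int m + 1)\<rparr>"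


section \<open>Filtered modules and filtered complexes as enriched categories\<close>

text \<open>\<open>fgr K n\<close> is \<open>K\<^sup>n\<close> and \<open>fil K p n\<close> is \<open>F\<^sub>p K\<^sup>n\<close>.\<close>

record ('r, 'k) fmodule =
  fgr :: "int \<Rightarrow> ('r, 'k) module"
  fil :: "int \<Rightarrow> int \<Rightarrow> 'k set"

definition filtered_module :: "'r ring \<Rightarrow> ('r, 'k) fmodule \<Rightarrow> bool" where
  "filtered_module R K \<longleftrightarrow>
     (\<forall>n. module R (fgr K n)) \<and>
     (\<forall>p n. submodule (fil K p n) R (fgr K n)) \<and>
     (\<forall>p n. fil K p n \<subseteq> fil K (p + 1) n) \<and>
     (\<forall>n. (\<Union>p. fil K p n) = carrier (fgr K n))"

definition fMod_hom ::
  "'r ring \<Rightarrow> ('r, 'k) fmodule \<Rightarrow> ('r, 'l) fmodule \<Rightarrow> ('r, int \<Rightarrow> 'k \<Rightarrow> 'l) bgmod" where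
  "fMod_hom R K L = (\<lambda>u v. mk_module
     {f. (\<forall>m. f m \<in> lin R (fgr K m) (fgr L (m + v - u))) \<and>
         (\<forall>q m. f m ` fil K q m \<subseteq> fil L (q + u) (m + v - u))}
     (\<lambda>m. \<lambda>x \<in> carrier (fgr K m). \<zero>\<^bsub>fgr L (m + v - u)\<^esub>)
     (\<lambda>f g m. \<lambda>x \<in> carrier (fgr K m). f m x \<oplus>\<^bsub>fgr L (m + v - u)\<^esub> g m x)
     (\<lambda>r f m. \<lambda>x \<in> carrier (fgr K m). r \<odot>\<^bsub>fgr L (m + v - u)\<^esub> f m x))"

definition fMod_comp ::
  "('r, 'k) fmodule \<Rightarrow> ('r, 'n) fmodule \<Rightarrow> int \<Rightarrow> int \<Rightarrow> int \<Rightarrow> int \<Rightarrow>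
   (int \<Rightarrow> 'l \<Rightarrow> 'n) \<Rightarrow> (int \<Rightarrow> 'k \<Rightarrow> 'l) \<Rightarrow> int \<Rightarrow> 'k \<Rightarrow> 'n" where
  "fMod_comp K N u v u' v' f g = (\<lambda>m. \<lambda>x \<in> carrier (fgr K m).
     sign_pow (fgr N (m + (v + v') - (u + u'))) (u * (v' - u')) (f (m + v' - u') (g m x)))"

definition fMod_id :: "('r, 'k) fmodule \<Rightarrow> int \<Rightarrow> 'k \<Rightarrow> 'k" where
  "fMod_id K = (\<lambda>m. \<lambda>x \<in> carrier (fgr K m). x)"

definition fMod :: "'r ring \<Rightarrow> (('r, 'k) fmodule, 'r, int \<Rightarrow> 'k \<Rightarrow> 'k) bg_cat" where
  "fMod R =
     \<lparr>Ob = {K. filtered_module R K},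
      Hom = fMod_hom R,
      Comp = \<lambda>K L N. bg_lift R (fMod_hom R L N) (fMod_hom R K L) (fMod_hom R K N) 0 0
        (\<lambda>u v u' v' f g. fMod_comp K N u v u' v' f g),
      Unit = \<lambda>K. bg_elem R (fMod_hom R K K) (fMod_id K)\<rparr>"

record ('r, 'k) fcomplex =
  fmod :: "('r, 'k) fmodule"
  fdiff :: "int \<Rightarrow> 'k \<Rightarrow> 'k"

definition filtered_complex :: "'r ring \<Rightarrow> ('r, 'k) fcomplex \<Rightarrow> bool" where
  "filtered_complex R X \<longleftrightarrow> (let K = fmod X; d = fdiff X in
     filtered_module R K \<and>
     (\<forall>n. d n \<in> lin R (fgr K n) (fgr K (n + 1))) \<and>
     (\<forall>n. \<forall>x \<in> carrier (fgr K n). d (n + 1) (d n x) = \<zero>\<^bsub>fgr K (n + 1 + 1)\<^esub>) \<and>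
     (\<forall>p n. d n ` fil K p n \<subseteq> fil K p (n + 1)))"

definition fC_diff ::
  "'r ring \<Rightarrow> ('r, 'k) fcomplex \<Rightarrow> ('r, 'l) fcomplex \<Rightarrow>
   (int \<Rightarrow> 'k \<Rightarrow> 'l, int \<Rightarrow> 'k \<Rightarrow> 'l) bgmap" where
  "fC_diff R X Y = (let K = fmod X; L = fmod Y in
     (\<lambda>u v. \<lambda>f \<in> carrier (fMod_hom R K L u v). \<lambda>m. \<lambda>x \<in> carrier (fgr K m).
       (let M = fgr L (m + (v + 1) - u) in
        fdiff Y (m + v - u) (f m x) \<ominus>\<^bsub>M\<^esub> sign_pow M (v - u) (f (m + 1) (fdiff X m x)))))"

definition fC :: "'r ring \<Rightarrow> (('r, 'k) fcomplex, 'r, int \<Rightarrow> 'k \<Rightarrow> 'k) vb_cat" where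
  "fC R =
     \<lparr>Ob = {X. filtered_complex R X},
      Hom = \<lambda>X Y. Hom (fMod R) (fmod X) (fmod Y),
      Comp = \<lambda>X Y Z. Comp (fMod R) (fmod X) (fmod Y) (fmod Z),
      Unit = \<lambda>X. Unit (fMod R) (fmod X),
      HDiff = fC_diff R\<rparr>"

definition fC_of_fmodule :: "('r, 'k) fmodule \<Rightarrow> ('r, 'k) fcomplex" where
  "fC_of_fmodule K =
     \<lparr>fmod = K, fdiff = \<lambda>n. \<lambda>x \<in> carrier (fgr K n). \<zero>\<^bsub>fgr K (n + 1)\<^esub>\<rparr>"


section \<open>Totalization\<close>

text \<open>An element \<open>a\<close> of \<open>Tot(A)\<^sup>n\<close> is the family of its components \<open>a i\<close> in \<open>A\<^sub>i\<^bsup>n+i\<^esup>\<close>.\<close>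

definition Tot_gr :: "('r, 'a) bgmod \<Rightarrow> int \<Rightarrow> ('r, int \<Rightarrow> 'a) module" where
  "Tot_gr A n = mk_module
     {a. (\<forall>i. a i \<in> carrier (A i (n + i))) \<and> finite {i. i > 0 \<and> a i \<noteq> \<zero>\<^bsub>A i (n + i)\<^esub>}}
     (\<lambda>i. \<zero>\<^bsub>A i (n + i)\<^esub>)
     (\<lambda>a b i. a i \<oplus>\<^bsub>A i (n + i)\<^esub> b i)
     (\<lambda>r a i. r \<odot>\<^bsub>A i (n + i)\<^esub> a i)"

definition Tot_mod :: "('r, 'a) bgmod \<Rightarrow> ('r, int \<Rightarrow> 'a) fmodule" where
  "Tot_mod A =
     \<lparr>fgr = Tot_gr A,
      fil = \<lambda>p n. {a \<in> carrier (Tot_gr A n). \<forall>i. i > p \<longrightarrow> a i = \<zero>\<^bsub>A i (n + i)\<^esub>}\<rparr>"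

text \<open>
  The formulas for the differential and for \<open>Tot(f)\<close> are sums over all \<open>m \<ge> 0\<close>. Only finitely
  many components \<open>a (j + m)\<close> are nonzero; the sums run over these \<open>m\<close>, since
  \<^const>\<open>finsum\<close> is trivial on infinite index sets.
\<close>

definition Tot_diff :: "('r, 'a) tcomplex \<Rightarrow> int \<Rightarrow> (int \<Rightarrow> 'a) \<Rightarrow> (int \<Rightarrow> 'a)" where
  "Tot_diff T = (let A = tmod T in (\<lambda>n. \<lambda>a \<in> carrier (Tot_gr A n). \<lambda>j.
     (let M = A j (n + 1 + j) in
      \<Oplus>\<^bsub>M\<^esub> m \<in> {m. a (j + int m) \<noteq> \<zero>\<^bsub>A (j + int m) (n + (j + int m))\<^esub>}.
        sign_pow M (int m * n) (tdiff T m (j + int m) (n + (j + int m)) (a (j + int m))))))"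

text \<open>The component of \<open>Tot(f)(a)\<close> at \<open>k\<close> is given by the formula for index \<open>j + u = k\<close>.\<close>

definition Tot_map ::
  "('r, 'a) bgmod \<Rightarrow> ('r, 'b) bgmod \<Rightarrow> int \<Rightarrow> int \<Rightarrow> ('a, 'b) bgseq \<Rightarrow>
   int \<Rightarrow> (int \<Rightarrow> 'a) \<Rightarrow> (int \<Rightarrow> 'b)" where
  "Tot_map A B u v f = (\<lambda>n. \<lambda>a \<in> carrier (Tot_gr A n). \<lambda>k.
     (let j = k - u; M = B (j + u) (n + v - u + (j + u)) in
      \<Oplus>\<^bsub>M\<^esub> m \<in> {m. a (j + int m) \<noteq> \<zero>\<^bsub>A (j + int m) (n + (j + int m))\<^esub>}.
        sign_pow M ((int m + u) * n) (f m (j + int m) (n + (j + int m)) (a (j + int m)))))"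

definition Tot_complex :: "('r, 'a) tcomplex \<Rightarrow> ('r, int \<Rightarrow> 'a) fcomplex" where
  "Tot_complex T = \<lparr>fmod = Tot_mod (tmod T), fdiff = Tot_diff T\<rparr>"

definition Tot_hom ::
  "'r ring \<Rightarrow> ('r, 'a) bgmod \<Rightarrow> ('r, 'b) bgmod \<Rightarrow>
   (('a, 'b) bgseq, int \<Rightarrow> (int \<Rightarrow> 'a) \<Rightarrow> (int \<Rightarrow> 'b)) bgmap" where
  "Tot_hom R A B = (\<lambda>u v. \<lambda>f \<in> carrier (bg_hom R A B u v). Tot_map A B u v f)"

definition Tot_tC ::
  "'r ring \<Rightarrow> (('r, 'a) tcomplex, ('r, int \<Rightarrow> 'a) fcomplex,
     ('a, 'a) bgseq, int \<Rightarrow> (int \<Rightarrow> 'a) \<Rightarrow> (int \<Rightarrow> 'a)) efunctor" where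
  "Tot_tC R = \<lparr>FOb = Tot_complex, FHom = \<lambda>S T. Tot_hom R (tmod S) (tmod T)\<rparr>"

definition Tot_bgMod ::
  "'r ring \<Rightarrow> (('r, 'a) bgmod, ('r, int \<Rightarrow> 'a) fmodule,
     ('a, 'a) bgseq, int \<Rightarrow> (int \<Rightarrow> 'a) \<Rightarrow> (int \<Rightarrow> 'a)) efunctor" where
  "Tot_bgMod R = \<lparr>FOb = Tot_mod, FHom = Tot_hom R\<rparr>"


section \<open>Split filtered modules and complexes\<close>

text \<open>The bigraded module \<open>A\<close> is part of the data of a split filtered complex or module.\<close>

definition sfC ::
  "'r ring \<Rightarrow> (('r, int \<Rightarrow> 'a) fcomplex \<times> ('r, 'a) bgmod, 'r,
     int \<Rightarrow> (int \<Rightarrow> 'a) \<Rightarrow> (int \<Rightarrow> 'a)) vb_cat" where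
  "sfC R = vb_full_on (fC R)
     {(K, A). filtered_complex R K \<and> bigraded_module R A \<and> fmod K = Tot_mod A} fst"

definition sfMod ::
  "'r ring \<Rightarrow> (('r, int \<Rightarrow> 'a) fmodule \<times> ('r, 'a) bgmod, 'r,
     int \<Rightarrow> (int \<Rightarrow> 'a) \<Rightarrow> (int \<Rightarrow> 'a)) bg_cat" where
  "sfMod R = bg_full_on (fMod R)
     {(K, A). filtered_module R K \<and> bigraded_module R A \<and> K = Tot_mod A} fst"

text \<open>The corestriction of a functor that sends \<open>X\<close> to \<open>F X\<close> equipped with the data \<open>s X\<close>.\<close>

definition corestrict ::
  "('o, 'p, 'h, 'k) efunctor \<Rightarrow> ('o \<Rightarrow> 's) \<Rightarrow> ('o, 'p \<times> 's, 'h, 'k) efunctor" where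
  "corestrict F s = \<lparr>FOb = \<lambda>X. (FOb F X, s X), FHom = FHom F\<rparr>"

end

theory Submission
  imports Defs
begin

text \<open>
  A filtered map between total objects is determined by the images of elements with a single
  nonzero component, and the component of such an image that lies \<open>m\<close> steps below the top filtration
  degree depends linearly on the element. These components are, up to sign, the maps \<open>f\<^sub>m\<close>; hence
  totalization is bijective on hom-objects. Under this bijection composition of filtered maps becomes
  the twisted composition \<open>c(f, g)\<close>, whose associativity is thereby reduced to that of composition
  of maps. Both differentials have the form \<open>\<delta>(f) = c(d, f) - (-1)\<^sup>v c(f, d)\<close> for an element \<open>d\<close> of
  bidegree \<open>(0, 1)\<close> with \<open>c(d, d) = 0\<close>, where \<open>v\<close> is the vertical degree of \<open>f\<close>; this gives
  \<open>\<delta>\<^sup>2 = 0\<close> and the Leibniz rule formally, and totalization maps \<open>d\<close> to \<open>d\<close>.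
\<close>

section \<open>Modules and linear maps\<close>

text \<open>The column filtration is what makes totalization full. An element of Tot(A) may have
  infinitely many nonzero components at negative indices, so it is no finite sum of elements with
  one component. But a map of bidegree (u, v) sends F_p into F_(p+u), so component k of an image
  sees only the components at indices from k - u on, and finitely many of these are nonzero. The
  signs are tied together: Tot puts (m + u) n on f_m in degree n, composition of filtered maps puts
  u |g|, and in a composite everything except k |g| occurs twice. The same u |g|, for g the
  differential, turns the sign (-1)^v of the commutator into (-1)^|f|. The formal burden is that
  composition, associators and unitors are picked by \<open>THE\<close> among maps out of tensor
  products, which are quotients of free modules. So the universal property comes first; then each
  enriched axiom is checked on pure tensors, and locales restate the axioms for elements. Bidegrees
  often agree only up to arithmetic, which is why many lemmas carry the target bidegree as a
  variable with an equation.\<close>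

lemma mk_module_simps [simp]:
  "carrier (mk_module S z p s) = S"
  "zero (mk_module S z p s) = z"
  "add (mk_module S z p s) = p"
  "smult (mk_module S z p s) = s"
  by (simp_all add: mk_module_def)

text \<open>The maps \<open>e k\<close> are jointly injective and respect the operations, so every
  module law holds because it holds in each \<open>N k\<close>; only closure of \<open>S\<close>
  remains to be shown. Direct sums, both kinds of hom-objects and Tot are instances.\<close>

lemma module_mk_by_evaluations:
  assumes R: "cring R"
    and N: "\<And>k. k \<in> K \<Longrightarrow> module R (N k)"
    and ev: "\<And>k x. k \<in> K \<Longrightarrow> x \<in> S \<Longrightarrow> e k x \<in> carrier (N k)"
    and inj: "\<And>x y. x \<in> S \<Longrightarrow> y \<in> S \<Longrightarrow> (\<And>k. k \<in> K \<Longrightarrow> e k x = e k y) \<Longrightarrow> x = y"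
    and z: "z \<in> S" and ez: "\<And>k. k \<in> K \<Longrightarrow> e k z = \<zero>\<^bsub>N k\<^esub>"
    and p: "\<And>x y. x \<in> S \<Longrightarrow> y \<in> S \<Longrightarrow> p x y \<in> S"
    and ep: "\<And>k x y. k \<in> K \<Longrightarrow> x \<in> S \<Longrightarrow> y \<in> S \<Longrightarrow> e k (p x y) = e k x \<oplus>\<^bsub>N k\<^esub> e k y"
    and s: "\<And>r x. r \<in> carrier R \<Longrightarrow> x \<in> S \<Longrightarrow> s r x \<in> S"
    and es: "\<And>k r x. k \<in> K \<Longrightarrow> r \<in> carrier R \<Longrightarrow> x \<in> S \<Longrightarrow> e k (s r x) = r \<odot>\<^bsub>N k\<^esub> e k x"
  shows "module R (mk_module S z p s)"
proof (rule moduleI, goal_cases)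
  case 2
  interpret R: cring R by fact
  have ag: "abelian_group (N k)" if "k \<in> K" for k using N[OF that] by (rule module.axioms(2))
  have am: "abelian_monoid (N k)" if "k \<in> K" for k using ag[OF that] by (rule abelian_group.axioms(1))
  show ?case
  proof (rule abelian_groupI, goal_cases)
    case (3 x y w)
    then show ?case
      by (auto intro!: inj p simp: ep ev p abelian_monoid.a_assoc[OF am])
  next
    case (4 x y)
    then show ?case
      by (auto intro!: inj p simp: ep ev p abelian_monoid.a_comm[OF am])
  next
    case (5 x)
    then show ?case
      by (auto intro!: inj p z simp: ep ev ez p z abelian_monoid.l_zero[OF am])
  next
    case (6 x)
    \<comment> \<open>No negation is given on \<open>S\<close>; the scalar -1 provides the additive
      inverse.\<close>
    let ?y = "s (\<ominus>\<^bsub>R\<^esub> \<one>\<^bsub>R\<^esub>) x"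
    have y: "?y \<in> S" using 6 by (auto intro: s)
    have "e k (p ?y x) = e k z" if k: "k \<in> K" for k
    proof -
      interpret N: module R "N k" by (rule N[OF k])
      have x: "x \<in> S" using 6 by simp
      note k6 = k x
      show ?thesis
        using k6 y ev[OF k6]
        by (simp add: ep es ez N.smult_l_minus N.smult_one N.M.l_neg)
    qed
    then have "p ?y x = z" using 6 y by (auto intro!: inj p z)
    then show ?case using y by auto
  qed (auto intro: p z)
qed (auto intro!: inj intro: s p simp: R es ep ev s p module.smult_one[OF N]
  module.smult_l_distr[OF N] module.smult_r_distr[OF N] module.smult_assoc1[OF N]
  ring.ring_simprules[OF cring.axioms(1)[OF R]])

text \<open>The laws pass to the image of a homomorphism. That \<open>p\<close> and \<open>s\<close>
  are functions on the image contains the well-definedness, which has to be settled by the caller;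
  the use is for cosets.\<close>

lemma module_surjective_image:
  fixes M :: "('r, 'a) module"
  assumes M: "module R M" and S: "S = f ` carrier M" and z: "z = f \<zero>\<^bsub>M\<^esub>"
    and p: "\<And>x y. x \<in> carrier M \<Longrightarrow> y \<in> carrier M \<Longrightarrow> p (f x) (f y) = f (x \<oplus>\<^bsub>M\<^esub> y)"
    and s: "\<And>r x. r \<in> carrier R \<Longrightarrow> x \<in> carrier M \<Longrightarrow> s r (f x) = f (r \<odot>\<^bsub>M\<^esub> x)"
  shows "module R (mk_module S z p s)"
proof -
  interpret M: module R M by fact
  show ?thesis
  proof (rule moduleI, goal_cases)
    case 1 show ?case by (rule M.R.cring_axioms)
  next
    case 2 show ?case
    proof (rule abelian_groupI, goal_cases)
      case (6 x)
      then obtain x' where "x' \<in> carrier M" "x = f x'" by (auto simp: S)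
      then show ?case by (auto simp: S p z M.l_neg intro!: bexI[of _ "\<ominus>\<^bsub>M\<^esub> x'"])
    qed (auto simp: S p z M.a_ac)
  qed (auto simp: S p z s M.smult_l_distr M.smult_r_distr M.smult_assoc1)
qed

section \<open>Linear maps\<close>

lemma linI:
  assumes "f \<in> extensional (carrier M)"
    and "\<And>x. x \<in> carrier M \<Longrightarrow> f x \<in> carrier N"
    and "\<And>x y. x \<in> carrier M \<Longrightarrow> y \<in> carrier M \<Longrightarrow> f (x \<oplus>\<^bsub>M\<^esub> y) = f x \<oplus>\<^bsub>N\<^esub> f y"
    and "\<And>r x. r \<in> carrier R \<Longrightarrow> x \<in> carrier M \<Longrightarrow> f (r \<odot>\<^bsub>M\<^esub> x) = r \<odot>\<^bsub>N\<^esub> f x"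
  shows "f \<in> lin R M N"
  using assms by (auto simp: lin_def PiE_def)

lemma lin_restrictI:
  assumes M: "module R M"
    and "\<And>x. x \<in> carrier M \<Longrightarrow> f x \<in> carrier N"
    and "\<And>x y. x \<in> carrier M \<Longrightarrow> y \<in> carrier M \<Longrightarrow> f (x \<oplus>\<^bsub>M\<^esub> y) = f x \<oplus>\<^bsub>N\<^esub> f y"
    and "\<And>r x. r \<in> carrier R \<Longrightarrow> x \<in> carrier M \<Longrightarrow> f (r \<odot>\<^bsub>M\<^esub> x) = r \<odot>\<^bsub>N\<^esub> f x"
  shows "(\<lambda>x \<in> carrier M. f x) \<in> lin R M N"
proof -
  interpret M: module R M by fact
  show ?thesis by (rule linI) (auto simp: assms)
qed

lemma lin_closed: "f \<in> lin R M N \<Longrightarrow> x \<in> carrier M \<Longrightarrow> f x \<in> carrier N"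
  by (auto simp: lin_def)

lemma lin_add:
  "f \<in> lin R M N \<Longrightarrow> x \<in> carrier M \<Longrightarrow> y \<in> carrier M \<Longrightarrow> f (x \<oplus>\<^bsub>M\<^esub> y) = f x \<oplus>\<^bsub>N\<^esub> f y"
  by (auto simp: lin_def)

lemma lin_smult:
  "f \<in> lin R M N \<Longrightarrow> r \<in> carrier R \<Longrightarrow> x \<in> carrier M \<Longrightarrow> f (r \<odot>\<^bsub>M\<^esub> x) = r \<odot>\<^bsub>N\<^esub> f x"
  by (auto simp: lin_def)

lemma lin_extensional: "f \<in> lin R M N \<Longrightarrow> f \<in> extensional (carrier M)"
  by (auto simp: lin_def PiE_def)

lemma lin_ext:
  "f \<in> lin R M N \<Longrightarrow> g \<in> lin R M N' \<Longrightarrow> (\<And>x. x \<in> carrier M \<Longrightarrow> f x = g x) \<Longrightarrow> f = g"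
  by (rule extensionalityI[of _ "carrier M"]) (auto simp: lin_def PiE_def)

lemma lin_zero:
  assumes "module R M" "module R N" "f \<in> lin R M N"
  shows "f \<zero>\<^bsub>M\<^esub> = \<zero>\<^bsub>N\<^esub>"
proof -
  interpret M: module R M by fact
  interpret N: module R N by fact
  have "f (\<zero>\<^bsub>R\<^esub> \<odot>\<^bsub>M\<^esub> \<zero>\<^bsub>M\<^esub>) = \<zero>\<^bsub>R\<^esub> \<odot>\<^bsub>N\<^esub> f \<zero>\<^bsub>M\<^esub>"
    by (rule lin_smult[OF assms(3)]) auto
  then show ?thesis using lin_closed[OF assms(3), of "\<zero>\<^bsub>M\<^esub>"] by simp
qed

lemma lin_neg:
  assumes "module R M" "module R N" "f \<in> lin R M N" "x \<in> carrier M"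
  shows "f (\<ominus>\<^bsub>M\<^esub> x) = \<ominus>\<^bsub>N\<^esub> f x"
proof -
  interpret M: module R M by fact
  interpret N: module R N by fact
  have "f ((\<ominus>\<^bsub>R\<^esub> \<one>\<^bsub>R\<^esub>) \<odot>\<^bsub>M\<^esub> x) = (\<ominus>\<^bsub>R\<^esub> \<one>\<^bsub>R\<^esub>) \<odot>\<^bsub>N\<^esub> f x"
    by (rule lin_smult[OF assms(3)]) (auto simp: assms(4))
  then show ?thesis
    using lin_closed[OF assms(3,4)] assms(4) by (simp add: M.smult_l_minus N.smult_l_minus)
qed

lemma lin_minus:
  assumes "module R M" "module R N" "f \<in> lin R M N" "x \<in> carrier M" "y \<in> carrier M"
  shows "f (x \<ominus>\<^bsub>M\<^esub> y) = f x \<ominus>\<^bsub>N\<^esub> f y"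
proof -
  interpret M: module R M by fact
  show ?thesis using assms by (simp add: a_minus_def lin_add[OF assms(3)] lin_neg[OF assms(1-3)])
qed

lemma lin_sign_pow:
  assumes "module R M" "module R N" "f \<in> lin R M N" "x \<in> carrier M"
  shows "f (sign_pow M n x) = sign_pow N n (f x)"
  using lin_neg[OF assms] by (simp add: sign_pow_def)

lemma lin_finsum:
  assumes "module R M" "module R N" "f \<in> lin R M N" "g \<in> I \<rightarrow> carrier M"
  shows "f (\<Oplus>\<^bsub>M\<^esub> i \<in> I. g i) = (\<Oplus>\<^bsub>N\<^esub> i \<in> I. f (g i))"
proof -
  interpret M: module R M by fact
  interpret N: module R N by fact
  show ?thesis
  proof (cases "finite I")
    case True
    then show ?thesis using assms(4)
    proof (induction I)
      case empty
      then show ?case by (simp add: lin_zero[OF assms(1-3)])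
    next
      case (insert i I)
      then have "g \<in> I \<rightarrow> carrier M" "g i \<in> carrier M" by auto
      moreover have "(\<lambda>i. f (g i)) \<in> I \<rightarrow> carrier N" "f (g i) \<in> carrier N"
        using calculation lin_closed[OF assms(3)] by auto
      ultimately show ?case using insert
        by (simp add: M.finsum_insert N.finsum_insert lin_add[OF assms(3)] M.finsum_closed)
    qed
  next
    case False
    then show ?thesis by (simp add: M.finsum_infinite N.finsum_infinite lin_zero[OF assms(1-3)])
  qed
qed

text \<open>Maps out of direct sums and \<open>Tot_map\<close> are sums over the support of the
  argument, which varies with it. Linearity is proved here for a fixed finite index set and used
  after enlarging the supports to a common one.\<close>

lemma lin_sum:
  assumes M: "module R M" and N: "module R N" and I: "finite I"
    and h: "\<And>i. i \<in> I \<Longrightarrow> (\<lambda>x \<in> carrier M. h i x) \<in> lin R M N"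
  shows "(\<lambda>x \<in> carrier M. \<Oplus>\<^bsub>N\<^esub> i \<in> I. h i x) \<in> lin R M N"
proof (rule lin_restrictI[OF M])
  interpret M: module R M by (rule M)
  interpret N: module R N by (rule N)
  have c: "h i x \<in> carrier N" if "i \<in> I" "x \<in> carrier M" for i x
    using lin_closed[OF h] that by fastforce
  fix x y r assume x: "x \<in> carrier M"
  show "(\<Oplus>\<^bsub>N\<^esub> i \<in> I. h i x) \<in> carrier N"
    using c x by (intro N.finsum_closed) auto
  show "(\<Oplus>\<^bsub>N\<^esub> i \<in> I. h i (x \<oplus>\<^bsub>M\<^esub> y)) = (\<Oplus>\<^bsub>N\<^esub> i \<in> I. h i x) \<oplus>\<^bsub>N\<^esub> (\<Oplus>\<^bsub>N\<^esub> i \<in> I. h i y)"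
    if y: "y \<in> carrier M"
  proof -
    have "(\<Oplus>\<^bsub>N\<^esub> i \<in> I. h i (x \<oplus>\<^bsub>M\<^esub> y)) = (\<Oplus>\<^bsub>N\<^esub> i \<in> I. h i x \<oplus>\<^bsub>N\<^esub> h i y)"
      using lin_add[OF h x y] c x y by (intro N.finsum_cong') auto
    also have "\<dots> = (\<Oplus>\<^bsub>N\<^esub> i \<in> I. h i x) \<oplus>\<^bsub>N\<^esub> (\<Oplus>\<^bsub>N\<^esub> i \<in> I. h i y)"
      using c x y by (intro N.finsum_addf) auto
    finally show ?thesis .
  qed
  show "(\<Oplus>\<^bsub>N\<^esub> i \<in> I. h i (r \<odot>\<^bsub>M\<^esub> x)) = r \<odot>\<^bsub>N\<^esub> (\<Oplus>\<^bsub>N\<^esub> i \<in> I. h i x)"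
    if r: "r \<in> carrier R"
    using lin_smult[OF h r x] c x r
    by (subst N.finsum_smult_ldistr[OF I r]) (auto intro!: N.finsum_cong')
qed

lemma lin_compose:
  assumes M: "module R M" and f: "f \<in> lin R M N" and g: "g \<in> lin R N P"
  shows "compose (carrier M) g f \<in> lin R M P"
  unfolding compose_def
  by (rule lin_restrictI[OF M])
    (auto simp: lin_closed[OF f] lin_closed[OF g] lin_add[OF f] lin_add[OF g]
      lin_smult[OF f] lin_smult[OF g])

text \<open>Applying the linear \<open>g\<close> to \<open>f x + f y\<close> gives
  \<open>x + y\<close>, and \<open>f\<close> undoes \<open>g\<close>. This allows linearity to be
  proved for whichever of two inverse maps has the simpler formula.\<close>

lemma lin_inverse:
  assumes M: "module R M" and N: "module R N" and g: "g \<in> lin R N M"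
    and f: "\<And>x. x \<in> carrier M \<Longrightarrow> f x \<in> carrier N" "\<And>x. x \<in> carrier M \<Longrightarrow> g (f x) = x"
    and fg: "\<And>y. y \<in> carrier N \<Longrightarrow> f (g y) = y"
  shows "(\<lambda>x \<in> carrier M. f x) \<in> lin R M N"
proof (rule lin_restrictI[OF M f(1)])
  interpret N: module R N by (rule N)
  fix x y r assume x: "x \<in> carrier M"
  show "f (x \<oplus>\<^bsub>M\<^esub> y) = f x \<oplus>\<^bsub>N\<^esub> f y" if y: "y \<in> carrier M"
    using fg[of "f x \<oplus>\<^bsub>N\<^esub> f y"] x y by (simp add: lin_add[OF g] f)
  show "f (r \<odot>\<^bsub>M\<^esub> x) = r \<odot>\<^bsub>N\<^esub> f x" if r: "r \<in> carrier R"
    using fg[of "r \<odot>\<^bsub>N\<^esub> f x"] x r by (simp add: lin_smult[OF g] f)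
qed

lemma lin_plus:
  assumes "module R M" "module R N" "f \<in> lin R M N" "g \<in> lin R M N"
  shows "(\<lambda>x \<in> carrier M. f x \<oplus>\<^bsub>N\<^esub> g x) \<in> lin R M N"
proof -
  interpret N: module R N by fact
  show ?thesis
    using assms
    by (intro lin_restrictI)
      (auto simp: lin_closed lin_add lin_smult N.smult_r_distr N.a_ac)
qed

lemma lin_scale:
  assumes "module R M" "module R N" "f \<in> lin R M N" "r \<in> carrier R"
  shows "(\<lambda>x \<in> carrier M. r \<odot>\<^bsub>N\<^esub> f x) \<in> lin R M N"
proof -
  interpret N: module R N by fact
  show ?thesis
    using assms
    by (intro lin_restrictI)
      (auto simp: lin_closed lin_add lin_smult N.smult_r_distr N.smult_assoc1[symmetric] N.R.m_comm)
qed

lemma lin_const_zero: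
  assumes "module R M" "module R N"
  shows "(\<lambda>x \<in> carrier M. \<zero>\<^bsub>N\<^esub>) \<in> lin R M N"
proof -
  interpret N: module R N by fact
  show ?thesis by (intro lin_restrictI assms(1)) auto
qed

section \<open>Signs acting on a module\<close>

lemma sign_pow_0 [simp]: "sign_pow M 0 x = x"
  by (simp add: sign_pow_def)

lemma sign_pow_cong: "even m = even n \<Longrightarrow> sign_pow M m x = sign_pow M n x"
  by (simp add: sign_pow_def)

context
  fixes R :: "'r ring" and M :: "('r, 'a) module"
  assumes M: "module R M"
begin

interpretation M: module R M by (rule M)

lemma sign_pow_closed: "x \<in> carrier M \<Longrightarrow> sign_pow M n x \<in> carrier M"
  by (simp add: sign_pow_def)

lemma sign_pow_add:
  "x \<in> carrier M \<Longrightarrow> y \<in> carrier M \<Longrightarrow>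
    sign_pow M n (x \<oplus>\<^bsub>M\<^esub> y) = sign_pow M n x \<oplus>\<^bsub>M\<^esub> sign_pow M n y"
  by (simp add: sign_pow_def M.M.minus_add)

lemma sign_pow_smult:
  "r \<in> carrier R \<Longrightarrow> x \<in> carrier M \<Longrightarrow> sign_pow M n (r \<odot>\<^bsub>M\<^esub> x) = r \<odot>\<^bsub>M\<^esub> sign_pow M n x"
  by (simp add: sign_pow_def M.smult_r_minus)

lemma sign_pow_zero: "sign_pow M n \<zero>\<^bsub>M\<^esub> = \<zero>\<^bsub>M\<^esub>"
  by (simp add: sign_pow_def)

lemma sign_pow_sign_pow: "x \<in> carrier M \<Longrightarrow> sign_pow M m (sign_pow M n x) = sign_pow M (m + n) x"
  by (simp add: sign_pow_def)

lemma sign_pow_lin: "(\<lambda>x \<in> carrier M. sign_pow M n x) \<in> lin R M M"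
  by (rule lin_restrictI[OF M])
    (auto simp: sign_pow_add sign_pow_smult sign_pow_closed)

lemma sign_pow_finsum:
  assumes "g \<in> I \<rightarrow> carrier M"
  shows "sign_pow M n (\<Oplus>\<^bsub>M\<^esub> i \<in> I. g i) = (\<Oplus>\<^bsub>M\<^esub> i \<in> I. sign_pow M n (g i))"
proof -
  have "(\<lambda>x \<in> carrier M. sign_pow M n x) (\<Oplus>\<^bsub>M\<^esub> i \<in> I. g i) =
      (\<Oplus>\<^bsub>M\<^esub> i \<in> I. (\<lambda>x \<in> carrier M. sign_pow M n x) (g i))"
    by (rule lin_finsum[OF M M sign_pow_lin assms])
  also have "\<dots> = (\<Oplus>\<^bsub>M\<^esub> i \<in> I. sign_pow M n (g i))"
    using assms by (intro M.finsum_cong) (auto simp: simp_implies_def Pi_def intro: sign_pow_closed)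
  finally show ?thesis using assms by (simp add: M.finsum_closed)
qed

end

lemma (in abelian_monoid) finsum_mono_neutral:
  assumes "finite T" "S \<subseteq> T" "g \<in> T \<rightarrow> carrier G" "\<And>i. i \<in> T - S \<Longrightarrow> g i = \<zero>"
  shows "finsum G g S = finsum G g T"
  using assms by (intro add.finprod_mono_neutral_cong_left) (auto simp: Pi_def)

lemma module_bg_unit:
  assumes "cring R" shows "module R (bg_unit R i j)"
proof -
  interpret R: cring R by fact
  show ?thesis
    unfolding bg_unit_def
  proof (rule moduleI, goal_cases)
    case 2
    show ?case
    proof (rule abelian_groupI, goal_cases)
      case (6 x)
      then show ?case
        by (cases "i = 0 \<and> j = 0") (auto simp: R.l_neg intro!: bexI[of _ "\<ominus>\<^bsub>R\<^esub> x"] split: if_splits)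
    qed (auto simp: R.a_ac split: if_splits)
  qed (use assms in \<open>auto simp: R.l_distr R.r_distr R.m_assoc split: if_splits\<close>)
qed

lemma bg_unit_simps:
  "carrier (bg_unit R i j) = (if i = 0 \<and> j = 0 then carrier R else {\<zero>\<^bsub>R\<^esub>})"
  "\<zero>\<^bsub>bg_unit R i j\<^esub> = \<zero>\<^bsub>R\<^esub>"
  "x \<oplus>\<^bsub>bg_unit R i j\<^esub> y = x \<oplus>\<^bsub>R\<^esub> y"
  "r \<odot>\<^bsub>bg_unit R i j\<^esub> x = r \<otimes>\<^bsub>R\<^esub> x"
  by (simp_all add: bg_unit_def)

section \<open>Direct sums\<close>

lemma module_direct_sum:
  assumes R: "cring R" and M: "\<And>i. module R (M i)"
  shows "module R (direct_sum M)"
proof -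
  interpret M: module R "M i" for i by (rule M)
  show ?thesis
    unfolding direct_sum_def
  proof (rule module_mk_by_evaluations[where K = UNIV and N = M and e = "\<lambda>i x. x i"], goal_cases)
    case (7 x y)
    then show ?case
      by (auto intro: finite_subset[of _ "{i. x i \<noteq> \<zero>\<^bsub>M i\<^esub>} \<union> {i. y i \<noteq> \<zero>\<^bsub>M i\<^esub>}"])
  next
    case (9 r x)
    then show ?case
      by (auto intro: finite_subset[of _ "{i. x i \<noteq> \<zero>\<^bsub>M i\<^esub>}"])
  qed (use R M in auto)
qed

lemma direct_sum_simps:
  "\<zero>\<^bsub>direct_sum M\<^esub> = (\<lambda>i. \<zero>\<^bsub>M i\<^esub>)"
  "x \<oplus>\<^bsub>direct_sum M\<^esub> y = (\<lambda>i. x i \<oplus>\<^bsub>M i\<^esub> y i)"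
  "r \<odot>\<^bsub>direct_sum M\<^esub> x = (\<lambda>i. r \<odot>\<^bsub>M i\<^esub> x i)"
  by (simp_all add: direct_sum_def)

definition dsum_single :: "('i \<Rightarrow> ('r, 'a) module) \<Rightarrow> 'i \<Rightarrow> 'a \<Rightarrow> 'i \<Rightarrow> 'a" where
  "dsum_single M i a = (\<lambda>k. if k = i then a else \<zero>\<^bsub>M k\<^esub>)"

definition dsum_lift ::
  "('i \<Rightarrow> ('r, 'a) module) \<Rightarrow> ('r, 'c) module \<Rightarrow> ('i \<Rightarrow> 'a \<Rightarrow> 'c) \<Rightarrow> ('i \<Rightarrow> 'a) \<Rightarrow> 'c" where
  "dsum_lift M P h = (\<lambda>x \<in> carrier (direct_sum M). \<Oplus>\<^bsub>P\<^esub> i \<in> {i. x i \<noteq> \<zero>\<^bsub>M i\<^esub>}. h i (x i))"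

context
  fixes R :: "'r ring" and M :: "'i \<Rightarrow> ('r, 'a) module"
  assumes R: "cring R" and M: "\<And>i. module R (M i)"
begin

interpretation M: module R "M i" for i by (rule M)

lemma module_dsum: "module R (direct_sum M)" by (rule module_direct_sum[OF R M])

interpretation D: module R "direct_sum M" by (rule module_dsum)

lemma dsum_single_lin: "(\<lambda>a \<in> carrier (M i). dsum_single M i a) \<in> lin R (M i) (direct_sum M)"
proof (rule lin_restrictI[OF M], goal_cases)
  case (1 x)
  then show ?case
    by (auto simp: direct_sum_def dsum_single_def intro: finite_subset[of _ "{i}"])
qed (auto simp: direct_sum_simps dsum_single_def fun_eq_iff)

lemma dsum_single_closed: "a \<in> carrier (M i) \<Longrightarrow> dsum_single M i a \<in> carrier (direct_sum M)"
  using lin_closed[OF dsum_single_lin] by fastforce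

text \<open>Each element is a finite sum of elements with one component. The induction runs over a
  finite set containing the support instead of the support itself, so that it passes to elements
  with smaller support without further care.\<close>

lemma dsum_ext:
  assumes P: "module R P"
    and f: "f \<in> lin R (direct_sum M) P" and g: "g \<in> lin R (direct_sum M) P"
    and eq: "\<And>i a. a \<in> carrier (M i) \<Longrightarrow> f (dsum_single M i a) = g (dsum_single M i a)"
  shows "f = g"
proof (rule lin_ext[OF f g])
  have "finite T \<Longrightarrow> x \<in> carrier (direct_sum M) \<Longrightarrow> {i. x i \<noteq> \<zero>\<^bsub>M i\<^esub>} \<subseteq> T \<Longrightarrow> f x = g x" for T x
  proof (induction T arbitrary: x rule: finite_induct)
    case empty
    then have "x = \<zero>\<^bsub>direct_sum M\<^esub>" by (auto simp: direct_sum_simps)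
    then show ?case by (simp add: lin_zero[OF module_dsum P f] lin_zero[OF module_dsum P g])
  next
    case (insert i T)
    \<comment> \<open>Erasing the component at \<open>i\<close> leaves an element supported in
      \<open>T\<close>; the erased part is a single element.\<close>
    define y where "y = x(i := \<zero>\<^bsub>M i\<^esub>)"
    have xi: "x i \<in> carrier (M i)" using insert.prems by (auto simp: direct_sum_def)
    have y: "y \<in> carrier (direct_sum M)"
      using insert.prems(1)
      by (auto simp: direct_sum_def y_def intro: finite_subset[of _ "{i. x i \<noteq> \<zero>\<^bsub>M i\<^esub>}"])
    have "f y = g y" by (rule insert.IH[OF y]) (use insert.prems in \<open>auto simp: y_def\<close>)
    moreover have "x = y \<oplus>\<^bsub>direct_sum M\<^esub> dsum_single M i (x i)"
      using insert.prems(1) by (auto simp: fun_eq_iff direct_sum_simps direct_sum_def dsum_single_def y_def)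
    ultimately show ?case
      using lin_add[OF f y dsum_single_closed[OF xi]] lin_add[OF g y dsum_single_closed[OF xi]] eq[OF xi]
      by simp
  qed
  then show "f x = g x" if "x \<in> carrier (direct_sum M)" for x
    using that by (auto simp: direct_sum_def)
qed

context
  fixes P :: "('r, 'c) module" and h :: "'i \<Rightarrow> 'a \<Rightarrow> 'c"
  assumes P: "module R P" and h: "\<And>i. h i \<in> lin R (M i) P"
begin

interpretation P: module R P by (rule P)

private lemma h_x: "x \<in> carrier (direct_sum M) \<Longrightarrow> h i (x i) \<in> carrier P"
  using lin_closed[OF h] by (auto simp: direct_sum_def)

text \<open>The support of a sum can be smaller than the union of the supports. Since
  \<open>h i\<close> maps zero to zero, all the sums involved may be taken over that union.\<close>

private lemma dsum_lift_superset:
  assumes "x \<in> carrier (direct_sum M)" "finite T" "{i. x i \<noteq> \<zero>\<^bsub>M i\<^esub>} \<subseteq> T"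
  shows "dsum_lift M P h x = (\<Oplus>\<^bsub>P\<^esub> i \<in> T. h i (x i))"
proof -
  have "(\<Oplus>\<^bsub>P\<^esub> i \<in> {i. x i \<noteq> \<zero>\<^bsub>M i\<^esub>}. h i (x i)) = (\<Oplus>\<^bsub>P\<^esub> i \<in> T. h i (x i))"
    using assms by (intro P.finsum_mono_neutral) (auto simp: h_x lin_zero[OF M P h])
  then show ?thesis using assms by (simp add: dsum_lift_def)
qed

private lemma sum_lin:
  "finite T \<Longrightarrow> (\<lambda>x \<in> carrier (direct_sum M). \<Oplus>\<^bsub>P\<^esub> i \<in> T. h i (x i)) \<in> lin R (direct_sum M) P"
  by (intro lin_sum lin_restrictI module_dsum P)
    (auto simp: h_x direct_sum_simps direct_sum_def lin_add[OF h] lin_smult[OF h])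

lemma dsum_lift_lin: "dsum_lift M P h \<in> lin R (direct_sum M) P"
proof (rule linI, goal_cases)
  case 1 show ?case by (auto simp: dsum_lift_def)
next
  case (2 x)
  then show ?case using h_x by (auto simp: dsum_lift_def intro!: P.finsum_closed)
next
  case (3 x y)
  let ?T = "{i. x i \<noteq> \<zero>\<^bsub>M i\<^esub>} \<union> {i. y i \<noteq> \<zero>\<^bsub>M i\<^esub>}"
  have T: "finite ?T" using 3 by (auto simp: direct_sum_def)
  have xy: "x \<oplus>\<^bsub>direct_sum M\<^esub> y \<in> carrier (direct_sum M)" using 3 by simp
  have "dsum_lift M P h (x \<oplus>\<^bsub>direct_sum M\<^esub> y) =
      (\<Oplus>\<^bsub>P\<^esub> i \<in> ?T. h i ((x \<oplus>\<^bsub>direct_sum M\<^esub> y) i))"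
    using T by (intro dsum_lift_superset[OF xy]) (auto simp: direct_sum_simps)
  then show ?case
    using 3 T xy lin_add[OF sum_lin[OF T] 3] by (simp add: dsum_lift_superset[of _ ?T])
next
  case (4 r x)
  let ?T = "{i. x i \<noteq> \<zero>\<^bsub>M i\<^esub>}"
  have T: "finite ?T" using 4 by (auto simp: direct_sum_def)
  have rx: "r \<odot>\<^bsub>direct_sum M\<^esub> x \<in> carrier (direct_sum M)" using 4 by simp
  have "dsum_lift M P h (r \<odot>\<^bsub>direct_sum M\<^esub> x) = (\<Oplus>\<^bsub>P\<^esub> i \<in> ?T. h i ((r \<odot>\<^bsub>direct_sum M\<^esub> x) i))"
    using T 4 by (intro dsum_lift_superset[OF rx]) (auto simp: direct_sum_simps)
  then show ?case
    using 4 T rx lin_smult[OF sum_lin[OF T] 4] by (simp add: dsum_lift_superset[of _ ?T])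
qed

lemma dsum_lift_single:
  assumes "a \<in> carrier (M i)"
  shows "dsum_lift M P h (dsum_single M i a) = h i a"
proof -
  have "dsum_lift M P h (dsum_single M i a) = (\<Oplus>\<^bsub>P\<^esub> k \<in> {i}. h k (dsum_single M i a k))"
    using assms by (intro dsum_lift_superset dsum_single_closed) (auto simp: dsum_single_def)
  also have "\<dots> = h i a"
    using lin_closed[OF h assms] by (subst P.finsum_insert) (auto simp: dsum_single_def)
  finally show ?thesis .
qed

end

end

section \<open>Free modules, quotients and tensor products\<close>

text \<open>The functions in \<open>free_mod\<close> are defined on the whole type, so indices
  outside \<open>S\<close> must carry the zero module. The unit object provides both cases: R in
  bidegree (0, 0) and zero in bidegree (1, 0).\<close>

lemma free_mod_eq_direct_sum:
  assumes "cring R"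
  shows "free_mod R S = direct_sum (\<lambda>s. bg_unit R (if s \<in> S then 0 else 1) 0)"
proof -
  interpret R: cring R by fact
  have "x s \<in> carrier R" if "\<forall>s. (s \<in> S \<longrightarrow> x s \<in> carrier R) \<and> (s \<notin> S \<longrightarrow> x s = \<zero>\<^bsub>R\<^esub>)" for x :: "'b \<Rightarrow> 'a" and s
    using that by (cases "s \<in> S") auto
  then show ?thesis
    unfolding free_mod_def direct_sum_def
    by (intro arg_cong4[where f = mk_module]) (auto simp: bg_unit_simps split: if_splits)
qed

lemma module_free_mod: "cring R \<Longrightarrow> module R (free_mod R S)"
  using module_direct_sum[OF _ module_bg_unit] by (simp add: free_mod_eq_direct_sum)

lemma free_gen_single:
  "s \<in> S \<Longrightarrow> free_gen R s = dsum_single (\<lambda>s. bg_unit R (if s \<in> S then 0 else 1) 0) s \<one>\<^bsub>R\<^esub>"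
  by (auto simp: free_gen_def dsum_single_def bg_unit_simps)

lemma free_gen_closed: "cring R \<Longrightarrow> s \<in> S \<Longrightarrow> free_gen R s \<in> carrier (free_mod R S)"
  by (auto simp: free_mod_def free_gen_def cring_def ring.ring_simprules)

lemma free_mod_ext:
  assumes P: "module R P" and f: "f \<in> lin R (free_mod R S) P" and g: "g \<in> lin R (free_mod R S) P"
    and eq: "\<And>s. s \<in> S \<Longrightarrow> f (free_gen R s) = g (free_gen R s)"
  shows "f = g"
proof -
  interpret P: module R P by (rule P)
  note R = P.R.cring_axioms
  note F = module_free_mod[OF R, of S] and M = module_bg_unit[OF R]
  let ?M = "\<lambda>s. bg_unit R (if s \<in> S then 0 else 1) 0"
  show ?thesis
  proof (rule dsum_ext[OF R M P f[unfolded free_mod_eq_direct_sum[OF R]] g[unfolded free_mod_eq_direct_sum[OF R]]])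
    fix s r assume r: "r \<in> carrier (?M s)"
    \<comment> \<open>Over \<open>S\<close> a single element is a multiple of a generator; outside
      \<open>S\<close> the component \<open>r\<close> can only be zero.\<close>
    have "dsum_single ?M s r =
        (if s \<in> S then r \<odot>\<^bsub>free_mod R S\<^esub> free_gen R s else \<zero>\<^bsub>free_mod R S\<^esub>)"
      using r by (auto simp: fun_eq_iff dsum_single_def free_gen_def free_mod_def bg_unit_simps)
    then show "f (dsum_single ?M s r) = g (dsum_single ?M s r)"
      using r eq by (auto simp: bg_unit_simps lin_zero[OF F P f] lin_zero[OF F P g]
          lin_smult[OF f] lin_smult[OF g] free_gen_closed[OF R] split: if_splits)
  qed
qed

definition free_lift :: "'r ring \<Rightarrow> 's set \<Rightarrow> ('r, 'c) module \<Rightarrow> ('s \<Rightarrow> 'c) \<Rightarrow> ('s \<Rightarrow> 'r) \<Rightarrow> 'c" where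
  "free_lift R S P \<phi> = dsum_lift (\<lambda>s. bg_unit R (if s \<in> S then 0 else 1) 0) P
     (\<lambda>s. \<lambda>r \<in> carrier (bg_unit R (if s \<in> S then 0 else 1) 0). if s \<in> S then r \<odot>\<^bsub>P\<^esub> \<phi> s else \<zero>\<^bsub>P\<^esub>)"

lemma free_lift:
  assumes P: "module R P" and \<phi>: "\<phi> \<in> S \<rightarrow> carrier P"
  shows "free_lift R S P \<phi> \<in> lin R (free_mod R S) P"
    and "s \<in> S \<Longrightarrow> free_lift R S P \<phi> (free_gen R s) = \<phi> s"
proof -
  interpret P: module R P by (rule P)
  note R = P.R.cring_axioms
  have h: "(\<lambda>r \<in> carrier (bg_unit R (if s \<in> S then 0 else 1) 0). if s \<in> S then r \<odot>\<^bsub>P\<^esub> \<phi> s else \<zero>\<^bsub>P\<^esub>)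
      \<in> lin R (bg_unit R (if s \<in> S then 0 else 1) 0) P" for s
    using \<phi> by (intro lin_restrictI module_bg_unit R)
      (auto simp: bg_unit_simps P.smult_l_distr P.smult_assoc1 Pi_def)
  show "free_lift R S P \<phi> \<in> lin R (free_mod R S) P"
    unfolding free_lift_def free_mod_eq_direct_sum[OF R] by (rule dsum_lift_lin[OF R module_bg_unit[OF R] P h])
  show "free_lift R S P \<phi> (free_gen R s) = \<phi> s" if "s \<in> S"
    using dsum_lift_single[OF R module_bg_unit[OF R] P h, where a = "\<one>\<^bsub>R\<^esub>" and i = s] that \<phi>
    by (auto simp: free_lift_def free_gen_single bg_unit_simps Pi_def)
qed

section \<open>Quotient modules\<close>

context
  fixes R :: "'r ring" and M :: "('r, 'a) module" and H :: "'a set"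
  assumes M: "module R M" and H: "submodule H R M"
begin

interpretation M: module R M by (rule M)
interpretation H: abelian_subgroup H M
  by (intro abelian_subgroupI3 additive_subgroup.intro submodule.axioms(1)[OF H] M.M.abelian_group_axioms)

lemma rcos_absorb:
  assumes "h \<in> H" "x \<in> carrier M"
  shows "H +>\<^bsub>M\<^esub> (h \<oplus>\<^bsub>M\<^esub> x) = H +>\<^bsub>M\<^esub> x"
proof -
  have "H +>\<^bsub>M\<^esub> (h \<oplus>\<^bsub>M\<^esub> x) = (H +>\<^bsub>M\<^esub> h) +>\<^bsub>M\<^esub> x"
    using assms H.a_subset by (intro M.a_coset_add_assoc[symmetric]) auto
  also have "H +>\<^bsub>M\<^esub> h = H"
    using assms H.a_Hcarr H.a_rcos_const by blast
  finally show ?thesis .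
qed

lemma rcos_eqI:
  assumes "x \<in> carrier M" "y \<in> carrier M" "x \<ominus>\<^bsub>M\<^esub> y \<in> H"
  shows "H +>\<^bsub>M\<^esub> x = H +>\<^bsub>M\<^esub> y"
  using rcos_absorb[OF assms(3,2)] assms
  by (simp add: a_minus_def M.M.a_assoc M.M.l_neg)

text \<open>Scalar multiplication in \<open>quot_mod\<close> is a union over all representatives.
  They all yield the same coset, so the union collapses to it.\<close>

lemma rcos_smult:
  assumes "r \<in> carrier R" "x \<in> carrier M"
  shows "(\<Union>y \<in> H +>\<^bsub>M\<^esub> x. H +>\<^bsub>M\<^esub> (r \<odot>\<^bsub>M\<^esub> y)) = H +>\<^bsub>M\<^esub> (r \<odot>\<^bsub>M\<^esub> x)"
proof -
  have "H +>\<^bsub>M\<^esub> (r \<odot>\<^bsub>M\<^esub> y) = H +>\<^bsub>M\<^esub> (r \<odot>\<^bsub>M\<^esub> x)" if y: "y \<in> H +>\<^bsub>M\<^esub> x" for y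
  proof -
    obtain h where h: "h \<in> H" "y = h \<oplus>\<^bsub>M\<^esub> x" using y by (auto simp: a_r_coset_def')
    then have "r \<odot>\<^bsub>M\<^esub> y = r \<odot>\<^bsub>M\<^esub> h \<oplus>\<^bsub>M\<^esub> r \<odot>\<^bsub>M\<^esub> x"
      using assms H.a_Hcarr by (simp add: M.smult_r_distr)
    moreover have "r \<odot>\<^bsub>M\<^esub> h \<in> H" using assms h by (intro submodule.smult_closed[OF H])
    ultimately show ?thesis using assms by (simp add: rcos_absorb)
  qed
  moreover have "x \<in> H +>\<^bsub>M\<^esub> x" using assms by (intro H.a_rcos_self)
  ultimately show ?thesis by blast
qed

lemma quot_mod_simps:
  "carrier (quot_mod M H) = (\<lambda>x. H +>\<^bsub>M\<^esub> x) ` carrier M"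
  "\<zero>\<^bsub>quot_mod M H\<^esub> = H +>\<^bsub>M\<^esub> \<zero>\<^bsub>M\<^esub>"
  "x \<in> carrier M \<Longrightarrow> y \<in> carrier M \<Longrightarrow>
    (H +>\<^bsub>M\<^esub> x) \<oplus>\<^bsub>quot_mod M H\<^esub> (H +>\<^bsub>M\<^esub> y) = H +>\<^bsub>M\<^esub> (x \<oplus>\<^bsub>M\<^esub> y)"
  "r \<in> carrier R \<Longrightarrow> x \<in> carrier M \<Longrightarrow>
    r \<odot>\<^bsub>quot_mod M H\<^esub> (H +>\<^bsub>M\<^esub> x) = H +>\<^bsub>M\<^esub> (r \<odot>\<^bsub>M\<^esub> x)"
  using H.a_rcos_sum H.a_subset
  by (auto simp: quot_mod_def A_RCOSETS_def' rcos_smult)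

lemma module_quot_mod: "module R (quot_mod M H)"
  using quot_mod_simps unfolding quot_mod_def mk_module_simps
  by (intro module_surjective_image[OF M, where f = "\<lambda>x. H +>\<^bsub>M\<^esub> x"]) auto

lemma rcos_self: "x \<in> carrier M \<Longrightarrow> x \<in> H +>\<^bsub>M\<^esub> x"
  by (rule H.a_rcos_self)

lemma rcosD:
  assumes "y \<in> H +>\<^bsub>M\<^esub> x"
  obtains h where "h \<in> H" "h \<in> carrier M" "y = h \<oplus>\<^bsub>M\<^esub> x"
  using assms H.a_Hcarr by (auto simp: a_r_coset_def')

end

lemma submodule_hull:
  assumes M: "module R M" and X: "X \<subseteq> carrier M"
  shows "submodule ((\<lambda>H. submodule H R M) hull X) R M"
proof -
  interpret M: module R M by (rule M)
  \<comment> \<open>The whole module keeps the intersected family nonempty, so the hull stays inside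
    the carrier.\<close>
  have ne: "carrier M \<in> {H. submodule H R M \<and> X \<subseteq> H}" using M.carrier_is_submodule X by simp
  have sub: "submodule H R M" if "H \<in> {H. submodule H R M \<and> X \<subseteq> H}" for H using that by simp
  show ?thesis
    unfolding hull_def using ne M.submoduleE[OF sub]
    by (intro M.submoduleI) (auto intro: subgroup.one_closed[OF submodule.axioms(1)[OF sub], simplified])
qed

section \<open>Bilinear maps and the universal property of the tensor product\<close>

definition bilinear ::
  "'r ring \<Rightarrow> ('r, 'a) module \<Rightarrow> ('r, 'b) module \<Rightarrow> ('r, 'c) module \<Rightarrow> ('a \<Rightarrow> 'b \<Rightarrow> 'c) \<Rightarrow> bool" where
  "bilinear R M N P \<phi> \<longleftrightarrow>
     (\<forall>a \<in> carrier M. \<forall>b \<in> carrier N. \<phi> a b \<in> carrier P) \<and>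
     (\<forall>a \<in> carrier M. \<forall>a' \<in> carrier M. \<forall>b \<in> carrier N. \<phi> (a \<oplus>\<^bsub>M\<^esub> a') b = \<phi> a b \<oplus>\<^bsub>P\<^esub> \<phi> a' b) \<and>
     (\<forall>a \<in> carrier M. \<forall>b \<in> carrier N. \<forall>b' \<in> carrier N. \<phi> a (b \<oplus>\<^bsub>N\<^esub> b') = \<phi> a b \<oplus>\<^bsub>P\<^esub> \<phi> a b') \<and>
     (\<forall>r \<in> carrier R. \<forall>a \<in> carrier M. \<forall>b \<in> carrier N. \<phi> (r \<odot>\<^bsub>M\<^esub> a) b = r \<odot>\<^bsub>P\<^esub> \<phi> a b) \<and>
     (\<forall>r \<in> carrier R. \<forall>a \<in> carrier M. \<forall>b \<in> carrier N. \<phi> a (r \<odot>\<^bsub>N\<^esub> b) = r \<odot>\<^bsub>P\<^esub> \<phi> a b)"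

lemma bilinearI:
  assumes "\<And>a b. a \<in> carrier M \<Longrightarrow> b \<in> carrier N \<Longrightarrow> \<phi> a b \<in> carrier P"
    and "\<And>a a' b. a \<in> carrier M \<Longrightarrow> a' \<in> carrier M \<Longrightarrow> b \<in> carrier N \<Longrightarrow>
      \<phi> (a \<oplus>\<^bsub>M\<^esub> a') b = \<phi> a b \<oplus>\<^bsub>P\<^esub> \<phi> a' b"
    and "\<And>a b b'. a \<in> carrier M \<Longrightarrow> b \<in> carrier N \<Longrightarrow> b' \<in> carrier N \<Longrightarrow>
      \<phi> a (b \<oplus>\<^bsub>N\<^esub> b') = \<phi> a b \<oplus>\<^bsub>P\<^esub> \<phi> a b'"
    and "\<And>r a b. r \<in> carrier R \<Longrightarrow> a \<in> carrier M \<Longrightarrow> b \<in> carrier N \<Longrightarrow>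
      \<phi> (r \<odot>\<^bsub>M\<^esub> a) b = r \<odot>\<^bsub>P\<^esub> \<phi> a b"
    and "\<And>r a b. r \<in> carrier R \<Longrightarrow> a \<in> carrier M \<Longrightarrow> b \<in> carrier N \<Longrightarrow>
      \<phi> a (r \<odot>\<^bsub>N\<^esub> b) = r \<odot>\<^bsub>P\<^esub> \<phi> a b"
  shows "bilinear R M N P \<phi>"
  using assms by (simp add: bilinear_def)

lemma bilinearD:
  assumes "bilinear R M N P \<phi>"
  shows "\<And>a b. a \<in> carrier M \<Longrightarrow> b \<in> carrier N \<Longrightarrow> \<phi> a b \<in> carrier P"
    and "\<And>a a' b. a \<in> carrier M \<Longrightarrow> a' \<in> carrier M \<Longrightarrow> b \<in> carrier N \<Longrightarrow>
      \<phi> (a \<oplus>\<^bsub>M\<^esub> a') b = \<phi> a b \<oplus>\<^bsub>P\<^esub> \<phi> a' b"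
    and "\<And>a b b'. a \<in> carrier M \<Longrightarrow> b \<in> carrier N \<Longrightarrow> b' \<in> carrier N \<Longrightarrow>
      \<phi> a (b \<oplus>\<^bsub>N\<^esub> b') = \<phi> a b \<oplus>\<^bsub>P\<^esub> \<phi> a b'"
    and "\<And>r a b. r \<in> carrier R \<Longrightarrow> a \<in> carrier M \<Longrightarrow> b \<in> carrier N \<Longrightarrow>
      \<phi> (r \<odot>\<^bsub>M\<^esub> a) b = r \<odot>\<^bsub>P\<^esub> \<phi> a b"
    and "\<And>r a b. r \<in> carrier R \<Longrightarrow> a \<in> carrier M \<Longrightarrow> b \<in> carrier N \<Longrightarrow>
      \<phi> a (r \<odot>\<^bsub>N\<^esub> b) = r \<odot>\<^bsub>P\<^esub> \<phi> a b"
  using assms by (simp_all add: bilinear_def)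

lemma bilinear_lin_right:
  "module R N \<Longrightarrow> bilinear R M N P \<phi> \<Longrightarrow> a \<in> carrier M \<Longrightarrow> (\<lambda>b \<in> carrier N. \<phi> a b) \<in> lin R N P"
  by (rule lin_restrictI) (auto simp: bilinearD)

lemma bilinear_lin_left:
  "module R M \<Longrightarrow> bilinear R M N P \<phi> \<Longrightarrow> b \<in> carrier N \<Longrightarrow> (\<lambda>a \<in> carrier M. \<phi> a b) \<in> lin R M P"
  by (rule lin_restrictI) (auto simp: bilinearD)

lemma bilinear_zero_left:
  assumes "module R M" "module R P" "bilinear R M N P \<phi>" "b \<in> carrier N"
  shows "\<phi> \<zero>\<^bsub>M\<^esub> b = \<zero>\<^bsub>P\<^esub>"
proof -
  interpret M: module R M by fact
  show ?thesis
    using lin_zero[OF assms(1,2) bilinear_lin_left[OF assms(1,3,4)]] by simp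
qed

lemma bilinear_zero_right:
  assumes "module R N" "module R P" "bilinear R M N P \<phi>" "a \<in> carrier M"
  shows "\<phi> a \<zero>\<^bsub>N\<^esub> = \<zero>\<^bsub>P\<^esub>"
proof -
  interpret M: module R N by fact
  show ?thesis
    using lin_zero[OF assms(1,2) bilinear_lin_right[OF assms(1,3,4)]] by simp
qed

lemma bilinear_sign_pow_left:
  assumes "module R M" "module R P" "bilinear R M N P \<phi>" "a \<in> carrier M" "b \<in> carrier N"
  shows "\<phi> (sign_pow M n a) b = sign_pow P n (\<phi> a b)"
  using lin_sign_pow[OF assms(1,2) bilinear_lin_left[OF assms(1,3,5)] assms(4)] assms(1,4)
  by (simp add: sign_pow_closed)

lemma bilinear_sign_pow_right:
  assumes "module R N" "module R P" "bilinear R M N P \<phi>" "a \<in> carrier M" "b \<in> carrier N"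
  shows "\<phi> a (sign_pow N n b) = sign_pow P n (\<phi> a b)"
  using lin_sign_pow[OF assms(1,2) bilinear_lin_right[OF assms(1,3,4)] assms(5)] assms(1,5)
  by (simp add: sign_pow_closed)

lemma bilinear_minus_left:
  assumes "module R M" "module R P" "bilinear R M N P \<phi>" "a \<in> carrier M" "a' \<in> carrier M" "b \<in> carrier N"
  shows "\<phi> (a \<ominus>\<^bsub>M\<^esub> a') b = \<phi> a b \<ominus>\<^bsub>P\<^esub> \<phi> a' b"
proof -
  interpret M: module R M by fact
  show ?thesis
    using lin_minus[OF assms(1,2) bilinear_lin_left[OF assms(1,3,6)] assms(4,5)] assms(4,5) by simp
qed

lemma bilinear_minus_right:
  assumes "module R N" "module R P" "bilinear R M N P \<phi>" "a \<in> carrier M" "b \<in> carrier N" "b' \<in> carrier N"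
  shows "\<phi> a (b \<ominus>\<^bsub>N\<^esub> b') = \<phi> a b \<ominus>\<^bsub>P\<^esub> \<phi> a b'"
proof -
  interpret N: module R N by fact
  show ?thesis
    using lin_minus[OF assms(1,2) bilinear_lin_right[OF assms(1,3,4)] assms(5,6)] assms(5,6) by simp
qed

text \<open>A coset is evaluated at an arbitrary representative; \<open>L_some\<close> shows that
  the choice is irrelevant.\<close>

definition tensor_lift ::
  "'r ring \<Rightarrow> ('r, 'a) module \<Rightarrow> ('r, 'b) module \<Rightarrow> ('r, 'c) module \<Rightarrow> ('a \<Rightarrow> 'b \<Rightarrow> 'c) \<Rightarrow>
   ('a \<times> 'b \<Rightarrow> 'r) set \<Rightarrow> 'c" where
  "tensor_lift R M N P \<phi> = (\<lambda>X \<in> carrier (tensor R M N).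
     free_lift R (carrier M \<times> carrier N) P (\<lambda>(a, b). \<phi> a b) (SOME x. x \<in> X))"

context
  fixes R :: "'r ring" and M :: "('r, 'a) module" and N :: "('r, 'b) module"
  assumes M: "module R M" and N: "module R N"
begin

interpretation M: module R M by (rule M)
interpretation N: module R N by (rule N)

private abbreviation "F \<equiv> free_mod R (carrier M \<times> carrier N)"
private abbreviation "T \<equiv> tensor_rel R M N"
private abbreviation "e \<equiv> free_gen R :: _ \<Rightarrow> 'a \<times> 'b \<Rightarrow> 'r"

lemma module_F: "module R F" by (rule module_free_mod) (rule M.R.cring_axioms)

interpretation F: module R F by (rule module_F)

private lemma gen: "a \<in> carrier M \<Longrightarrow> b \<in> carrier N \<Longrightarrow> e (a, b) \<in> carrier F"
  by (intro free_gen_closed M.R.cring_axioms) auto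

text \<open>Intended for \<open>K\<close> the kernel of the linear extension of a bilinear
  map.\<close>

lemma tensor_rel_minimal:
  assumes "submodule K R F"
    and "\<And>a a' b. a \<in> carrier M \<Longrightarrow> a' \<in> carrier M \<Longrightarrow> b \<in> carrier N \<Longrightarrow>
      e (a \<oplus>\<^bsub>M\<^esub> a', b) \<ominus>\<^bsub>F\<^esub> (e (a, b) \<oplus>\<^bsub>F\<^esub> e (a', b)) \<in> K"
    and "\<And>a b b'. a \<in> carrier M \<Longrightarrow> b \<in> carrier N \<Longrightarrow> b' \<in> carrier N \<Longrightarrow>
      e (a, b \<oplus>\<^bsub>N\<^esub> b') \<ominus>\<^bsub>F\<^esub> (e (a, b) \<oplus>\<^bsub>F\<^esub> e (a, b')) \<in> K"
    and "\<And>r a b. r \<in> carrier R \<Longrightarrow> a \<in> carrier M \<Longrightarrow> b \<in> carrier N \<Longrightarrow>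
      e (r \<odot>\<^bsub>M\<^esub> a, b) \<ominus>\<^bsub>F\<^esub> (r \<odot>\<^bsub>F\<^esub> e (a, b)) \<in> K"
    and "\<And>r a b. r \<in> carrier R \<Longrightarrow> a \<in> carrier M \<Longrightarrow> b \<in> carrier N \<Longrightarrow>
      e (a, r \<odot>\<^bsub>N\<^esub> b) \<ominus>\<^bsub>F\<^esub> (r \<odot>\<^bsub>F\<^esub> e (a, b)) \<in> K"
  shows "T \<subseteq> K"
  unfolding tensor_rel_def Let_def
  by (rule hull_minimal) (auto simp: assms)

lemma tensor_rel_submodule: "submodule T R F"
  unfolding tensor_rel_def Let_def
  by (rule submodule_hull[OF module_F])
    (auto intro!: F.M.minus_closed F.M.a_closed F.smult_closed gen M.a_closed N.a_closed M.smult_closed N.smult_closed)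

lemma tensor_rel_relations:
  "a \<in> carrier M \<Longrightarrow> a' \<in> carrier M \<Longrightarrow> b \<in> carrier N \<Longrightarrow>
    e (a \<oplus>\<^bsub>M\<^esub> a', b) \<ominus>\<^bsub>F\<^esub> (e (a, b) \<oplus>\<^bsub>F\<^esub> e (a', b)) \<in> T"
  "a \<in> carrier M \<Longrightarrow> b \<in> carrier N \<Longrightarrow> b' \<in> carrier N \<Longrightarrow>
    e (a, b \<oplus>\<^bsub>N\<^esub> b') \<ominus>\<^bsub>F\<^esub> (e (a, b) \<oplus>\<^bsub>F\<^esub> e (a, b')) \<in> T"
  "r \<in> carrier R \<Longrightarrow> a \<in> carrier M \<Longrightarrow> b \<in> carrier N \<Longrightarrow>
    e (r \<odot>\<^bsub>M\<^esub> a, b) \<ominus>\<^bsub>F\<^esub> (r \<odot>\<^bsub>F\<^esub> e (a, b)) \<in> T"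
  "r \<in> carrier R \<Longrightarrow> a \<in> carrier M \<Longrightarrow> b \<in> carrier N \<Longrightarrow>
    e (a, r \<odot>\<^bsub>N\<^esub> b) \<ominus>\<^bsub>F\<^esub> (r \<odot>\<^bsub>F\<^esub> e (a, b)) \<in> T"
  unfolding tensor_rel_def Let_def by (rule hull_inc, blast)+

lemma module_tensor: "module R (tensor R M N)"
  unfolding tensor_def by (rule module_quot_mod[OF module_F tensor_rel_submodule])

lemmas tensor_simps = quot_mod_simps[OF module_F tensor_rel_submodule, folded tensor_def]

text \<open>Each law of bilinearity says that two cosets agree, and their difference is one of the
  four kinds of generators of \<open>tensor_rel\<close>.\<close>

lemma bilinear_pure: "bilinear R M N (tensor R M N) (pure R M N)"
proof -
  note eq = rcos_eqI[OF module_F tensor_rel_submodule]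
  show ?thesis
  proof (rule bilinearI, goal_cases)
    case (1 a b) then show ?case by (auto simp: tensor_simps pure_def gen)
  next
    case (2 a a' b) then show ?case
      by (simp add: tensor_simps pure_def gen)
        (intro eq tensor_rel_relations gen F.a_closed M.a_closed; assumption)
  next
    case (3 a b b') then show ?case
      by (simp add: tensor_simps pure_def gen)
        (intro eq tensor_rel_relations gen F.a_closed N.a_closed; assumption)
  next
    case (4 r a b) then show ?case
      by (simp add: tensor_simps pure_def gen)
        (intro eq tensor_rel_relations gen F.smult_closed M.smult_closed; assumption)
  next
    case (5 r a b) then show ?case
      by (simp add: tensor_simps pure_def gen)
        (intro eq tensor_rel_relations gen F.smult_closed N.smult_closed; assumption)
  qed
qed

text \<open>Precomposing with the quotient map gives linear maps on the free module, where agreement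
  on generators suffices.\<close>

lemma tensor_ext:
  assumes P: "module R P"
    and f: "f \<in> lin R (tensor R M N) P" and g: "g \<in> lin R (tensor R M N) P"
    and eq: "\<And>a b. a \<in> carrier M \<Longrightarrow> b \<in> carrier N \<Longrightarrow> f (pure R M N a b) = g (pure R M N a b)"
  shows "f = g"
proof (rule lin_ext[OF f g])
  let ?q = "\<lambda>x \<in> carrier F. T +>\<^bsub>F\<^esub> x"
  have q: "?q \<in> lin R F (tensor R M N)"
    by (rule lin_restrictI[OF module_F]) (auto simp: tensor_simps)
  have "compose (carrier F) f ?q = compose (carrier F) g ?q"
    by (rule free_mod_ext[OF P lin_compose[OF module_F q f] lin_compose[OF module_F q g]])
      (auto simp: compose_eq gen eq[unfolded pure_def])
  note * = fun_cong[OF this]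
  fix X assume "X \<in> carrier (tensor R M N)"
  then obtain x where "x \<in> carrier F" "X = T +>\<^bsub>F\<^esub> x" by (auto simp: tensor_simps)
  with *[of x] show "f X = g X" by (simp add: compose_eq)
qed

context
  fixes P :: "('r, 'c) module" and \<phi> :: "'a \<Rightarrow> 'b \<Rightarrow> 'c"
  assumes P: "module R P" and \<phi>: "bilinear R M N P \<phi>"
begin

interpretation P: module R P by (rule P)

private abbreviation "L \<equiv> free_lift R (carrier M \<times> carrier N) P (\<lambda>(a, b). \<phi> a b)"

private lemma \<phi>': "(\<lambda>(a, b). \<phi> a b) \<in> carrier M \<times> carrier N \<rightarrow> carrier P"
  using bilinearD(1)[OF \<phi>] by auto

private lemmas L_lin = free_lift(1)[OF P \<phi>']

private lemma L_gen: "a \<in> carrier M \<Longrightarrow> b \<in> carrier N \<Longrightarrow> L (e (a, b)) = \<phi> a b"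
  by (subst free_lift(2)[OF P \<phi>']) auto

text \<open>Bilinearity of \<phi> says exactly that the four kinds of relations lie in the kernel of
  \<open>L\<close>, and a kernel is a submodule.\<close>

private lemma L_tensor_rel: "T \<subseteq> {x \<in> carrier F. L x = \<zero>\<^bsub>P\<^esub>}"
proof (rule tensor_rel_minimal)
  show "submodule {x \<in> carrier F. L x = \<zero>\<^bsub>P\<^esub>} R F"
    by (intro F.submoduleI)
      (auto simp: lin_zero[OF module_F P L_lin] lin_neg[OF module_F P L_lin] lin_add[OF L_lin] lin_smult[OF L_lin])
qed (auto simp: lin_minus[OF module_F P L_lin] gen L_gen lin_add[OF L_lin] lin_smult[OF L_lin] bilinearD[OF \<phi>]
  P.M.r_neg a_minus_def[of P])

private lemma L_some: 
  assumes "x \<in> carrier F" shows "L (SOME y. y \<in> T +>\<^bsub>F\<^esub> x) = L x"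
proof -
  have "(SOME y. y \<in> T +>\<^bsub>F\<^esub> x) \<in> T +>\<^bsub>F\<^esub> x"
    using rcos_self[OF module_F tensor_rel_submodule assms] by (rule someI[of "\<lambda>y. y \<in> T +>\<^bsub>F\<^esub> x"])
  then obtain h where "h \<in> T" "h \<in> carrier F" "(SOME y. y \<in> T +>\<^bsub>F\<^esub> x) = h \<oplus>\<^bsub>F\<^esub> x"
    by (rule rcosD[OF module_F tensor_rel_submodule])
  then show ?thesis
    using assms L_tensor_rel by (auto simp: lin_add[OF L_lin] lin_closed[OF L_lin])
qed

lemma tensor_lift_lin: "tensor_lift R M N P \<phi> \<in> lin R (tensor R M N) P"
  unfolding tensor_lift_def
  by (rule lin_restrictI[OF module_tensor])
    (auto simp: tensor_simps L_some lin_add[OF L_lin] lin_smult[OF L_lin] lin_closed[OF L_lin])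

lemma tensor_lift_pure:
  "a \<in> carrier M \<Longrightarrow> b \<in> carrier N \<Longrightarrow> tensor_lift R M N P \<phi> (pure R M N a b) = \<phi> a b"
  unfolding tensor_lift_def
  using bilinearD(1)[OF bilinear_pure, of a b]
  by simp (simp add: pure_def L_some gen L_gen)

end

end

section \<open>Tensor products of bigraded modules\<close>

lemma bigraded_moduleD: "bigraded_module R A \<Longrightarrow> module R (A i j)"
  by (simp add: bigraded_module_def)

lemma bg_mapsI:
  "(\<And>i j. f i j \<in> lin R (A i j) (B (i + p) (j + q))) \<Longrightarrow> f \<in> bg_maps R A B p q"
  by (simp add: bg_maps_def)

lemma bg_mapsD: "f \<in> bg_maps R A B p q \<Longrightarrow> f i j \<in> lin R (A i j) (B (i + p) (j + q))"
  by (simp add: bg_maps_def)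

lemma bg_maps_ext:
  assumes "f \<in> bg_maps R A B p q" "g \<in> bg_maps R A B' p' q'"
    and "\<And>i j x. x \<in> carrier (A i j) \<Longrightarrow> f i j x = g i j x"
  shows "f = g"
proof (intro ext)
  fix i j x
  have "f i j = g i j"
    by (rule lin_ext[OF bg_mapsD[OF assms(1)] bg_mapsD[OF assms(2)] assms(3)])
  then show "f i j x = g i j x" by simp
qed

text \<open>The degrees of the target are often only propositionally equal to sums.\<close>

lemma bg_mapsD':
  "f \<in> bg_maps R A B p q \<Longrightarrow> i' = i + p \<Longrightarrow> j' = j + q \<Longrightarrow> f i j \<in> lin R (A i j) (B i' j')"
  by (simp add: bg_maps_def)

context
  fixes R :: "'r ring" and A :: "('r, 'a) bgmod" and B :: "('r, 'b) bgmod"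
  assumes R: "cring R" and A: "bigraded_module R A" and B: "bigraded_module R B"
begin

private abbreviation "TT i j \<equiv> (\<lambda>(p, q). tensor R (A p q) (B (i - p) (j - q)))"

private lemma TT: "module R (TT i j pq)"
  by (auto split: prod.split intro: module_tensor bigraded_moduleD[OF A] bigraded_moduleD[OF B])

lemma bigraded_module_bg_tensor: "bigraded_module R (bg_tensor R A B)"
  unfolding bigraded_module_def bg_tensor_def
  by (intro allI module_dsum[OF R TT])

private lemma bg_pure_single:
  "bg_pure R A B p q s t a b =
    dsum_single (TT (p + s) (q + t)) (p, q) (pure R (A p q) (B s t) a b)"
  by (auto simp: bg_pure_def dsum_single_def fun_eq_iff)

text \<open>Callers meet the target bidegree in rebracketed or shifted form, hence the variables
  \<open>i\<close>, \<open>j\<close> with equations.\<close>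

lemma bilinear_bg_pure:
  assumes "i = p + s" "j = q + t"
  shows "bilinear R (A p q) (B s t) (bg_tensor R A B i j) (bg_pure R A B p q s t)"
proof -
  let ?L = "\<lambda>x \<in> carrier (TT i j (p, q)). dsum_single (TT i j) (p, q) x"
  have L: "?L \<in> lin R (TT i j (p, q)) (bg_tensor R A B i j)"
    unfolding bg_tensor_def by (rule dsum_single_lin[OF R TT])
  note bp = bilinear_pure[OF bigraded_moduleD[OF A] bigraded_moduleD[OF B]]
  have eq: "TT i j (p, q) = tensor R (A p q) (B s t)" using assms by simp
  have pure: "bg_pure R A B p q s t a b = ?L (pure R (A p q) (B s t) a b)"
    if "a \<in> carrier (A p q)" "b \<in> carrier (B s t)" for a b
    using bilinearD(1)[OF bp that] assms by (simp add: bg_pure_single)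
  interpret A: module R "A p q" by (rule bigraded_moduleD[OF A])
  interpret B: module R "B s t" by (rule bigraded_moduleD[OF B])
  show ?thesis
    by (rule bilinearI)
     (use L in \<open>simp_all only: eq pure A.a_closed B.a_closed A.smult_closed B.smult_closed
       bilinearD[OF bp] lin_closed[OF L] lin_add[OF L] lin_smult[OF L]
       lin_closed[OF L, unfolded eq] lin_add[OF L, unfolded eq] lin_smult[OF L, unfolded eq]\<close>)
qed

text \<open>\<open>dsum_ext\<close> reduces to one summand and \<open>tensor_ext\<close> to its pure
  tensors. All identities between maps out of tensor products are proved in this way.\<close>

lemma bg_tensor_ext:
  assumes C: "bigraded_module R C"
    and f: "f \<in> bg_maps R (bg_tensor R A B) C u v" and g: "g \<in> bg_maps R (bg_tensor R A B) C u v"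
    and eq: "\<And>p q s t a b. a \<in> carrier (A p q) \<Longrightarrow> b \<in> carrier (B s t) \<Longrightarrow>
      f (p + s) (q + t) (bg_pure R A B p q s t a b) = g (p + s) (q + t) (bg_pure R A B p q s t a b)"
  shows "f = g"
proof (rule bg_maps_ext[OF f g])
  fix i j x
  note Am = bigraded_moduleD[OF A] and Bm = bigraded_moduleD[OF B] and Cm = bigraded_moduleD[OF C]
  have fg: "f i j \<in> lin R (direct_sum (TT i j)) (C (i + u) (j + v))"
    "g i j \<in> lin R (direct_sum (TT i j)) (C (i + u) (j + v))"
    using bg_mapsD[OF f] bg_mapsD[OF g] by (auto simp: bg_tensor_def)
  have "f i j = g i j"
  proof (rule dsum_ext[OF R TT Cm fg])
    fix pq X assume X: "X \<in> carrier (TT i j pq)"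
    obtain p q where pq: "pq = (p, q)" by fastforce
    let ?S = "\<lambda>X \<in> carrier (TT i j pq). dsum_single (TT i j) pq X"
    have S: "?S \<in> lin R (TT i j pq) (direct_sum (TT i j))" by (rule dsum_single_lin[OF R TT])
    have "compose (carrier (TT i j pq)) (f i j) ?S = compose (carrier (TT i j pq)) (g i j) ?S"
    proof (rule tensor_ext[OF Am Bm Cm])
      show "compose (carrier (TT i j pq)) (f i j) ?S \<in>
          lin R (tensor R (A p q) (B (i - p) (j - q))) (C (i + u) (j + v))"
        "compose (carrier (TT i j pq)) (g i j) ?S \<in>
          lin R (tensor R (A p q) (B (i - p) (j - q))) (C (i + u) (j + v))"
        using lin_compose[OF TT S fg(1)] lin_compose[OF TT S fg(2)] by (simp_all add: pq)
    next
      fix a b assume ab: "a \<in> carrier (A p q)" "b \<in> carrier (B (i - p) (j - q))"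
      then show "compose (carrier (TT i j pq)) (f i j) ?S (pure R (A p q) (B (i - p) (j - q)) a b) =
          compose (carrier (TT i j pq)) (g i j) ?S (pure R (A p q) (B (i - p) (j - q)) a b)"
        using eq[OF ab] bilinearD(1)[OF bilinear_pure[OF Am Bm] ab]
        by (simp add: pq compose_eq bg_pure_single)
    qed
    from fun_cong[OF this, of X] X
    show "f i j (dsum_single (TT i j) pq X) = g i j (dsum_single (TT i j) pq X)"
      by (simp add: compose_eq)
  qed
  then show "f i j x = g i j x" by simp
qed

text \<open>This justifies the \<open>THE\<close> in \<open>bg_lift\<close>. For existence, the maps
  given by the universal property on each summand are assembled over the direct sum; uniqueness is
  \<open>bg_tensor_ext\<close>.\<close>

lemma bg_lift_properties:
  assumes C: "bigraded_module R C"
    and \<phi>: "\<And>p q s t. bilinear R (A p q) (B s t) (C (p + s + u) (q + t + v)) (\<phi> p q s t)"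
  shows "bg_lift R A B C u v \<phi> \<in> bg_maps R (bg_tensor R A B) C u v \<and>
    (\<forall>p q s t. \<forall>a \<in> carrier (A p q). \<forall>b \<in> carrier (B s t).
      bg_lift R A B C u v \<phi> (p + s) (q + t) (bg_pure R A B p q s t a b) = \<phi> p q s t a b)"
proof -
  let ?P = "\<lambda>h. h \<in> bg_maps R (bg_tensor R A B) C u v \<and>
    (\<forall>p q s t. \<forall>a \<in> carrier (A p q). \<forall>b \<in> carrier (B s t).
      h (p + s) (q + t) (bg_pure R A B p q s t a b) = \<phi> p q s t a b)"
  note Am = bigraded_moduleD[OF A] and Bm = bigraded_moduleD[OF B] and Cm = bigraded_moduleD[OF C]
  define k where "k i j = (\<lambda>(p, q).
    tensor_lift R (A p q) (B (i - p) (j - q)) (C (i + u) (j + v)) (\<phi> p q (i - p) (j - q)))" for i j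
  define h where "h i j = dsum_lift (TT i j) (C (i + u) (j + v)) (k i j)" for i j
  have k: "k i j pq \<in> lin R (TT i j pq) (C (i + u) (j + v))" for i j pq
  proof (cases pq)
    case (Pair p q)
    show ?thesis
      using \<phi>[of p q "i - p" "j - q"] by (auto simp: k_def Pair intro!: tensor_lift_lin Am Bm Cm)
  qed
  have "h (p + s) (q + t) (bg_pure R A B p q s t a b) = \<phi> p q s t a b"
    if ab: "a \<in> carrier (A p q)" "b \<in> carrier (B s t)" for p q s t a b
  proof -
    have "pure R (A p q) (B s t) a b \<in> carrier (TT (p + s) (q + t) (p, q))"
      using bilinearD(1)[OF bilinear_pure[OF Am Bm] ab] by simp
    from dsum_lift_single[where R = R and P = "C (p + s + u) (q + t + v)" and h = "k (p + s) (q + t)", OF R TT Cm k this]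
    have "h (p + s) (q + t) (bg_pure R A B p q s t a b) =
        k (p + s) (q + t) (p, q) (pure R (A p q) (B s t) a b)"
      by (simp add: h_def bg_pure_single)
    also have "\<dots> = \<phi> p q s t a b"
      using tensor_lift_pure[OF Am Bm Cm \<phi> ab] by (simp add: k_def)
    finally show ?thesis .
  qed
  moreover have "h \<in> bg_maps R (bg_tensor R A B) C u v"
    using dsum_lift_lin[OF R TT Cm k] by (auto intro!: bg_mapsI simp: h_def bg_tensor_def)
  ultimately have "\<exists>h. ?P h" by blast
  then have "\<exists>!h. ?P h" by (rule ex_ex1I) (rule bg_tensor_ext[OF C, of _ u v]; simp)
  then show ?thesis unfolding bg_lift_def by (rule theI')
qed

lemmas bg_lift_maps = bg_lift_properties[THEN conjunct1]

lemma bg_lift_pure: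
  assumes "bigraded_module R C"
    and "\<And>p q s t. bilinear R (A p q) (B s t) (C (p + s + u) (q + t + v)) (\<phi> p q s t)"
    and "a \<in> carrier (A p q)" "b \<in> carrier (B s t)" "i = p + s" "j = q + t"
  shows "bg_lift R A B C u v \<phi> i j (bg_pure R A B p q s t a b) = \<phi> p q s t a b"
  using bg_lift_properties[OF assms(1,2)] assms(3-6) by blast

end

lemma bg_maps_closed:
  "f \<in> bg_maps R A B p q \<Longrightarrow> x \<in> carrier (A i j) \<Longrightarrow> i' = i + p \<Longrightarrow> j' = j + q \<Longrightarrow>
    f i j x \<in> carrier (B i' j')"
  by (auto dest: bg_mapsD intro: lin_closed)

lemma bg_id_maps [simp]: "bigraded_module R A \<Longrightarrow> bg_id A \<in> bg_maps R A A 0 0"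
  by (auto simp: bg_id_def intro!: bg_mapsI lin_restrictI bigraded_moduleD)

lemma bg_comp_maps:
  assumes A: "bigraded_module R A" and f: "f \<in> bg_maps R A B 0 0" and g: "g \<in> bg_maps R B C u v"
  shows "bg_comp A g f \<in> bg_maps R A C u v"
proof (rule bg_mapsI)
  fix i j
  show "bg_comp A g f i j \<in> lin R (A i j) (C (i + u) (j + v))"
    using lin_compose[OF bigraded_moduleD[OF A] bg_mapsD[OF f, of i j, simplified] bg_mapsD[OF g]]
    by (simp add: bg_comp_def)
qed

lemma bg_comp_apply: "x \<in> carrier (A i j) \<Longrightarrow> bg_comp A g f i j x = g i j (f i j x)"
  by (simp add: bg_comp_def compose_eq)

lemma bg_maps_add:
  assumes "bigraded_module R A" "bigraded_module R B" "f \<in> bg_maps R A B p q" "g \<in> bg_maps R A B p q"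
  shows "(\<lambda>i j. \<lambda>x \<in> carrier (A i j). f i j x \<oplus>\<^bsub>B (i + p) (j + q)\<^esub> g i j x) \<in> bg_maps R A B p q"
  by (rule bg_mapsI, rule lin_plus[OF bigraded_moduleD bigraded_moduleD bg_mapsD bg_mapsD]; fact)

lemma bg_maps_smult:
  assumes "bigraded_module R A" "bigraded_module R B" "f \<in> bg_maps R A B p q" "r \<in> carrier R"
  shows "(\<lambda>i j. \<lambda>x \<in> carrier (A i j). r \<odot>\<^bsub>B (i + p) (j + q)\<^esub> f i j x) \<in> bg_maps R A B p q"
  by (rule bg_mapsI, rule lin_scale[OF bigraded_moduleD bigraded_moduleD bg_mapsD]; fact)

lemma bg_zero_maps:
  "bigraded_module R A \<Longrightarrow> bigraded_module R B \<Longrightarrow> bg_zero A B p q \<in> bg_maps R A B p q"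
  unfolding bg_zero_def by (intro bg_mapsI lin_const_zero bigraded_moduleD)

lemma bigraded_module_bg_unit: "cring R \<Longrightarrow> bigraded_module R (bg_unit R)"
  by (simp add: bigraded_module_def module_bg_unit)

context
  fixes R :: "'r ring" and A :: "('r, 'a) bgmod" and B :: "('r, 'b) bgmod"
    and A' :: "('r, 'c) bgmod" and B' :: "('r, 'd) bgmod" and p q s t f g
  assumes R: "cring R" and A: "bigraded_module R A" and B: "bigraded_module R B"
    and A': "bigraded_module R A'" and B': "bigraded_module R B'"
    and f: "f \<in> bg_maps R A A' p q" and g: "g \<in> bg_maps R B B' s t"
begin

private lemma tens_bilinear:
  "bilinear R (A i j) (B k l) (bg_tensor R A' B' (i + k + (p + s)) (j + l + (q + t)))
    (\<lambda>a b. sign_pow (bg_tensor R A' B' (i + p + (k + s)) (j + q + (l + t))) n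
      (bg_pure R A' B' (i + p) (j + q) (k + s) (l + t) (f i j a) (g k l b)))"
proof -
  \<comment> \<open>\<open>bg_lift\<close> expects the bidegree of the argument plus that of the
    map, while the pure tensor of the images lies in the sum of the two image bidegrees.\<close>
  have eq: "i + k + (p + s) = i + p + (k + s)" "j + l + (q + t) = j + q + (l + t)" by auto
  note bp = bilinearD[OF bilinear_bg_pure[OF R A' B' refl refl]]
  note f = bg_mapsD[OF f] and g = bg_mapsD[OF g]
  note T = bigraded_moduleD[OF bigraded_module_bg_tensor[OF R A' B']]
  show ?thesis
    unfolding eq
    by (rule bilinearI)
      (auto simp: bp lin_closed[OF f] lin_closed[OF g] lin_add[OF f] lin_add[OF g]
        lin_smult[OF f] lin_smult[OF g] sign_pow_closed[OF T] sign_pow_add[OF T] sign_pow_smult[OF T])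
qed

lemma bg_tens_maps:
  "bg_tens R A B A' B' p q s t f g \<in> bg_maps R (bg_tensor R A B) (bg_tensor R A' B') (p + s) (q + t)"
  unfolding bg_tens_def
  by (rule bg_lift_maps[OF R A B bigraded_module_bg_tensor[OF R A' B'] tens_bilinear])

lemma bg_tens_pure:
  assumes "a \<in> carrier (A i j)" "b \<in> carrier (B k l)" "m = i + k" "n = j + l"
  shows "bg_tens R A B A' B' p q s t f g m n (bg_pure R A B i j k l a b) =
    sign_pow (bg_tensor R A' B' (i + p + (k + s)) (j + q + (l + t))) (s * i + t * j)
      (bg_pure R A' B' (i + p) (j + q) (k + s) (l + t) (f i j a) (g k l b))"
  unfolding bg_tens_def
  by (rule bg_lift_pure[OF R A B bigraded_module_bg_tensor[OF R A' B'] tens_bilinear assms])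

end

lemma bg_tens_pure_0:
  assumes "cring R" "bigraded_module R A" "bigraded_module R B" "bigraded_module R A'" "bigraded_module R B'"
    and "f \<in> bg_maps R A A' 0 0" "g \<in> bg_maps R B B' 0 0"
    and "a \<in> carrier (A i j)" "b \<in> carrier (B k l)" "m = i + k" "n = j + l"
  shows "bg_tens R A B A' B' 0 0 0 0 f g m n (bg_pure R A B i j k l a b) =
    bg_pure R A' B' i j k l (f i j a) (g k l b)"
  using bg_tens_pure[OF assms] by simp

lemma bg_tens_maps_0:
  assumes "cring R" "bigraded_module R A" "bigraded_module R B" "bigraded_module R A'" "bigraded_module R B'"
    and "f \<in> bg_maps R A A' 0 0" "g \<in> bg_maps R B B' 0 0"
  shows "bg_tens R A B A' B' 0 0 0 0 f g \<in> bg_maps R (bg_tensor R A B) (bg_tensor R A' B') 0 0"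
  using bg_tens_maps[OF assms] by simp

section \<open>Associators and unitors\<close>

context
  fixes R :: "'r ring" and A :: "('r, 'a) bgmod" and B :: "('r, 'b) bgmod" and C :: "('r, 'c) bgmod"
  assumes R: "cring R" and A: "bigraded_module R A" and B: "bigraded_module R B" and C: "bigraded_module R C"
begin

private lemmas AB = bigraded_module_bg_tensor[OF R A B]
private lemmas BC = bigraded_module_bg_tensor[OF R B C]
private lemmas ABC = bigraded_module_bg_tensor[OF R A BC]

text \<open>For a fixed \<open>c\<close> in the third factor, \<open>x\<close> going to the image of
  \<open>x\<close> tensor \<open>c\<close> is a map on \<open>bg_tensor R A B\<close> whose bidegree
  is shifted by that of \<open>c\<close>. So the two-factor principle applies twice.\<close>

lemma bg_tensor_ext3:
  assumes D: "bigraded_module R D"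
    and f: "f \<in> bg_maps R (bg_tensor R (bg_tensor R A B) C) D u v"
    and g: "g \<in> bg_maps R (bg_tensor R (bg_tensor R A B) C) D u v"
    and eq: "\<And>p q s t k l a b c. a \<in> carrier (A p q) \<Longrightarrow> b \<in> carrier (B s t) \<Longrightarrow> c \<in> carrier (C k l) \<Longrightarrow>
      f (p + s + k) (q + t + l)
        (bg_pure R (bg_tensor R A B) C (p + s) (q + t) k l (bg_pure R A B p q s t a b) c) =
      g (p + s + k) (q + t + l)
        (bg_pure R (bg_tensor R A B) C (p + s) (q + t) k l (bg_pure R A B p q s t a b) c)"
  shows "f = g"
proof (rule bg_tensor_ext[OF R AB C D f g])
  fix p q s t x c
  assume x: "x \<in> carrier (bg_tensor R A B p q)" and c: "c \<in> carrier (C s t)"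
  define k where "k h = (\<lambda>p q. \<lambda>x \<in> carrier (bg_tensor R A B p q).
    h (p + s) (q + t) (bg_pure R (bg_tensor R A B) C p q s t x c) :: 'd)" for h
  note bp = bilinearD[OF bilinear_bg_pure[OF R AB C refl refl]]
  have k: "k h \<in> bg_maps R (bg_tensor R A B) D (s + u) (t + v)"
    if "h \<in> bg_maps R (bg_tensor R (bg_tensor R A B) C) D u v" for h
  proof -
    note h = bg_mapsD[OF that]
    show ?thesis
      unfolding k_def
      by (rule bg_mapsI, rule lin_restrictI[OF bigraded_moduleD[OF AB]])
        (use c in \<open>simp_all add: bp lin_closed[OF h, folded add.assoc] lin_add[OF h] lin_smult[OF h] flip: add.assoc\<close>)
  qed
  have "k f = k g"
  proof (rule bg_tensor_ext[OF R A B D k[OF f] k[OF g]])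
    fix p q s' t' a b
    assume "a \<in> carrier (A p q)" "b \<in> carrier (B s' t')"
    then show "k f (p + s') (q + t') (bg_pure R A B p q s' t' a b) =
      k g (p + s') (q + t') (bg_pure R A B p q s' t' a b)"
      using eq[of a p q b s' t' c s t] c bilinearD(1)[OF bilinear_bg_pure[OF R A B refl refl]]
      by (simp add: k_def)
  qed
  then have "k f p q x = k g p q x" by simp
  then show "f (p + s) (q + t) (bg_pure R (bg_tensor R A B) C p q s t x c) =
    g (p + s) (q + t) (bg_pure R (bg_tensor R A B) C p q s t x c)"
    using x by (simp add: k_def)
qed

text \<open>The associator with its third argument fixed: a tensor b goes to a tensor (b tensor c).
  The associator is the lift of \<open>\<alpha>1 s t c p q x\<close> as a function of
  \<open>x\<close> and \<open>c\<close>.\<close>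

private definition "\<alpha>1 s t c = bg_lift R A B (bg_tensor R A (bg_tensor R B C)) s t
  (\<lambda>p q p' q' a b. bg_pure R A (bg_tensor R B C) p q (p' + s) (q' + t) a (bg_pure R B C p' q' s t b c))"

private lemma \<alpha>1_bilinear:
  assumes c: "c \<in> carrier (C s t)"
  shows "bilinear R (A p q) (B p' q') (bg_tensor R A (bg_tensor R B C) (p + p' + s) (q + q' + t))
    (\<lambda>a b. bg_pure R A (bg_tensor R B C) p q (p' + s) (q' + t) a (bg_pure R B C p' q' s t b c))"
proof -
  note bp = bilinearD[OF bilinear_bg_pure[OF R A BC add.assoc add.assoc]]
    bilinearD[OF bilinear_bg_pure[OF R B C refl refl]]
  show ?thesis by (rule bilinearI) (simp_all add: bp c)
qed

private lemma \<alpha>1_maps: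
  "c \<in> carrier (C s t) \<Longrightarrow>
    \<alpha>1 s t c \<in> bg_maps R (bg_tensor R A B) (bg_tensor R A (bg_tensor R B C)) s t"
  unfolding \<alpha>1_def by (rule bg_lift_maps[OF R A B ABC]) (rule \<alpha>1_bilinear)

private lemma \<alpha>1_pure:
  "c \<in> carrier (C s t) \<Longrightarrow> a \<in> carrier (A p q) \<Longrightarrow> b \<in> carrier (B p' q') \<Longrightarrow>
    \<alpha>1 s t c (p + p') (q + q') (bg_pure R A B p q p' q' a b) =
      bg_pure R A (bg_tensor R B C) p q (p' + s) (q' + t) a (bg_pure R B C p' q' s t b c)"
  unfolding \<alpha>1_def by (subst bg_lift_pure[OF R A B ABC]) (auto intro: \<alpha>1_bilinear)

text \<open>Linearity in \<open>x\<close> is built into the lift; linearity in \<open>c\<close> is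
  not, and is obtained by comparing two maps of \<open>x\<close> on pure tensors.\<close>

private lemma \<alpha>1_add:
  assumes c: "c \<in> carrier (C s t)" "c' \<in> carrier (C s t)" and x: "x \<in> carrier (bg_tensor R A B p q)"
  shows "\<alpha>1 s t (c \<oplus>\<^bsub>C s t\<^esub> c') p q x =
    \<alpha>1 s t c p q x \<oplus>\<^bsub>bg_tensor R A (bg_tensor R B C) (p + s) (q + t)\<^esub> \<alpha>1 s t c' p q x"
proof -
  interpret C: module R "C s t" by (rule bigraded_moduleD[OF C])
  note bp = bilinearD[OF bilinear_bg_pure[OF R A BC add.assoc add.assoc]]
    bilinearD[OF bilinear_bg_pure[OF R B C refl refl]] 
    bilinearD[OF bilinear_bg_pure[OF R A B refl refl]]
  let ?h = "\<lambda>i j. \<lambda>x \<in> carrier (bg_tensor R A B i j).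
    \<alpha>1 s t c i j x \<oplus>\<^bsub>bg_tensor R A (bg_tensor R B C) (i + s) (j + t)\<^esub> \<alpha>1 s t c' i j x"
  have "\<alpha>1 s t (c \<oplus>\<^bsub>C s t\<^esub> c') = ?h"
    by (rule bg_tensor_ext[OF R A B ABC \<alpha>1_maps bg_maps_add[OF AB ABC \<alpha>1_maps \<alpha>1_maps]])
      (use c in \<open>simp_all add: \<alpha>1_pure bp\<close>)
  then show ?thesis using x by simp
qed

private lemma \<alpha>1_smult:
  assumes c: "c \<in> carrier (C s t)" and r: "r \<in> carrier R" and x: "x \<in> carrier (bg_tensor R A B p q)"
  shows "\<alpha>1 s t (r \<odot>\<^bsub>C s t\<^esub> c) p q x =
    r \<odot>\<^bsub>bg_tensor R A (bg_tensor R B C) (p + s) (q + t)\<^esub> \<alpha>1 s t c p q x"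
proof -
  interpret C: module R "C s t" by (rule bigraded_moduleD[OF C])
  note bp = bilinearD[OF bilinear_bg_pure[OF R A BC add.assoc add.assoc]]
    bilinearD[OF bilinear_bg_pure[OF R B C refl refl]]
    bilinearD[OF bilinear_bg_pure[OF R A B refl refl]]
  let ?h = "\<lambda>i j. \<lambda>x \<in> carrier (bg_tensor R A B i j).
    r \<odot>\<^bsub>bg_tensor R A (bg_tensor R B C) (i + s) (j + t)\<^esub> \<alpha>1 s t c i j x"
  have "\<alpha>1 s t (r \<odot>\<^bsub>C s t\<^esub> c) = ?h"
    by (rule bg_tensor_ext[OF R A B ABC \<alpha>1_maps bg_maps_smult[OF AB ABC \<alpha>1_maps]])
      (use c r in \<open>simp_all add: \<alpha>1_pure bp\<close>)
  then show ?thesis using x by simp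
qed

text \<open>Existence comes from lifting \<open>\<alpha>1\<close>, uniqueness from
  \<open>bg_tensor_ext3\<close>; together they make the \<open>THE\<close> meaningful.\<close>

lemma bg_associator_properties:
  "bg_associator R A B C \<in>
     bg_maps R (bg_tensor R (bg_tensor R A B) C) (bg_tensor R A (bg_tensor R B C)) 0 0 \<and>
   (\<forall>p q s t k l. \<forall>a \<in> carrier (A p q). \<forall>b \<in> carrier (B s t). \<forall>c \<in> carrier (C k l).
      bg_associator R A B C (p + s + k) (q + t + l)
        (bg_pure R (bg_tensor R A B) C (p + s) (q + t) k l (bg_pure R A B p q s t a b) c) =
      bg_pure R A (bg_tensor R B C) p q (s + k) (t + l) a (bg_pure R B C s t k l b c))"
proof -
  let ?P = "\<lambda>h.
     h \<in> bg_maps R (bg_tensor R (bg_tensor R A B) C) (bg_tensor R A (bg_tensor R B C)) 0 0 \<and>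
   (\<forall>p q s t k l. \<forall>a \<in> carrier (A p q). \<forall>b \<in> carrier (B s t). \<forall>c \<in> carrier (C k l).
      h (p + s + k) (q + t + l)
        (bg_pure R (bg_tensor R A B) C (p + s) (q + t) k l (bg_pure R A B p q s t a b) c) =
      bg_pure R A (bg_tensor R B C) p q (s + k) (t + l) a (bg_pure R B C s t k l b c))"
  let ?\<phi> = "\<lambda>p q s t x c. \<alpha>1 s t c p q x"
  let ?h = "bg_lift R (bg_tensor R A B) C (bg_tensor R A (bg_tensor R B C)) 0 0 ?\<phi>"
  have bil: "bilinear R (bg_tensor R A B p q) (C s t)
      (bg_tensor R A (bg_tensor R B C) (p + s + 0) (q + t + 0)) (?\<phi> p q s t)" for p q s t
  proof -
    note m = bg_mapsD[OF \<alpha>1_maps]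
    show ?thesis
      by (rule bilinearI)
        (simp_all add: lin_closed[OF m] lin_add[OF m] lin_smult[OF m] \<alpha>1_add \<alpha>1_smult)
  qed
  note h = bg_lift_maps[OF R AB C ABC bil] bg_lift_pure[OF R AB C ABC bil]
  have "\<exists>h. ?P h"
    by (intro exI[of _ ?h])
      (auto simp: h \<alpha>1_pure bilinearD(1)[OF bilinear_bg_pure[OF R A B refl refl]])
  then have "\<exists>!h. ?P h" by (rule ex_ex1I) (rule bg_tensor_ext3[OF ABC, of _ 0 0]; simp)
  then show ?thesis unfolding bg_associator_def by (rule theI')
qed

lemmas bg_associator_maps = bg_associator_properties[THEN conjunct1]
lemmas bg_associator_pure = bg_associator_properties[THEN conjunct2, rule_format]

end

context
  fixes R :: "'r ring" and A :: "('r, 'a) bgmod"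
  assumes R: "cring R" and A: "bigraded_module R A"
begin

private lemmas U = bigraded_module_bg_unit[OF R]

text \<open>The unitor is not constructed separately. The composite on the other side of the unit
  axiom meets its specification, so by uniqueness it is what the \<open>THE\<close> selects.\<close>

lemma bg_left_unitor_unique:
  assumes h: "h \<in> bg_maps R (bg_tensor R (bg_unit R) A) A 0 0"
    and eq: "\<And>i j r a. r \<in> carrier R \<Longrightarrow> a \<in> carrier (A i j) \<Longrightarrow>
      h i j (bg_pure R (bg_unit R) A 0 0 i j r a) = r \<odot>\<^bsub>A i j\<^esub> a"
  shows "h = bg_left_unitor R A"
  unfolding bg_left_unitor_def
proof (rule the_equality[symmetric], goal_cases)
  case 1
  show ?case using h eq by blast
next
  case (2 h')
  then have h': "h' \<in> bg_maps R (bg_tensor R (bg_unit R) A) A 0 0"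
    and eq': "\<And>i j r a. r \<in> carrier R \<Longrightarrow> a \<in> carrier (A i j) \<Longrightarrow>
      h' i j (bg_pure R (bg_unit R) A 0 0 i j r a) = r \<odot>\<^bsub>A i j\<^esub> a" by blast+
  show ?case
  proof (rule bg_tensor_ext[OF R U A A h' h], goal_cases)
    case (1 p q s t x y)
    note T = bigraded_moduleD[OF bigraded_module_bg_tensor[OF R U A]]
    show ?case
    proof (cases "p = 0 \<and> q = 0")
      case True
      then show ?thesis using eq eq' 1 by (simp add: bg_unit_simps)
    next
      \<comment> \<open>Outside bidegree (0, 0) the unit object is zero, so such pure tensors
        vanish; the specification speaks about bidegree (0, 0) only.\<close>
      case False
      then have "x = \<zero>\<^bsub>bg_unit R p q\<^esub>" using 1 by (auto simp: bg_unit_simps)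
      then have "bg_pure R (bg_unit R) A p q s t x y = \<zero>\<^bsub>bg_tensor R (bg_unit R) A (p + s) (q + t)\<^esub>"
        using bilinear_zero_left[OF bigraded_moduleD[OF U] T bilinear_bg_pure[OF R U A refl refl] 1(2)]
        by simp
      then show ?thesis
        using lin_zero[OF T bigraded_moduleD[OF A] bg_mapsD[OF h]]
          lin_zero[OF T bigraded_moduleD[OF A] bg_mapsD[OF h']]
        by simp
    qed
  qed
qed

lemma bg_right_unitor_unique:
  assumes h: "h \<in> bg_maps R (bg_tensor R A (bg_unit R)) A 0 0"
    and eq: "\<And>i j r a. r \<in> carrier R \<Longrightarrow> a \<in> carrier (A i j) \<Longrightarrow>
      h i j (bg_pure R A (bg_unit R) i j 0 0 a r) = r \<odot>\<^bsub>A i j\<^esub> a"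
  shows "h = bg_right_unitor R A"
  unfolding bg_right_unitor_def
proof (rule the_equality[symmetric], goal_cases)
  case 1
  show ?case using h eq by blast
next
  case (2 h')
  then have h': "h' \<in> bg_maps R (bg_tensor R A (bg_unit R)) A 0 0"
    and eq': "\<And>i j r a. r \<in> carrier R \<Longrightarrow> a \<in> carrier (A i j) \<Longrightarrow>
      h' i j (bg_pure R A (bg_unit R) i j 0 0 a r) = r \<odot>\<^bsub>A i j\<^esub> a" by blast+
  show ?case
  proof (rule bg_tensor_ext[OF R A U A h' h], goal_cases)
    case (1 p q s t x y)
    note T = bigraded_moduleD[OF bigraded_module_bg_tensor[OF R A U]]
    show ?case
    proof (cases "s = 0 \<and> t = 0")
      case True
      then show ?thesis using eq eq' 1 by (simp add: bg_unit_simps)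
    next
      case False
      then have "y = \<zero>\<^bsub>bg_unit R s t\<^esub>" using 1 by (auto simp: bg_unit_simps)
      then have "bg_pure R A (bg_unit R) p q s t x y = \<zero>\<^bsub>bg_tensor R A (bg_unit R) (p + s) (q + t)\<^esub>"
        using bilinear_zero_right[OF bigraded_moduleD[OF U] T bilinear_bg_pure[OF R A U refl refl] 1(1)]
        by simp
      then show ?thesis
        using lin_zero[OF T bigraded_moduleD[OF A] bg_mapsD[OF h]]
          lin_zero[OF T bigraded_moduleD[OF A] bg_mapsD[OF h']]
        by simp
    qed
  qed
qed

end

section \<open>Enriched categories presented by elements\<close>

lemma bg_elem_maps:
  assumes R: "cring R" and H: "bigraded_module R H" and e: "e \<in> carrier (H 0 0)"
  shows "bg_elem R H e \<in> bg_maps R (bg_unit R) H 0 0"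
proof (rule bg_mapsI)
  fix i j
  interpret R: cring R by (rule R)
  interpret H: module R "H i j" for i j by (rule bigraded_moduleD[OF H])
  show "bg_elem R H e i j \<in> lin R (bg_unit R i j) (H (i + 0) (j + 0))"
    unfolding bg_elem_def
    by (rule lin_restrictI[OF module_bg_unit[OF R]])
      (auto simp: bg_unit_simps e H.smult_l_distr H.smult_assoc1 split: if_splits)
qed

text \<open>
  A category enriched in bigraded modules given by a composition \<open>c\<close> of elements and by elements
  \<open>e X\<close>, so that the axioms become identities between elements.
\<close>

locale presented_category =
  fixes R :: "'r ring" and C :: "('o, 'r, 'h, 'z) bg_cat_scheme"
    and c :: "'o \<Rightarrow> 'o \<Rightarrow> 'o \<Rightarrow> int \<Rightarrow> int \<Rightarrow> int \<Rightarrow> int \<Rightarrow> 'h \<Rightarrow> 'h \<Rightarrow> 'h" and e :: "'o \<Rightarrow> 'h"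
  assumes R: "cring R"
    and hom_module: "X \<in> Ob C \<Longrightarrow> Y \<in> Ob C \<Longrightarrow> bigraded_module R (Hom C X Y)"
    and c_bilinear: "X \<in> Ob C \<Longrightarrow> Y \<in> Ob C \<Longrightarrow> Z \<in> Ob C \<Longrightarrow>
      bilinear R (Hom C Y Z p q) (Hom C X Y s t) (Hom C X Z (p + s) (q + t)) (c X Y Z p q s t)"
    and c_assoc: "X \<in> Ob C \<Longrightarrow> Y \<in> Ob C \<Longrightarrow> Z \<in> Ob C \<Longrightarrow> W \<in> Ob C \<Longrightarrow>
      f \<in> carrier (Hom C Z W p q) \<Longrightarrow> g \<in> carrier (Hom C Y Z s t) \<Longrightarrow> h \<in> carrier (Hom C X Y k l) \<Longrightarrow>
      c X Y W (p + s) (q + t) k l (c Y Z W p q s t f g) h =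
      c X Z W p q (s + k) (t + l) f (c X Y Z s t k l g h)"
    and e_closed: "X \<in> Ob C \<Longrightarrow> e X \<in> carrier (Hom C X X 0 0)"
    and c_left: "X \<in> Ob C \<Longrightarrow> Y \<in> Ob C \<Longrightarrow> f \<in> carrier (Hom C X Y p q) \<Longrightarrow> c X Y Y 0 0 p q (e Y) f = f"
    and c_right: "X \<in> Ob C \<Longrightarrow> Y \<in> Ob C \<Longrightarrow> f \<in> carrier (Hom C X Y p q) \<Longrightarrow> c X X Y p q 0 0 f (e X) = f"
    and Comp_eq: "X \<in> Ob C \<Longrightarrow> Y \<in> Ob C \<Longrightarrow> Z \<in> Ob C \<Longrightarrow>
      Comp C X Y Z = bg_lift R (Hom C Y Z) (Hom C X Y) (Hom C X Z) 0 0 (c X Y Z)"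
    and Unit_eq: "X \<in> Ob C \<Longrightarrow> Unit C X = bg_elem R (Hom C X X) (e X)"
begin

lemma hom: "X \<in> Ob C \<Longrightarrow> Y \<in> Ob C \<Longrightarrow> module R (Hom C X Y i j)"
  by (rule bigraded_moduleD[OF hom_module])

lemma c_closed:
  "X \<in> Ob C \<Longrightarrow> Y \<in> Ob C \<Longrightarrow> Z \<in> Ob C \<Longrightarrow> f \<in> carrier (Hom C Y Z p q) \<Longrightarrow> g \<in> carrier (Hom C X Y s t) \<Longrightarrow>
    i = p + s \<Longrightarrow> j = q + t \<Longrightarrow> c X Y Z p q s t f g \<in> carrier (Hom C X Z i j)"
  using bilinearD(1)[OF c_bilinear] by simp

lemma Comp_maps:
  "X \<in> Ob C \<Longrightarrow> Y \<in> Ob C \<Longrightarrow> Z \<in> Ob C \<Longrightarrow>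
    Comp C X Y Z \<in> bg_maps R (bg_tensor R (Hom C Y Z) (Hom C X Y)) (Hom C X Z) 0 0"
  using c_bilinear by (simp add: Comp_eq bg_lift_maps[OF R] hom_module)

lemma Comp_pure:
  "X \<in> Ob C \<Longrightarrow> Y \<in> Ob C \<Longrightarrow> Z \<in> Ob C \<Longrightarrow> f \<in> carrier (Hom C Y Z p q) \<Longrightarrow> g \<in> carrier (Hom C X Y s t) \<Longrightarrow>
    i = p + s \<Longrightarrow> j = q + t \<Longrightarrow>
    Comp C X Y Z i j (bg_pure R (Hom C Y Z) (Hom C X Y) p q s t f g) = c X Y Z p q s t f g"
  using c_bilinear by (simp add: Comp_eq bg_lift_pure[OF R] hom_module)

lemma Unit_maps: "X \<in> Ob C \<Longrightarrow> Unit C X \<in> bg_maps R (bg_unit R) (Hom C X X) 0 0"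
  by (simp add: Unit_eq bg_elem_maps R hom_module e_closed)

lemma Unit_0: "X \<in> Ob C \<Longrightarrow> r \<in> carrier R \<Longrightarrow> Unit C X 0 0 r = r \<odot>\<^bsub>Hom C X X 0 0\<^esub> e X"
  by (simp add: Unit_eq bg_elem_def bg_unit_simps)

text \<open>On (f tensor g) tensor h the two composites become the two sides of
  \<open>c_assoc\<close>.\<close>

lemma associativity:
  assumes X: "X \<in> Ob C" and Y: "Y \<in> Ob C" and Z: "Z \<in> Ob C" and W: "W \<in> Ob C"
    and PQS: "P = Hom C Z W" "Q = Hom C Y Z" "S = Hom C X Y" "T = bg_tensor R (bg_tensor R P Q) S"
  shows "bg_comp T (Comp C X Y W)
           (bg_tens R (bg_tensor R P Q) S (Hom C Y W) S 0 0 0 0 (Comp C Y Z W) (bg_id S)) =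
         bg_comp T (Comp C X Z W)
           (bg_comp T (bg_tens R P (bg_tensor R Q S) P (Hom C X Z) 0 0 0 0
                         (bg_id P) (Comp C X Y Z))
              (bg_associator R P Q S))"
proof -
  let ?l = "bg_comp T (Comp C X Y W)
           (bg_tens R (bg_tensor R P Q) S (Hom C Y W) S 0 0 0 0 (Comp C Y Z W) (bg_id S))"
  let ?r = "bg_comp T (Comp C X Z W)
           (bg_comp T (bg_tens R P (bg_tensor R Q S) P (Hom C X Z) 0 0 0 0
                         (bg_id P) (Comp C X Y Z))
              (bg_associator R P Q S))"
  have P: "bigraded_module R P" and Q: "bigraded_module R Q" and S: "bigraded_module R S"
    using X Y Z W by (simp_all add: PQS hom_module)
  note PQ = bigraded_module_bg_tensor[OF R P Q] and QS = bigraded_module_bg_tensor[OF R Q S]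
  have T: "bigraded_module R T" unfolding PQS(4) by (rule bigraded_module_bg_tensor[OF R PQ S])
  have XZ: "bigraded_module R (Hom C X Z)" and YW: "bigraded_module R (Hom C Y W)"
    and XW: "bigraded_module R (Hom C X W)" using X Y Z W by (simp_all add: hom_module)
  note l = bg_tens_maps_0[OF R PQ S YW S Comp_maps[OF Y Z W, folded PQS] bg_id_maps[OF S], folded PQS]
    and r = bg_tens_maps_0[OF R P QS P XZ bg_id_maps[OF P] Comp_maps[OF X Y Z, folded PQS]]
    and a = bg_associator_maps[OF R P Q S, folded PQS]
  note bp = bilinearD(1)[OF bilinear_bg_pure[OF R P Q refl refl]]
    bilinearD(1)[OF bilinear_bg_pure[OF R Q S refl refl]]
    bilinearD(1)[OF bilinear_bg_pure[OF R PQ S refl refl]]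
  show ?thesis
  proof (rule bg_tensor_ext3[OF R P Q S XW,
        OF bg_comp_maps[OF T l Comp_maps[OF X Y W, folded PQS], unfolded PQS(4)]
          bg_comp_maps[OF T bg_comp_maps[OF T a r] Comp_maps[OF X Z W, folded PQS], unfolded PQS(4)],
        folded PQS(4)])
    fix p q s t k l f g h
    assume f: "f \<in> carrier (P p q)" and g: "g \<in> carrier (Q s t)" and h: "h \<in> carrier (S k l)"
    let ?x = "bg_pure R P Q p q s t f g" and ?y = "bg_pure R Q S s t k l g h"
    let ?z = "bg_pure R (bg_tensor R P Q) S (p + s) (q + t) k l ?x h"
    have x: "?x \<in> carrier (bg_tensor R P Q (p + s) (q + t))" using f g by (rule bp)
    have y: "?y \<in> carrier (bg_tensor R Q S (s + k) (t + l))" using g h by (rule bp)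
    have z: "?z \<in> carrier (T (p + s + k) (q + t + l))" using x h unfolding PQS(4) by (rule bp)
    note app = bg_comp_apply[of ?z T "p + s + k" "q + t + l", OF z]
    have fg: "Comp C Y Z W (p + s) (q + t) ?x = c Y Z W p q s t f g"
      using Comp_pure[OF Y Z W, of f p q g s t] f g by (simp add: PQS)
    have gh: "Comp C X Y Z (s + k) (t + l) ?y = c X Y Z s t k l g h"
      using Comp_pure[OF X Y Z, of g s t h k l] g h by (simp add: PQS)
    have fg': "c Y Z W p q s t f g \<in> carrier (Hom C Y W (p + s) (q + t))"
      and gh': "c X Y Z s t k l g h \<in> carrier (Hom C X Z (s + k) (t + l))"
      using f g h X Y Z W by (auto simp: PQS intro: c_closed)
    have "?l
           (p + s + k) (q + t + l) ?z = Comp C X Y W (p + s + k) (q + t + l)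
             (bg_pure R (Hom C Y W) S (p + s) (q + t) k l (c Y Z W p q s t f g) h)"
      using bg_tens_pure_0[OF R PQ S YW S Comp_maps[OF Y Z W, folded PQS] bg_id_maps[OF S] x h refl refl] h
      by (simp add: app fg bg_id_def)
    also have "\<dots> = c X Y W (p + s) (q + t) k l (c Y Z W p q s t f g) h"
      using Comp_pure[OF X Y W fg' h[unfolded PQS(3)] refl refl] by (simp add: PQS)
    also have "\<dots> = c X Z W p q (s + k) (t + l) f (c X Y Z s t k l g h)"
      using f g h by (intro c_assoc X Y Z W) (auto simp: PQS)
    also have "\<dots> = Comp C X Z W (p + s + k) (q + t + l)
        (bg_pure R P (Hom C X Z) p q (s + k) (t + l) f (c X Y Z s t k l g h))"
      using Comp_pure[OF X Z W f[unfolded PQS(1)] gh', of "p + s + k" "q + t + l"]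
      by (simp add: PQS add.assoc)
    also have "\<dots> = ?r (p + s + k) (q + t + l) ?z"
      using bg_tens_pure_0[OF R P QS P XZ bg_id_maps[OF P] Comp_maps[OF X Y Z, folded PQS] f y,
          of "p + s + k" "q + t + l", unfolded add.assoc[symmetric], OF refl refl] f
      by (simp add: app bg_associator_pure[OF R P Q S f g h] gh bg_id_def flip: add.assoc)
    finally show "?l
           (p + s + k) (q + t + l) ?z =
      ?r (p + s + k) (q + t + l) ?z" .
  qed
qed

text \<open>On r tensor a the composite is \<open>c\<close> applied to \<open>r\<close> times the
  identity element and \<open>a\<close>; bilinearity and \<open>c_left\<close> reduce this to
  \<open>r\<close> times \<open>a\<close>, the value that characterizes the unitor.\<close>

lemma left_unit:
  assumes X: "X \<in> Ob C" and Y: "Y \<in> Ob C" and H: "H = Hom C X Y"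
  shows "bg_comp (bg_tensor R (bg_unit R) H) (Comp C X Y Y)
           (bg_tens R (bg_unit R) H (Hom C Y Y) H 0 0 0 0 (Unit C Y) (bg_id H)) = bg_left_unitor R H"
proof -
  have Hm: "bigraded_module R H" and YY: "bigraded_module R (Hom C Y Y)"
    using X Y by (simp_all add: H hom_module)
  note U = bigraded_module_bg_unit[OF R]
  note T = bigraded_module_bg_tensor[OF R U Hm]
  note bp = bilinearD(1)[OF bilinear_bg_pure[OF R U Hm, of _ 0 _ _ 0]]
  note m = bg_tens_maps_0[OF R U Hm YY Hm Unit_maps[OF Y] bg_id_maps[OF Hm]]
  let ?f = "bg_comp (bg_tensor R (bg_unit R) H) (Comp C X Y Y)
           (bg_tens R (bg_unit R) H (Hom C Y Y) H 0 0 0 0 (Unit C Y) (bg_id H))"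
  have maps: "?f \<in> bg_maps R (bg_tensor R (bg_unit R) H) H 0 0"
    using bg_comp_maps[OF T m Comp_maps[OF X Y Y, folded H]] by (simp add: H)
  have eq: "?f i j (bg_pure R (bg_unit R) H 0 0 i j r a) = r \<odot>\<^bsub>H i j\<^esub> a"
    if r: "r \<in> carrier R" and a: "a \<in> carrier (H i j)" for i j r a
  proof -
    interpret YY: module R "Hom C Y Y 0 0" using Y by (intro hom)
    have r': "r \<in> carrier (bg_unit R 0 0)" using r by (simp add: bg_unit_simps)
    have "bg_pure R (bg_unit R) H 0 0 i j r a \<in> carrier (bg_tensor R (bg_unit R) H i j)"
      using r' a by (intro bp) auto
    then have "?f i j (bg_pure R (bg_unit R) H 0 0 i j r a) =
        Comp C X Y Y i j (bg_pure R (Hom C Y Y) H 0 0 i j (r \<odot>\<^bsub>Hom C Y Y 0 0\<^esub> e Y) a)"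
      using bg_tens_pure_0[OF R U Hm YY Hm Unit_maps[OF Y] bg_id_maps[OF Hm] r' a, of i j] r a
      by (simp add: bg_comp_apply bg_id_def Unit_0 Y)
    also have "\<dots> = c X Y Y 0 0 i j (r \<odot>\<^bsub>Hom C Y Y 0 0\<^esub> e Y) a"
      using X Y a r unfolding H by (intro Comp_pure) (auto simp: e_closed)
    also have "\<dots> = r \<odot>\<^bsub>H i j\<^esub> a"
      using bilinearD(4)[OF c_bilinear[OF X Y Y, of 0 0 i j] r e_closed[OF Y]] a X Y c_left[OF X Y]
      by (simp add: H)
    finally show ?thesis .
  qed
  show ?thesis
    using maps eq bg_left_unitor_unique[OF R Hm] by blast
qed

lemma right_unit:
  assumes X: "X \<in> Ob C" and Y: "Y \<in> Ob C" and H: "H = Hom C X Y"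
  shows "bg_comp (bg_tensor R H (bg_unit R)) (Comp C X X Y)
           (bg_tens R H (bg_unit R) H (Hom C X X) 0 0 0 0 (bg_id H) (Unit C X)) = bg_right_unitor R H"
proof -
  have Hm: "bigraded_module R H" and XX: "bigraded_module R (Hom C X X)"
    using X Y by (simp_all add: H hom_module)
  note U = bigraded_module_bg_unit[OF R]
  note T = bigraded_module_bg_tensor[OF R Hm U]
  note bp = bilinearD(1)[OF bilinear_bg_pure[OF R Hm U, of _ _ 0 _ _ 0]]
  note m = bg_tens_maps_0[OF R Hm U Hm XX bg_id_maps[OF Hm] Unit_maps[OF X]]
  let ?f = "bg_comp (bg_tensor R H (bg_unit R)) (Comp C X X Y)
           (bg_tens R H (bg_unit R) H (Hom C X X) 0 0 0 0 (bg_id H) (Unit C X))"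
  have maps: "?f \<in> bg_maps R (bg_tensor R H (bg_unit R)) H 0 0"
    using bg_comp_maps[OF T m Comp_maps[OF X X Y, folded H]] by (simp add: H)
  have eq: "?f i j (bg_pure R H (bg_unit R) i j 0 0 a r) = r \<odot>\<^bsub>H i j\<^esub> a"
    if r: "r \<in> carrier R" and a: "a \<in> carrier (H i j)" for i j r a
  proof -
    interpret XX: module R "Hom C X X 0 0" using X by (intro hom)
    have r': "r \<in> carrier (bg_unit R 0 0)" using r by (simp add: bg_unit_simps)
    have "bg_pure R H (bg_unit R) i j 0 0 a r \<in> carrier (bg_tensor R H (bg_unit R) i j)"
      using r' a by (intro bp) auto
    then have "?f i j (bg_pure R H (bg_unit R) i j 0 0 a r) =
        Comp C X X Y i j (bg_pure R H (Hom C X X) i j 0 0 a (r \<odot>\<^bsub>Hom C X X 0 0\<^esub> e X))"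
      using bg_tens_pure_0[OF R Hm U Hm XX bg_id_maps[OF Hm] Unit_maps[OF X] a r', of i j] r a
      by (simp add: bg_comp_apply bg_id_def Unit_0 X)
    also have "\<dots> = c X X Y i j 0 0 a (r \<odot>\<^bsub>Hom C X X 0 0\<^esub> e X)"
      using X Y a r unfolding H by (intro Comp_pure) (auto simp: e_closed)
    also have "\<dots> = r \<odot>\<^bsub>H i j\<^esub> a"
      using bilinearD(5)[OF c_bilinear[OF X X Y, of i j 0 0] r _ e_closed[OF X]] a X Y c_right[OF X Y]
      by (simp add: H)
    finally show ?thesis .
  qed
  show ?thesis
    using maps eq bg_right_unitor_unique[OF R Hm] by blast
qed

lemma bg_category: "bg_category R C"
  unfolding bg_category_def Let_def
  using hom_module Comp_maps Unit_maps associativity[OF _ _ _ _ refl refl refl refl]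
    left_unit[OF _ _ refl] right_unit[OF _ _ refl]
  by simp

text \<open>Every law mentions objects only through hom-objects, composition and identities. This
  gives twisted complexes from bigraded modules, filtered complexes from filtered modules, and the
  full subcategories on split objects.\<close>

lemma pullback:
  fixes D :: "('p, 'r, 'h, 'y) bg_cat_scheme"
  assumes U: "\<And>X. X \<in> Ob D \<Longrightarrow> U X \<in> Ob C"
    and "\<And>X Y. X \<in> Ob D \<Longrightarrow> Y \<in> Ob D \<Longrightarrow> Hom D X Y = Hom C (U X) (U Y)"
    and "\<And>X Y Z. X \<in> Ob D \<Longrightarrow> Y \<in> Ob D \<Longrightarrow> Z \<in> Ob D \<Longrightarrow> Comp D X Y Z = Comp C (U X) (U Y) (U Z)"
    and "\<And>X. X \<in> Ob D \<Longrightarrow> Unit D X = Unit C (U X)"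
  shows "presented_category R D (\<lambda>X Y Z. c (U X) (U Y) (U Z)) (\<lambda>X. e (U X))"
  by (rule presented_category.intro)
    (simp_all add: assms R hom_module c_bilinear c_assoc e_closed c_left c_right Comp_eq Unit_eq)

end

text \<open>The elements \<open>d X\<close> are the structure maps of the objects. The exponent
  \<open>v\<close> in \<open>HDiff_eq\<close> is the pairing of the bidegree (u, v) of
  \<open>f\<close> with the bidegree (0, 1) of \<open>d X\<close>.\<close>

locale presented_dg_category = presented_category R C c e
  for R :: "'r ring" and C :: "('o, 'r, 'h) vb_cat"
    and c :: "'o \<Rightarrow> 'o \<Rightarrow> 'o \<Rightarrow> int \<Rightarrow> int \<Rightarrow> int \<Rightarrow> int \<Rightarrow> 'h \<Rightarrow> 'h \<Rightarrow> 'h" and e :: "'o \<Rightarrow> 'h" +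
  fixes d :: "'o \<Rightarrow> 'h"
  assumes d_closed: "X \<in> Ob C \<Longrightarrow> d X \<in> carrier (Hom C X X 0 1)"
    and d_d: "X \<in> Ob C \<Longrightarrow> c X X X 0 1 0 1 (d X) (d X) = \<zero>\<^bsub>Hom C X X 0 2\<^esub>"
    and HDiff_eq: "X \<in> Ob C \<Longrightarrow> Y \<in> Ob C \<Longrightarrow> f \<in> carrier (Hom C X Y u v) \<Longrightarrow>
      HDiff C X Y u v f = c X Y Y 0 1 u v (d Y) f \<ominus>\<^bsub>Hom C X Y u (v + 1)\<^esub>
        sign_pow (Hom C X Y u (v + 1)) v (c X X Y u v 0 1 f (d X))"
    and HDiff_extensional: "X \<in> Ob C \<Longrightarrow> Y \<in> Ob C \<Longrightarrow>
      HDiff C X Y u v \<in> extensional (carrier (Hom C X Y u v))"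
begin

lemma d_lin:
  assumes X: "X \<in> Ob C" and Y: "Y \<in> Ob C"
  shows "(\<lambda>f \<in> carrier (Hom C X Y u v). c X Y Y 0 1 u v (d Y) f) \<in>
      lin R (Hom C X Y u v) (Hom C X Y u (v + 1))"
    and "(\<lambda>f \<in> carrier (Hom C X Y u v). c X X Y u v 0 1 f (d X)) \<in>
      lin R (Hom C X Y u v) (Hom C X Y u (v + 1))"
  using bilinear_lin_right[OF hom[OF X Y] c_bilinear[OF X Y Y] d_closed[OF Y], of u v]
    bilinear_lin_left[OF hom[OF X Y] c_bilinear[OF X X Y] d_closed[OF X], of u v]
  by (simp_all add: add.commute)

lemma HDiff_lin:
  assumes X: "X \<in> Ob C" and Y: "Y \<in> Ob C"
  shows "HDiff C X Y u v \<in> lin R (Hom C X Y u v) (Hom C X Y u (v + 1))"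
proof -
  interpret H: module R "Hom C X Y i j" for i j by (rule hom[OF X Y])
  note l = d_lin(1)[OF X Y, of u v] and r = d_lin(2)[OF X Y, of u v]
  note [simp] = sign_pow_closed[OF hom[OF X Y]] sign_pow_add[OF hom[OF X Y]] sign_pow_smult[OF hom[OF X Y]]
  let ?H = "Hom C X Y u (v + 1)"
  have l': "f \<in> carrier (Hom C X Y u v) \<Longrightarrow> c X Y Y 0 1 u v (d Y) f \<in> carrier ?H"
    and r': "f \<in> carrier (Hom C X Y u v) \<Longrightarrow> c X X Y u v 0 1 f (d X) \<in> carrier ?H" for f
    using lin_closed[OF l, of f] lin_closed[OF r, of f] by simp_all
  show ?thesis
  proof (rule linI)
    show "HDiff C X Y u v \<in> extensional (carrier (Hom C X Y u v))" by (rule HDiff_extensional[OF X Y])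
    fix f assume f: "f \<in> carrier (Hom C X Y u v)"
    show "HDiff C X Y u v f \<in> carrier ?H"
      using f by (simp add: HDiff_eq X Y l' r')
    show "HDiff C X Y u v (f \<oplus>\<^bsub>Hom C X Y u v\<^esub> g) =
      HDiff C X Y u v f \<oplus>\<^bsub>?H\<^esub> HDiff C X Y u v g" if g: "g \<in> carrier (Hom C X Y u v)" for g
      using lin_add[OF l f g] lin_add[OF r f g] f g
      by (simp add: HDiff_eq X Y l' r' a_minus_def H.M.minus_add H.a_ac)
    show "HDiff C X Y u v (s \<odot>\<^bsub>Hom C X Y u v\<^esub> f) = s \<odot>\<^bsub>?H\<^esub> HDiff C X Y u v f" if s: "s \<in> carrier R" for s
      using lin_smult[OF l s f] lin_smult[OF r s f] f s
      by (simp add: HDiff_eq X Y l' r' a_minus_def H.smult_r_distr H.smult_r_minus)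
  qed
qed

lemma HDiff_maps:
  "X \<in> Ob C \<Longrightarrow> Y \<in> Ob C \<Longrightarrow> HDiff C X Y \<in> bg_maps R (Hom C X Y) (Hom C X Y) 0 1"
  using HDiff_lin by (simp add: bg_maps_def)

lemma c_d_closed:
  assumes "X \<in> Ob C" "Y \<in> Ob C" "f \<in> carrier (Hom C X Y u v)"
  shows "c X Y Y 0 1 u v (d Y) f \<in> carrier (Hom C X Y u (v + 1))"
    and "c X X Y u v 0 1 f (d X) \<in> carrier (Hom C X Y u (v + 1))"
  using assms by (auto intro!: c_closed d_closed)

text \<open>Of the four terms, those with \<open>d\<close> twice on the same side vanish by
  associativity and \<open>d_d\<close>. The mixed ones both equal d f d up to sign, with opposite
  signs because the vertical degree grows by one.\<close>

lemma HDiff_HDiff: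
  assumes X: "X \<in> Ob C" and Y: "Y \<in> Ob C" and f: "f \<in> carrier (Hom C X Y u v)"
  shows "HDiff C X Y u (v + 1) (HDiff C X Y u v f) = \<zero>\<^bsub>Hom C X Y u (v + 1 + 1)\<^esub>"
proof -
  interpret H: module R "Hom C X Y i j" for i j by (rule hom[OF X Y])
  let ?H1 = "Hom C X Y u (v + 1)" and ?H2 = "Hom C X Y u (v + 1 + 1)"
  define a where "a = c X Y Y 0 1 u v (d Y) f"
  define b where "b = c X X Y u v 0 1 f (d X)"
  have a: "a \<in> carrier ?H1" and b: "b \<in> carrier ?H1"
    using c_d_closed[OF X Y f] by (simp_all add: a_def b_def)
  define x where "x = c X Y Y 0 1 u (v + 1) (d Y) b"
  have x: "x \<in> carrier ?H2" using c_d_closed(1)[OF X Y b] by (simp add: x_def)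
  have XY: "module R (Hom C X Y i j)" for i j by (rule hom[OF X Y])
  note s = sign_pow_closed[OF XY]
  have e1: "c X Y Y 0 1 u (v + 1) (d Y) a = \<zero>\<^bsub>?H2\<^esub>"
  proof -
    have "c X Y Y 0 1 u (v + 1) (d Y) a = c X Y Y 0 2 u v (c Y Y Y 0 1 0 1 (d Y) (d Y)) f"
      using c_assoc[OF X Y Y Y d_closed[OF Y] d_closed[OF Y] f] by (simp add: a_def add.commute)
    also have "\<dots> = \<zero>\<^bsub>Hom C X Y (0 + u) (2 + v)\<^esub>"
      unfolding d_d[OF Y] by (rule bilinear_zero_left[OF hom[OF Y Y] XY c_bilinear[OF X Y Y] f])
    finally show ?thesis by (simp add: add.commute)
  qed
  have e2: "c X X Y u (v + 1) 0 1 b (d X) = \<zero>\<^bsub>?H2\<^esub>"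
  proof -
    have "c X X Y u (v + 1) 0 1 b (d X) = c X X Y u v 0 2 f (c X X X 0 1 0 1 (d X) (d X))"
      using c_assoc[OF X X X Y f d_closed[OF X] d_closed[OF X]] by (simp add: b_def)
    also have "\<dots> = \<zero>\<^bsub>Hom C X Y (u + 0) (v + 2)\<^esub>"
      unfolding d_d[OF X] by (rule bilinear_zero_right[OF hom[OF X X] XY c_bilinear[OF X X Y] f])
    finally show ?thesis by (simp add: add.commute)
  qed
  have e3: "c X X Y u (v + 1) 0 1 a (d X) = x"
    using c_assoc[OF X X Y Y d_closed[OF Y] f d_closed[OF X]] by (simp add: a_def b_def x_def add.commute)
  note l = d_lin(1)[OF X Y, of u "v + 1"] and r = d_lin(2)[OF X Y, of u "v + 1"]
  have l1: "c X Y Y 0 1 u (v + 1) (d Y) (a \<ominus>\<^bsub>?H1\<^esub> sign_pow ?H1 v b) =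
      \<zero>\<^bsub>?H2\<^esub> \<ominus>\<^bsub>?H2\<^esub> sign_pow ?H2 v x"
    using lin_minus[OF XY XY l a s[OF b]] lin_sign_pow[OF XY XY l b] a b s[OF b]
    by (simp add: e1 x_def)
  have r1: "c X X Y u (v + 1) 0 1 (a \<ominus>\<^bsub>?H1\<^esub> sign_pow ?H1 v b) (d X) =
      x \<ominus>\<^bsub>?H2\<^esub> sign_pow ?H2 v \<zero>\<^bsub>?H2\<^esub>"
    using lin_minus[OF XY XY r a s[OF b]] lin_sign_pow[OF XY XY r b] a b s[OF b]
    by (simp add: e2 e3)
  have "HDiff C X Y u v f = a \<ominus>\<^bsub>?H1\<^esub> sign_pow ?H1 v b"
    using f by (simp add: HDiff_eq X Y a_def b_def)
  then have "HDiff C X Y u (v + 1) (HDiff C X Y u v f) =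
      (\<zero>\<^bsub>?H2\<^esub> \<ominus>\<^bsub>?H2\<^esub> sign_pow ?H2 v x) \<ominus>\<^bsub>?H2\<^esub> sign_pow ?H2 (v + 1) (x \<ominus>\<^bsub>?H2\<^esub> sign_pow ?H2 v \<zero>\<^bsub>?H2\<^esub>)"
    using a b by (simp add: HDiff_eq X Y l1 r1 s)
  moreover have mz: "\<ominus>\<^bsub>Hom C X Y i j\<^esub> \<zero>\<^bsub>Hom C X Y i j\<^esub> = \<zero>\<^bsub>Hom C X Y i j\<^esub>" for i j
    by (rule H.M.minus_equality) auto
  ultimately show ?thesis
    using x by (cases "even v") (simp_all add: sign_pow_def a_minus_def H.M.l_neg H.M.r_neg mz)
qed

text \<open>Composition with zero is zero by bilinearity. This is the reason why modules without
  structure maps form a full subcategory with zero differentials.\<close>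

lemma HDiff_zero:
  assumes X: "X \<in> Ob C" and Y: "Y \<in> Ob C"
    and d: "d X = \<zero>\<^bsub>Hom C X X 0 1\<^esub>" "d Y = \<zero>\<^bsub>Hom C Y Y 0 1\<^esub>"
  shows "HDiff C X Y = bg_zero (Hom C X Y) (Hom C X Y) 0 1"
proof (rule bg_maps_ext[OF HDiff_maps[OF X Y] bg_zero_maps[OF hom_module[OF X Y] hom_module[OF X Y]]])
  fix u v f assume f: "f \<in> carrier (Hom C X Y u v)"
  interpret H: module R "Hom C X Y i j" for i j by (rule hom[OF X Y])
  show "HDiff C X Y u v f = bg_zero (Hom C X Y) (Hom C X Y) 0 1 u v f"
    using f bilinear_zero_left[OF hom[OF Y Y] hom[OF X Y] c_bilinear[OF X Y Y] f, of 0 1]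
      bilinear_zero_right[OF hom[OF X X] hom[OF X Y] c_bilinear[OF X X Y] f, of 0 1]
    by (simp add: HDiff_eq X Y d bg_zero_def add.commute[of 1 v] sign_pow_zero[OF hom[OF X Y]]
        a_minus_def H.M.r_neg)
qed

lemma vertical_bicomplex: "X \<in> Ob C \<Longrightarrow> Y \<in> Ob C \<Longrightarrow> vertical_bicomplex R (VHom C X Y)"
  by (simp add: vertical_bicomplex_def VHom_def hom_module HDiff_maps HDiff_HDiff)

text \<open>With a = d f g, m = f d g and b = f g d, the two summands on the right are a - (-1)^q m
  and (-1)^q (m - (-1)^t b); the terms in m cancel. The sign (-1)^q is the Koszul sign for moving d
  past f.\<close>

lemma Leibniz:
  assumes X: "X \<in> Ob C" and Y: "Y \<in> Ob C" and Z: "Z \<in> Ob C"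
    and f: "f \<in> carrier (Hom C Y Z p q)" and g: "g \<in> carrier (Hom C X Y s t)"
  shows "HDiff C X Z (p + s) (q + t) (c X Y Z p q s t f g) =
    c X Y Z p (q + 1) s t (HDiff C Y Z p q f) g \<oplus>\<^bsub>Hom C X Z (p + s) (q + t + 1)\<^esub>
    sign_pow (Hom C X Z (p + s) (q + t + 1)) q (c X Y Z p q s (t + 1) f (HDiff C X Y s t g))"
proof -
  let ?K = "Hom C X Z (p + s) (q + t + 1)"
  have XZ: "module R (Hom C X Z i j)" for i j by (rule hom[OF X Z])
  have XY: "module R (Hom C X Y i j)" for i j by (rule hom[OF X Y])
  have YZ: "module R (Hom C Y Z i j)" for i j by (rule hom[OF Y Z])
  interpret K: module R ?K by (rule XZ)
  define a where "a = c X Z Z 0 1 (p + s) (q + t) (d Z) (c X Y Z p q s t f g)"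
  define b where "b = c X X Z (p + s) (q + t) 0 1 (c X Y Z p q s t f g) (d X)"
  define m where "m = c X Y Z p q s (t + 1) f (c X Y Y 0 1 s t (d Y) g)"
  have fg: "c X Y Z p q s t f g \<in> carrier (Hom C X Z (p + s) (q + t))"
    by (rule c_closed[OF X Y Z f g refl refl])
  have a: "a \<in> carrier ?K" and b: "b \<in> carrier ?K"
    using c_d_closed[OF X Z fg] by (simp_all add: a_def b_def)
  note df = c_d_closed[OF Y Z f] and dg = c_d_closed[OF X Y g]
  note s = sign_pow_closed
  have m: "m \<in> carrier ?K"
    unfolding m_def by (rule c_closed[OF X Y Z f dg(1)]) auto
  have a': "c X Y Z p (q + 1) s t (c Y Z Z 0 1 p q (d Z) f) g = a"
    using c_assoc[OF X Y Z Z d_closed[OF Z] f g] by (simp add: a_def add.commute)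
  have m': "c X Y Z p (q + 1) s t (c Y Y Z p q 0 1 f (d Y)) g = m"
    using c_assoc[OF X Y Y Z f d_closed[OF Y] g] by (simp add: m_def add.commute)
  have b': "c X Y Z p q s (t + 1) f (c X X Y s t 0 1 g (d X)) = b"
    using c_assoc[OF X X Y Z f g d_closed[OF X]] by (simp add: b_def)
  have bil1: "bilinear R (Hom C Y Z p (q + 1)) (Hom C X Y s t) ?K (c X Y Z p (q + 1) s t)"
    using c_bilinear[OF X Y Z, of p "q + 1" s t] by (simp add: ac_simps)
  have bil2: "bilinear R (Hom C Y Z p q) (Hom C X Y s (t + 1)) ?K (c X Y Z p q s (t + 1))"
    using c_bilinear[OF X Y Z, of p q s "t + 1"] by (simp add: ac_simps)
  have L: "c X Y Z p (q + 1) s t (HDiff C Y Z p q f) g = a \<ominus>\<^bsub>?K\<^esub> sign_pow ?K q m"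
    using bilinear_minus_left[OF YZ XZ bil1 df(1) s[OF YZ df(2)] g]
      bilinear_sign_pow_left[OF YZ XZ bil1 df(2) g]
    by (simp add: HDiff_eq Y Z f a' m')
  have M: "c X Y Z p q s (t + 1) f (HDiff C X Y s t g) = m \<ominus>\<^bsub>?K\<^esub> sign_pow ?K t b"
    using bilinear_minus_right[OF XY XZ bil2 f dg(1) s[OF XY dg(2)]]
      bilinear_sign_pow_right[OF XY XZ bil2 f dg(2)]
    by (simp add: HDiff_eq X Y g b' m_def)
  have cancel: "x \<oplus>\<^bsub>?K\<^esub> (y \<oplus>\<^bsub>?K\<^esub> \<ominus>\<^bsub>?K\<^esub> x) = y" "\<ominus>\<^bsub>?K\<^esub> x \<oplus>\<^bsub>?K\<^esub> (y \<oplus>\<^bsub>?K\<^esub> x) = y"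
    if "x \<in> carrier ?K" "y \<in> carrier ?K" for x y
    using that by (simp_all add: K.a_lcomm[of _ y] K.M.r_neg K.M.l_neg)
  have "HDiff C X Z (p + s) (q + t) (c X Y Z p q s t f g) = a \<ominus>\<^bsub>?K\<^esub> sign_pow ?K (q + t) b"
    using fg by (simp add: HDiff_eq X Z a_def b_def)
  also have "\<dots> = (a \<ominus>\<^bsub>?K\<^esub> sign_pow ?K q m) \<oplus>\<^bsub>?K\<^esub> sign_pow ?K q (m \<ominus>\<^bsub>?K\<^esub> sign_pow ?K t b)"
    using a b m by (cases "even q"; cases "even t")
      (simp_all add: sign_pow_def a_minus_def K.M.minus_add K.a_ac cancel K.M.r_neg1 K.M.r_neg2 K.M.r_neg)
  finally show ?thesis by (simp add: L M)
qed

text \<open>Both ways around the square are maps of bidegree (0, 1) on the tensor product; on pure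
  tensors their equality is \<open>Leibniz\<close>.\<close>

lemma Comp_vb_maps:
  assumes X: "X \<in> Ob C" and Y: "Y \<in> Ob C" and Z: "Z \<in> Ob C"
  shows "Comp C X Y Z \<in> vb_maps R (vb_tensor R (VHom C Y Z) (VHom C X Y)) (VHom C X Z)"
proof -
  note YZ = hom_module[OF Y Z] and XY = hom_module[OF X Y] and XZ = hom_module[OF X Z]
  let ?T = "bg_tensor R (Hom C Y Z) (Hom C X Y)"
  note T = bigraded_module_bg_tensor[OF R YZ XY]
  let ?d1 = "bg_tens R (Hom C Y Z) (Hom C X Y) (Hom C Y Z) (Hom C X Y) 0 1 0 0 (HDiff C Y Z) (bg_id (Hom C X Y))"
  let ?d2 = "bg_tens R (Hom C Y Z) (Hom C X Y) (Hom C Y Z) (Hom C X Y) 0 0 0 1 (bg_id (Hom C Y Z)) (HDiff C X Y)"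
  define D where "D = (\<lambda>i j. \<lambda>x \<in> carrier (?T i j). ?d1 i j x \<oplus>\<^bsub>?T i (j + 1)\<^esub> ?d2 i j x)"
  note d1 = bg_tens_maps[OF R YZ XY YZ XY HDiff_maps[OF Y Z] bg_id_maps[OF XY], simplified]
  note d2 = bg_tens_maps[OF R YZ XY YZ XY bg_id_maps[OF YZ] HDiff_maps[OF X Y], simplified]
  have D: "D \<in> bg_maps R ?T ?T 0 1"
    using bg_maps_add[OF T T d1 d2] by (simp add: D_def)
  define k where "k = (\<lambda>i j. compose (carrier (?T i j)) (HDiff C X Z i j) (Comp C X Y Z i j))"
  \<comment> \<open>\<open>bg_comp\<close> is for an inner map of bidegree (0, 0); here the inner
    \<open>D\<close> raises the upper index, so the outer map is taken at
    \<open>j + 1\<close>.\<close>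
  define l where "l = (\<lambda>i j. compose (carrier (?T i j)) (Comp C X Y Z i (j + 1)) (D i j))"
  have k: "k \<in> bg_maps R ?T (Hom C X Z) 0 1"
    using bg_comp_maps[OF T Comp_maps[OF X Y Z] HDiff_maps[OF X Z]] by (simp add: k_def bg_comp_def)
  have l: "l \<in> bg_maps R ?T (Hom C X Z) 0 1"
  proof (rule bg_mapsI)
    fix i j
    show "l i j \<in> lin R (?T i j) (Hom C X Z (i + 0) (j + 1))"
      using lin_compose[OF bigraded_moduleD[OF T] bg_mapsD[OF D, of i j]
          bg_mapsD[OF Comp_maps[OF X Y Z], of "i + 0" "j + 1"]]
      by (simp add: l_def)
  qed
  have "k = l"
  proof (rule bg_tensor_ext[OF R YZ XY XZ k l])
    fix p q s t f g
    assume f: "f \<in> carrier (Hom C Y Z p q)" and g: "g \<in> carrier (Hom C X Y s t)"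
    let ?x = "bg_pure R (Hom C Y Z) (Hom C X Y) p q s t f g"
    let ?m = "Hom C X Z (p + s) (q + t + 1)"
    have x: "?x \<in> carrier (?T (p + s) (q + t))"
      using f g by (rule bilinearD(1)[OF bilinear_bg_pure[OF R YZ XY refl refl]])
    have df: "HDiff C Y Z p q f \<in> carrier (Hom C Y Z p (q + 1))"
      and dg: "HDiff C X Y s t g \<in> carrier (Hom C X Y s (t + 1))"
      using f g X Y Z by (auto intro: lin_closed HDiff_lin)
    let ?y = "bg_pure R (Hom C Y Z) (Hom C X Y) p (q + 1) s t (HDiff C Y Z p q f) g"
    let ?z = "bg_pure R (Hom C Y Z) (Hom C X Y) p q s (t + 1) f (HDiff C X Y s t g)"
    have T1: "module R (?T (p + s) (q + t + 1))" by (rule bigraded_moduleD[OF T])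
    have y: "?y \<in> carrier (?T (p + s) (q + t + 1))"
      by (rule bilinearD(1)[OF bilinear_bg_pure[OF R YZ XY] df g]) auto
    have z: "?z \<in> carrier (?T (p + s) (q + t + 1))"
      by (rule bilinearD(1)[OF bilinear_bg_pure[OF R YZ XY] f dg]) auto
    \<comment> \<open>The sign comes from the second tensor map: its right factor has bidegree (0,
      1), so passing \<open>f\<close> costs the exponent 0 p + 1 q.\<close>
    have "D (p + s) (q + t) ?x = ?y \<oplus>\<^bsub>?T (p + s) (q + t + 1)\<^esub> sign_pow (?T (p + s) (q + t + 1)) q ?z"
      using x f g
        bg_tens_pure[OF R YZ XY YZ XY HDiff_maps[OF Y Z] bg_id_maps[OF XY] f g refl refl]
        bg_tens_pure[OF R YZ XY YZ XY bg_id_maps[OF YZ] HDiff_maps[OF X Y] f g refl refl]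
      by (simp add: D_def bg_id_def add.assoc)
    moreover have "Comp C X Y Z (p + s) (q + t + 1)
        (?y \<oplus>\<^bsub>?T (p + s) (q + t + 1)\<^esub> sign_pow (?T (p + s) (q + t + 1)) q ?z) =
        c X Y Z p (q + 1) s t (HDiff C Y Z p q f) g \<oplus>\<^bsub>?m\<^esub>
        sign_pow ?m q (c X Y Z p q s (t + 1) f (HDiff C X Y s t g))"
    proof -
      have cl: "Comp C X Y Z (p + s) (q + t + 1) \<in> lin R (?T (p + s) (q + t + 1)) ?m"
        using bg_mapsD[OF Comp_maps[OF X Y Z], of "p + s" "q + t + 1"] by simp
      have "Comp C X Y Z (p + s) (q + t + 1) ?y = c X Y Z p (q + 1) s t (HDiff C Y Z p q f) g"
        "Comp C X Y Z (p + s) (q + t + 1) ?z = c X Y Z p q s (t + 1) f (HDiff C X Y s t g)"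
        using df dg f g by (auto intro!: Comp_pure X Y Z)
      then show ?thesis
        using lin_add[OF cl y sign_pow_closed[OF T1 z]] lin_sign_pow[OF T1 hom[OF X Z] cl z] by simp
    qed
    ultimately have "l (p + s) (q + t) ?x = HDiff C X Z (p + s) (q + t) (c X Y Z p q s t f g)"
      using x Leibniz[OF X Y Z f g] by (simp add: l_def compose_eq)
    also have "\<dots> = k (p + s) (q + t) ?x"
      using x Comp_pure[OF X Y Z f g refl refl] by (simp add: k_def compose_eq)
    finally show "k (p + s) (q + t) ?x = l (p + s) (q + t) ?x" by simp
  qed
  have "HDiff C X Z i j (Comp C X Y Z i j x) = Comp C X Y Z i (j + 1) (D i j x)"
    if "x \<in> carrier (?T i j)" for i j x
    using fun_cong[OF fun_cong[OF fun_cong[OF \<open>k = l\<close>, of i], of j], of x] that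
    by (simp add: k_def l_def compose_eq)
  then show ?thesis
    using Comp_maps[OF X Y Z] by (simp add: vb_maps_def vb_tensor_def VHom_def D_def)
qed

lemma HDiff_e:
  assumes X: "X \<in> Ob C"
  shows "HDiff C X X 0 0 (e X) = \<zero>\<^bsub>Hom C X X 0 1\<^esub>"
proof -
  interpret H: module R "Hom C X X 0 1" by (rule hom[OF X X])
  show ?thesis
    using X by (simp add: HDiff_eq e_closed c_left c_right d_closed a_minus_def H.M.r_neg)
qed

text \<open>The monoidal unit has zero differential, so the identities have to be cycles. This holds
  by \<open>HDiff_e\<close>, where the two terms d e and e d cancel.\<close>

lemma Unit_vb_maps:
  assumes X: "X \<in> Ob C"
  shows "Unit C X \<in> vb_maps R (vb_unit R) (VHom C X X)"
proof -
  note XX = hom[OF X X]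
  interpret R: cring R by (rule R)
  interpret H: module R "Hom C X X i j" for i j by (rule XX)
  have z: "Unit C X i j \<zero>\<^bsub>R\<^esub> = \<zero>\<^bsub>Hom C X X i j\<^esub>" for i j
    using lin_zero[OF module_bg_unit[OF R] XX bg_mapsD[OF Unit_maps[OF X]], of i j]
    by (simp add: bg_unit_simps)
  have "HDiff C X X i j (Unit C X i j r) = \<zero>\<^bsub>Hom C X X i (j + 1)\<^esub>"
    if r: "r \<in> carrier (bg_unit R i j)" for i j r
  proof (cases "i = 0 \<and> j = 0")
    case True
    then show ?thesis
      using r lin_smult[OF HDiff_lin[OF X X] _ e_closed[OF X], of r]
      by (simp add: bg_unit_simps Unit_0[OF X] HDiff_e[OF X])
  next
    case False
    then have "r = \<zero>\<^bsub>R\<^esub>" using r by (auto simp: bg_unit_simps)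
    then show ?thesis using lin_zero[OF XX XX HDiff_lin[OF X X]] by (simp add: z)
  qed
  then show ?thesis
    using Unit_maps[OF X] by (simp add: vb_maps_def vb_unit_def VHom_def bg_zero_def bg_unit_simps z)
qed

lemma vb_category: "vb_category R C"
  unfolding vb_category_def
  using bg_category vertical_bicomplex Comp_vb_maps Unit_vb_maps by blast

end

section \<open>Functors\<close>

text \<open>The functor axioms, read on the elements that present composition and
  identities.\<close>

locale presented_functor = C: presented_category R C c e + D: presented_category R D c' e'
  for R :: "'r ring" and C :: "('o, 'r, 'h, 'y) bg_cat_scheme" and c e
    and D :: "('p, 'r, 'k, 'z) bg_cat_scheme" and c' e' +
  fixes F :: "('o, 'p, 'h, 'k) efunctor"
  assumes ob: "X \<in> Ob C \<Longrightarrow> FOb F X \<in> Ob D"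
    and maps: "X \<in> Ob C \<Longrightarrow> Y \<in> Ob C \<Longrightarrow>
      FHom F X Y \<in> bg_maps R (Hom C X Y) (Hom D (FOb F X) (FOb F Y)) 0 0"
    and comp: "X \<in> Ob C \<Longrightarrow> Y \<in> Ob C \<Longrightarrow> Z \<in> Ob C \<Longrightarrow>
      f \<in> carrier (Hom C Y Z p q) \<Longrightarrow> g \<in> carrier (Hom C X Y s t) \<Longrightarrow>
      FHom F X Z (p + s) (q + t) (c X Y Z p q s t f g) =
      c' (FOb F X) (FOb F Y) (FOb F Z) p q s t (FHom F Y Z p q f) (FHom F X Y s t g)"
    and unit: "X \<in> Ob C \<Longrightarrow> FHom F X X 0 0 (e X) = e' (FOb F X)"
begin

lemma FHom_lin:
  "X \<in> Ob C \<Longrightarrow> Y \<in> Ob C \<Longrightarrow>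
    FHom F X Y i j \<in> lin R (Hom C X Y i j) (Hom D (FOb F X) (FOb F Y) i j)"
  using bg_mapsD[OF maps, of X Y i j] by simp

lemma bg_functor: "bg_functor R C D F"
proof -
  note U = bigraded_module_bg_unit[OF C.R]
  have mc: "FHom F X Y i j f \<in> carrier (Hom D (FOb F X) (FOb F Y) i j)"
    if "X \<in> Ob C" "Y \<in> Ob C" "f \<in> carrier (Hom C X Y i j)" for X Y i j f
    using bg_maps_closed[OF maps[OF that(1,2)] that(3)] by simp
  have "bg_comp (bg_tensor R (Hom C Y Z) (Hom C X Y)) (FHom F X Z) (Comp C X Y Z) =
     bg_comp (bg_tensor R (Hom C Y Z) (Hom C X Y)) (Comp D (FOb F X) (FOb F Y) (FOb F Z))
       (bg_tens R (Hom C Y Z) (Hom C X Y)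
          (Hom D (FOb F Y) (FOb F Z)) (Hom D (FOb F X) (FOb F Y)) 0 0 0 0
          (FHom F Y Z) (FHom F X Y))"
    if X: "X \<in> Ob C" and Y: "Y \<in> Ob C" and Z: "Z \<in> Ob C" for X Y Z
  proof -
    note YZ = C.hom_module[OF Y Z] and XY = C.hom_module[OF X Y]
    note FYZ = D.hom_module[OF ob[OF Y] ob[OF Z]] and FXY = D.hom_module[OF ob[OF X] ob[OF Y]]
    note T = bigraded_module_bg_tensor[OF C.R YZ XY]
    note tm = bg_tens_maps_0[OF C.R YZ XY FYZ FXY maps[OF Y Z] maps[OF X Y]]
    show ?thesis
    proof (rule bg_tensor_ext[OF C.R YZ XY D.hom_module[OF ob[OF X] ob[OF Z]]
          bg_comp_maps[OF T C.Comp_maps[OF X Y Z] maps[OF X Z]]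
          bg_comp_maps[OF T tm D.Comp_maps[OF ob[OF X] ob[OF Y] ob[OF Z]]]], goal_cases)
      case (1 p q s t f g)
      note f = 1(1) and g = 1(2)
      have x: "bg_pure R (Hom C Y Z) (Hom C X Y) p q s t f g \<in>
          carrier (bg_tensor R (Hom C Y Z) (Hom C X Y) (p + s) (q + t))"
        using f g by (rule bilinearD(1)[OF bilinear_bg_pure[OF C.R YZ XY refl refl]])
      note app = bg_comp_apply[of "bg_pure R (Hom C Y Z) (Hom C X Y) p q s t f g"
        "bg_tensor R (Hom C Y Z) (Hom C X Y)" "p + s" "q + t", OF x]
      show ?case
        using bg_tens_pure_0[OF C.R YZ XY FYZ FXY maps[OF Y Z] maps[OF X Y] f g refl refl]
          C.Comp_pure[OF X Y Z f g refl refl] comp[OF X Y Z f g]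
          D.Comp_pure[OF ob[OF X] ob[OF Y] ob[OF Z] mc[OF Y Z f] mc[OF X Y g] refl refl]
        by (simp add: app)
    qed
  qed
  moreover have "bg_comp (bg_unit R) (FHom F X X) (Unit C X) = Unit D (FOb F X)" if X: "X \<in> Ob C" for X
  proof (rule bg_maps_ext[OF bg_comp_maps[OF U C.Unit_maps[OF X] maps[OF X X]] D.Unit_maps[OF ob[OF X]]])
    fix i j r assume r: "r \<in> carrier (bg_unit R i j)"
    note m = bg_mapsD[OF maps[OF X X], of i j]
    note CX = C.hom[OF X X] and DX = D.hom[OF ob[OF X] ob[OF X]]
    show "bg_comp (bg_unit R) (FHom F X X) (Unit C X) i j r = Unit D (FOb F X) i j r"
    proof (cases "i = 0 \<and> j = 0")
      case True
      then show ?thesis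
        using r X C.e_closed[OF X]
          lin_smult[OF bg_mapsD[OF maps[OF X X], of 0 0] _ C.e_closed[OF X], of r]
        by (simp add: bg_comp_apply C.Unit_0 D.Unit_0 ob unit bg_unit_simps)
    next
      case False
      then have "r = \<zero>\<^bsub>bg_unit R i j\<^esub>" using r by (auto simp: bg_unit_simps)
      then show ?thesis
        using r lin_zero[OF CX DX m, simplified]
          lin_zero[OF bigraded_moduleD[OF U] CX bg_mapsD[OF C.Unit_maps[OF X]], of i j]
          lin_zero[OF bigraded_moduleD[OF U] DX bg_mapsD[OF D.Unit_maps[OF ob[OF X]]], of i j]
        by (simp add: bg_comp_apply)
    qed
  qed
  ultimately show ?thesis
    unfolding bg_functor_def Let_def
    using C.bg_category D.bg_category ob maps by blast
qed

end

text \<open>The differential of a presented category is made from composition and \<open>d\<close>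
  alone, so a functor that preserves both commutes with it.\<close>

lemma vb_functorI:
  assumes C: "presented_dg_category R C c e d" and D: "presented_dg_category R D c' e' d'"
    and F: "presented_functor R C c e D c' e' F"
    and d: "\<And>X. X \<in> Ob C \<Longrightarrow> FHom F X X 0 1 (d X) = d' (FOb F X)"
  shows "vb_functor R C D F"
proof -
  interpret C: presented_dg_category R C c e d by (rule C)
  interpret D: presented_dg_category R D c' e' d' by (rule D)
  interpret presented_functor R C c e D c' e' F by (rule F)
  have "HDiff D (FOb F X) (FOb F Y) u v (FHom F X Y u v f) = FHom F X Y u (v + 1) (HDiff C X Y u v f)"
    if X: "X \<in> Ob C" and Y: "Y \<in> Ob C" and f: "f \<in> carrier (Hom C X Y u v)" for X Y u v f
  proof -
    note CXY = C.hom[OF X Y] and DXY = D.hom[OF ob[OF X] ob[OF Y]]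
    note m = FHom_lin[OF X Y]
    note cd = C.c_d_closed[OF X Y f]
    have "FHom F X Y u (v + 1) (HDiff C X Y u v f) =
       FHom F X Y u (v + 1) (c X Y Y 0 1 u v (d Y) f)
         \<ominus>\<^bsub>Hom D (FOb F X) (FOb F Y) u (v + 1)\<^esub>
       sign_pow (Hom D (FOb F X) (FOb F Y) u (v + 1)) v (FHom F X Y u (v + 1) (c X X Y u v 0 1 f (d X)))"
      using lin_minus[OF CXY DXY m cd(1) sign_pow_closed[OF CXY cd(2)]] lin_sign_pow[OF CXY DXY m cd(2)]
      by (simp add: C.HDiff_eq X Y f)
    also have "\<dots> = HDiff D (FOb F X) (FOb F Y) u v (FHom F X Y u v f)"
      using comp[OF X Y Y C.d_closed[OF Y] f] comp[OF X X Y f C.d_closed[OF X]] lin_closed[OF m f]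
      by (simp add: D.HDiff_eq ob X Y d add.commute)
    finally show ?thesis by simp
  qed
  then show ?thesis
    using bg_functor maps unfolding vb_functor_def by (simp add: C.vb_category D.vb_category vb_maps_def VHom_def)
qed

definition inverse_functor ::
  "('o, 'r, 'h, 'y) bg_cat_scheme \<Rightarrow> ('p, 'r, 'k, 'z) bg_cat_scheme \<Rightarrow> ('o, 'p, 'h, 'k) efunctor \<Rightarrow>
   ('p \<Rightarrow> 'o) \<Rightarrow> ('p, 'o, 'k, 'h) efunctor" where
  "inverse_functor C D F G = \<lparr>FOb = G,
     FHom = \<lambda>X Y i j. \<lambda>f \<in> carrier (Hom D X Y i j).
       inv_into (carrier (Hom C (G X) (G Y) i j)) (FHom F (G X) (G Y) i j) f\<rparr>"

locale presented_isomorphism = presented_functor R C c e D c' e' F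
  for R :: "'r ring" and C :: "('o, 'r, 'h, 'y) bg_cat_scheme" and c e
    and D :: "('p, 'r, 'k, 'z) bg_cat_scheme" and c' e' and F :: "('o, 'p, 'h, 'k) efunctor" +
  fixes G :: "'p \<Rightarrow> 'o"
  assumes G: "P \<in> Ob D \<Longrightarrow> G P \<in> Ob C"
    and FG: "P \<in> Ob D \<Longrightarrow> FOb F (G P) = P" and GF: "X \<in> Ob C \<Longrightarrow> G (FOb F X) = X"
    and bij: "X \<in> Ob C \<Longrightarrow> Y \<in> Ob C \<Longrightarrow>
      bij_betw (FHom F X Y i j) (carrier (Hom C X Y i j)) (carrier (Hom D (FOb F X) (FOb F Y) i j))"
begin

abbreviation (input) "FG' \<equiv> inverse_functor C D F G"

lemma inverse_bij: "X \<in> Ob D \<Longrightarrow> Y \<in> Ob D \<Longrightarrow>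
    bij_betw (FHom F (G X) (G Y) i j) (carrier (Hom C (G X) (G Y) i j)) (carrier (Hom D X Y i j))"
  using bij[of "G X" "G Y"] by (simp add: G FG)

lemma inverse_functor_closed:
  "X \<in> Ob D \<Longrightarrow> Y \<in> Ob D \<Longrightarrow> f \<in> carrier (Hom D X Y i j) \<Longrightarrow>
    FHom FG' X Y i j f \<in> carrier (Hom C (G X) (G Y) i j)"
  using inverse_bij[of X Y i j] by (auto simp: inverse_functor_def bij_betw_def inv_into_into)

lemma inverse_functor_right:
  "X \<in> Ob D \<Longrightarrow> Y \<in> Ob D \<Longrightarrow> f \<in> carrier (Hom D X Y i j) \<Longrightarrow>
    FHom F (G X) (G Y) i j (FHom FG' X Y i j f) = f"
  using inverse_bij[of X Y i j] by (auto simp: inverse_functor_def bij_betw_def f_inv_into_f)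

text \<open>Every law for the inverse is proved through this: the candidate value is pushed forward
  along \<open>F\<close>, where the corresponding law is known.\<close>

lemma inverse_functor_eqI:
  assumes "X \<in> Ob D" "Y \<in> Ob D" "g \<in> carrier (Hom C (G X) (G Y) i j)" "FHom F (G X) (G Y) i j g = f"
  shows "FHom FG' X Y i j f = g"
proof -
  have "f \<in> carrier (Hom D X Y i j)" using assms inverse_bij[of X Y i j] by (auto simp: bij_betw_def)
  then show ?thesis
    using assms inverse_bij[of X Y i j] by (auto simp: inverse_functor_def bij_betw_def)
qed

lemma inverse_functor_comp:
  assumes X: "X \<in> Ob D" and Y: "Y \<in> Ob D" and Z: "Z \<in> Ob D"
    and f: "f \<in> carrier (Hom D Y Z p q)" and g: "g \<in> carrier (Hom D X Y s t)"
  shows "FHom FG' X Z (p + s) (q + t) (c' X Y Z p q s t f g) =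
      c (G X) (G Y) (G Z) p q s t (FHom FG' Y Z p q f) (FHom FG' X Y s t g)"
  using comp[OF G[OF X] G[OF Y] G[OF Z] inverse_functor_closed[OF Y Z f] inverse_functor_closed[OF X Y g]]
    inverse_functor_right[OF Y Z f] inverse_functor_right[OF X Y g]
  by (intro inverse_functor_eqI X Z C.c_closed[OF G[OF X] G[OF Y] G[OF Z] inverse_functor_closed[OF Y Z f] inverse_functor_closed[OF X Y g]])
    (simp_all add: FG X Y Z)

lemma presented_inverse: "presented_functor R D c' e' C c e FG'"
proof (intro presented_functor.intro presented_functor_axioms.intro
    C.presented_category_axioms D.presented_category_axioms, goal_cases)
  case (1 X)
  then show ?case by (simp add: inverse_functor_def G)
next
  case (2 X Y)
  interpret DXY: module R "Hom D X Y i j" for i j by (rule D.hom[OF 2])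
  interpret CXY: module R "Hom C (G X) (G Y) i j" for i j by (rule C.hom[OF G[OF 2(1)] G[OF 2(2)]])
  note m' = FHom_lin[OF G[OF 2(1)] G[OF 2(2)], unfolded FG[OF 2(1)] FG[OF 2(2)]]
  have "(\<lambda>f \<in> carrier (Hom D X Y i j). FHom FG' X Y i j f) \<in> lin R (Hom D X Y i j) (Hom C (G X) (G Y) i j)" for i j
    by (rule lin_inverse[OF DXY.module_axioms CXY.module_axioms m'])
      (use 2 in \<open>auto simp: inverse_functor_closed inverse_functor_right intro: inverse_functor_eqI\<close>)
  then show ?case by (auto intro!: bg_mapsI simp: inverse_functor_def cong: restrict_cong)
next
  case (3 X Y Z p q s t f g)
  then show ?case using inverse_functor_comp by (simp add: inverse_functor_def)
next
  case (4 X)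
  then show ?case
    using unit[OF G[OF 4]] by (intro inverse_functor_eqI) (simp_all add: inverse_functor_def C.e_closed G FG)
qed

lemma mutually_inverse_inverse_functor: "mutually_inverse C D F FG'"
  unfolding mutually_inverse_def
proof (intro conjI ballI)
  fix X Y assume X: "X \<in> Ob C" and Y: "Y \<in> Ob C"
  show "bg_comp (Hom C X Y) (FHom FG' (FOb F X) (FOb F Y)) (FHom F X Y) = bg_id (Hom C X Y)"
    unfolding bg_comp_def bg_id_def compose_def
    by (intro ext restrict_ext inverse_functor_eqI) (simp_all add: GF X Y ob)
next
  fix X Y assume X: "X \<in> Ob D" and Y: "Y \<in> Ob D"
  have "FOb FG' = G" by (simp add: inverse_functor_def)
  then show "bg_comp (Hom D X Y) (FHom F (FOb FG' X) (FOb FG' Y)) (FHom FG' X Y) = bg_id (Hom D X Y)"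
    unfolding bg_comp_def bg_id_def compose_def
    by (intro ext restrict_ext) (simp add: inverse_functor_right X Y)
qed (simp_all add: inverse_functor_def GF FG)

lemma FOb_image: "FOb F ` Ob C = Ob D"
  using ob G FG by (force simp: image_iff)

lemma bg_isomorphism: "bg_isomorphism R C D F"
  unfolding bg_isomorphism_def
  using bg_functor presented_functor.bg_functor[OF presented_inverse] mutually_inverse_inverse_functor by blast

end

text \<open>As \<open>F\<close> carries \<open>d\<close> to \<open>d'\<close>, its inverse carries
  \<open>d'\<close> back to \<open>d\<close>, so \<open>vb_functorI\<close> applies in both
  directions.\<close>

lemma vb_isomorphismI:
  assumes C: "presented_dg_category R C c e d" and D: "presented_dg_category R D c' e' d'"
    and F: "presented_isomorphism R C c e D c' e' F G"
    and d: "\<And>X. X \<in> Ob C \<Longrightarrow> FHom F X X 0 1 (d X) = d' (FOb F X)"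
  shows "vb_isomorphism R C D F"
proof -
  interpret presented_isomorphism R C c e D c' e' F G by (rule F)
  interpret C: presented_dg_category R C c e d by (rule C)
  have "FHom FG' X X 0 1 (d' X) = d (FOb FG' X)" if "X \<in> Ob D" for X
    using that d[OF G[OF that]] C.d_closed[OF G[OF that]] inverse_functor_eqI[of X X "d (G X)" 0 1 "d' X"]
    by (simp add: FG inverse_functor_def)
  then have "vb_functor R D C FG'"
    by (rule vb_functorI[OF D C presented_inverse])
  then show ?thesis
    unfolding vb_isomorphism_def
    using vb_functorI[OF C D presented_functor_axioms d] mutually_inverse_inverse_functor by blast
qed

section \<open>The hom-objects of filtered modules\<close>

lemma filtered_moduleD:
  assumes "filtered_module R K"
  shows "module R (fgr K n)" and "submodule (fil K p n) R (fgr K n)"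
  using assms by (auto simp: filtered_module_def)

lemma fil_closed:
  assumes "filtered_module R K" "x \<in> fil K p n"
  shows "x \<in> carrier (fgr K n)"
  using module.submoduleE(1)[OF filtered_moduleD[OF assms(1)]] assms(2) by blast

lemma fil_ops:
  assumes K: "filtered_module R K"
  shows "\<zero>\<^bsub>fgr K n\<^esub> \<in> fil K p n"
    and "x \<in> fil K p n \<Longrightarrow> y \<in> fil K p n \<Longrightarrow> x \<oplus>\<^bsub>fgr K n\<^esub> y \<in> fil K p n"
    and "x \<in> fil K p n \<Longrightarrow> r \<in> carrier R \<Longrightarrow> r \<odot>\<^bsub>fgr K n\<^esub> x \<in> fil K p n"
    and "x \<in> fil K p n \<Longrightarrow> sign_pow (fgr K n) m x \<in> fil K p n"
  using module.submoduleE[OF filtered_moduleD[OF K]]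
    subgroup.one_closed[OF submodule.axioms(1)[OF filtered_moduleD(2)[OF K]]]
  by (auto simp: sign_pow_def)

lemma fMod_homI:
  assumes "\<And>m. f m \<in> lin R (fgr K m) (fgr L (m + v - u))"
    and "\<And>q m x. x \<in> fil K q m \<Longrightarrow> f m x \<in> fil L (q + u) (m + v - u)"
  shows "f \<in> carrier (fMod_hom R K L u v)"
  using assms by (auto simp: fMod_hom_def)

lemma fMod_homD:
  assumes "f \<in> carrier (fMod_hom R K L u v)" "n = m + v - u"
  shows "f m \<in> lin R (fgr K m) (fgr L n)"
    and "x \<in> fil K q m \<Longrightarrow> p = q + u \<Longrightarrow> f m x \<in> fil L p n"
  using assms by (auto simp: fMod_hom_def image_subset_iff)

lemma fMod_hom_simps:
  "\<zero>\<^bsub>fMod_hom R K L u v\<^esub> = (\<lambda>m. \<lambda>x \<in> carrier (fgr K m). \<zero>\<^bsub>fgr L (m + v - u)\<^esub>)"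
  "f \<oplus>\<^bsub>fMod_hom R K L u v\<^esub> g = (\<lambda>m. \<lambda>x \<in> carrier (fgr K m). f m x \<oplus>\<^bsub>fgr L (m + v - u)\<^esub> g m x)"
  "r \<odot>\<^bsub>fMod_hom R K L u v\<^esub> f = (\<lambda>m. \<lambda>x \<in> carrier (fgr K m). r \<odot>\<^bsub>fgr L (m + v - u)\<^esub> f m x)"
  by (simp_all add: fMod_hom_def)

lemma fMod_hom_ext:
  assumes f: "f \<in> carrier (fMod_hom R K L u v)" and g: "g \<in> carrier (fMod_hom R K L u' v')"
    and eq: "\<And>m x. x \<in> carrier (fgr K m) \<Longrightarrow> f m x = g m x"
  shows "f = g"
proof
  fix m show "f m = g m"
    by (rule lin_ext[OF fMod_homD(1)[OF f refl] fMod_homD(1)[OF g refl] eq])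
qed

context
  fixes R :: "'r ring" and K :: "('r, 'k) fmodule" and L :: "('r, 'l) fmodule"
  assumes R: "cring R" and K: "filtered_module R K" and L: "filtered_module R L"
begin

private lemmas Km = filtered_moduleD(1)[OF K]
private lemmas Lm = filtered_moduleD(1)[OF L]

lemma fMod_hom_closed:
  "\<zero>\<^bsub>fMod_hom R K L u v\<^esub> \<in> carrier (fMod_hom R K L u v)"
  "f \<in> carrier (fMod_hom R K L u v) \<Longrightarrow> g \<in> carrier (fMod_hom R K L u v) \<Longrightarrow>
    f \<oplus>\<^bsub>fMod_hom R K L u v\<^esub> g \<in> carrier (fMod_hom R K L u v)"
  "r \<in> carrier R \<Longrightarrow> f \<in> carrier (fMod_hom R K L u v) \<Longrightarrow>
    r \<odot>\<^bsub>fMod_hom R K L u v\<^esub> f \<in> carrier (fMod_hom R K L u v)"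
proof -
  show "\<zero>\<^bsub>fMod_hom R K L u v\<^esub> \<in> carrier (fMod_hom R K L u v)"
    unfolding fMod_hom_simps
    by (rule fMod_homI, rule lin_const_zero[OF Km Lm]) (simp add: fil_closed[OF K] fil_ops[OF L])
  show "f \<oplus>\<^bsub>fMod_hom R K L u v\<^esub> g \<in> carrier (fMod_hom R K L u v)"
    if "f \<in> carrier (fMod_hom R K L u v)" "g \<in> carrier (fMod_hom R K L u v)"
    unfolding fMod_hom_simps
    by (rule fMod_homI, rule lin_plus[OF Km Lm that[THEN fMod_homD(1)[OF _ refl]]])
      (simp add: fil_closed[OF K] fil_ops[OF L] that[THEN fMod_homD(2)[OF _ refl _ refl]])
  show "r \<odot>\<^bsub>fMod_hom R K L u v\<^esub> f \<in> carrier (fMod_hom R K L u v)"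
    if "r \<in> carrier R" "f \<in> carrier (fMod_hom R K L u v)"
    unfolding fMod_hom_simps
    by (rule fMod_homI, rule lin_scale[OF Km Lm fMod_homD(1)[OF that(2) refl] that(1)])
      (simp add: fil_closed[OF K] fil_ops[OF L] that(1) fMod_homD(2)[OF that(2) refl _ refl])
qed

text \<open>The evaluations at pairs (m, x) with \<open>x\<close> in the carrier are jointly
  injective because hom-elements are extensional.\<close>

lemma bigraded_module_fMod_hom: "bigraded_module R (fMod_hom R K L)"
proof -
  interpret L: module R "fgr L n" for n by (rule Lm)
  have "module R (fMod_hom R K L u v)" for u v
    unfolding fMod_hom_def
  proof (rule module_mk_by_evaluations[where K = "{(m, x). x \<in> carrier (fgr K m)}"
        and e = "\<lambda>(m, x) f. f m x" and N = "\<lambda>(m, x). fgr L (m + v - u)"], goal_cases)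
    case (4 f g)
    then show ?case
      by (intro fMod_hom_ext[of f R K L u v g u v]) (auto simp: fMod_hom_def)
  next
    case (3 k f)
    then show ?case by (auto intro: lin_closed)
  qed (use fMod_hom_closed in \<open>auto simp: R Lm fMod_hom_def lin_closed\<close>)
  then show ?thesis by (simp add: bigraded_module_def)
qed

text \<open>Negation in the hom-module is known only as an additive inverse. Linearity of evaluation
  makes differences and signs pointwise.\<close>

lemma fMod_hom_eval_lin:
  assumes "x \<in> carrier (fgr K m)" "n = m + v - u"
  shows "(\<lambda>f \<in> carrier (fMod_hom R K L u v). f m x) \<in> lin R (fMod_hom R K L u v) (fgr L n)"
  using assms
  by (intro lin_restrictI bigraded_moduleD bigraded_module_fMod_hom)
    (auto intro: lin_closed fMod_homD simp: fMod_hom_simps)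

lemma fMod_hom_minus:
  assumes "f \<in> carrier (fMod_hom R K L u v)" "g \<in> carrier (fMod_hom R K L u v)"
    and "x \<in> carrier (fgr K m)" "n = m + v - u"
  shows "(f \<ominus>\<^bsub>fMod_hom R K L u v\<^esub> g) m x = f m x \<ominus>\<^bsub>fgr L n\<^esub> g m x"
proof -
  interpret H: module R "fMod_hom R K L u v" by (rule bigraded_moduleD[OF bigraded_module_fMod_hom])
  show ?thesis
    using lin_minus[OF H.module_axioms Lm fMod_hom_eval_lin[OF assms(3,4)] assms(1,2)] assms by simp
qed

lemma fMod_hom_sign_pow:
  assumes "f \<in> carrier (fMod_hom R K L u v)" "x \<in> carrier (fgr K m)" "n = m + v - u"
  shows "(sign_pow (fMod_hom R K L u v) k f) m x = sign_pow (fgr L n) k (f m x)"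
proof -
  interpret H: module R "fMod_hom R K L u v" by (rule bigraded_moduleD[OF bigraded_module_fMod_hom])
  show ?thesis
    using lin_sign_pow[OF H.module_axioms Lm fMod_hom_eval_lin[OF assms(2,3)] assms(1)] assms
      sign_pow_closed[OF H.module_axioms assms(1)] by simp
qed

end

lemma fMod_comp_apply:
  "x \<in> carrier (fgr K m) \<Longrightarrow> fMod_comp K N u v u' v' f g m x =
    sign_pow (fgr N (m + (v + v') - (u + u'))) (u * (v' - u')) (f (m + v' - u') (g m x))"
  by (simp add: fMod_comp_def)

context
  fixes R :: "'r ring" and K :: "('r, 'k) fmodule" and L :: "('r, 'l) fmodule" and N :: "('r, 'n) fmodule"
  assumes R: "cring R" and K: "filtered_module R K" and L: "filtered_module R L" and N: "filtered_module R N"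
begin

private lemmas Km' = filtered_moduleD(1)[OF K]
private lemmas Nm' = filtered_moduleD(1)[OF N]

lemma fMod_comp_closed:
  assumes f: "f \<in> carrier (fMod_hom R L N u v)" and g: "g \<in> carrier (fMod_hom R K L u' v')"
  shows "fMod_comp K N u v u' v' f g \<in> carrier (fMod_hom R K N (u + u') (v + v'))"
proof (rule fMod_homI)
  fix m
  note f' = fMod_homD(1)[OF f, of "m + (v + v') - (u + u')" "m + v' - u'", simplified]
    and g' = fMod_homD(1)[OF g refl, of m]
  show "fMod_comp K N u v u' v' f g m \<in> lin R (fgr K m) (fgr N (m + (v + v') - (u + u')))"
  proof -
    let ?s = "\<lambda>x \<in> carrier (fgr N (m + (v + v') - (u + u'))).
      sign_pow (fgr N (m + (v + v') - (u + u'))) (u * (v' - u')) x"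
    have "compose (carrier (fgr K m)) ?s (compose (carrier (fgr K m)) (f (m + v' - u')) (g m)) =
        fMod_comp K N u v u' v' f g m"
      unfolding fMod_comp_def compose_def
      by (rule restrict_ext) (simp add: lin_closed[OF f'] lin_closed[OF g'])
    then show ?thesis
      using lin_compose[OF Km' lin_compose[OF Km' g' f'] sign_pow_lin[OF Nm'], of "u * (v' - u')"]
      by simp
  qed
  show "fMod_comp K N u v u' v' f g m x \<in> fil N (q + (u + u')) (m + (v + v') - (u + u'))"
    if x: "x \<in> fil K q m" for q x
    using fMod_homD(2)[OF f _ fMod_homD(2)[OF g refl x refl], of "m + (v + v') - (u + u')" "q + (u + u')"]
    by (simp add: fMod_comp_apply fil_closed[OF K x] fil_ops(4)[OF N])
qed

lemma fMod_comp_bilinear: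
  "bilinear R (fMod_hom R L N u v) (fMod_hom R K L u' v') (fMod_hom R K N (u + u') (v + v'))
    (fMod_comp K N u v u' v')"
proof -
  interpret LN: module R "fMod_hom R L N u v" by (rule bigraded_moduleD[OF bigraded_module_fMod_hom[OF R L N]])
  interpret KL: module R "fMod_hom R K L u' v'" by (rule bigraded_moduleD[OF bigraded_module_fMod_hom[OF R K L]])
  interpret KN: module R "fMod_hom R K N (u + u') (v + v')" by (rule bigraded_moduleD[OF bigraded_module_fMod_hom[OF R K N]])
  note s = sign_pow_add[OF Nm'] sign_pow_smult[OF Nm']
  have c: "f (m + v' - u') y \<in> carrier (fgr N (m + (v + v') - (u + u')))"
    if "f \<in> carrier (fMod_hom R L N u v)" "y \<in> carrier (fgr L (m + v' - u'))" for f m y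
    by (rule lin_closed[OF fMod_homD(1)[OF that(1)] that(2)]) simp
  have c': "g m x \<in> carrier (fgr L (m + v' - u'))"
    if "g \<in> carrier (fMod_hom R K L u' v')" "x \<in> carrier (fgr K m)" for g m x
    by (rule lin_closed[OF fMod_homD(1)[OF that(1)] that(2)]) simp
  have e: "m + v' - u' + v - u = m + (v + v') - (u + u')" for m by simp
  have l: "f (m + v' - u') \<in> lin R (fgr L (m + v' - u')) (fgr N (m + (v + v') - (u + u')))"
    if "f \<in> carrier (fMod_hom R L N u v)" for f m by (rule fMod_homD[OF that]) simp
  show ?thesis
  proof (rule bilinearI, goal_cases)
    case (1 f g)
    then show ?case by (rule fMod_comp_closed)
  next
    case (2 f f' g)
    then show ?case
      by (intro fMod_hom_ext[OF fMod_comp_closed KN.a_closed] LN.a_closed fMod_comp_closed)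
        (auto simp: fMod_comp_apply fMod_hom_simps c c' s e)
  next
    case (3 f g g')
    then show ?case
      by (intro fMod_hom_ext[OF fMod_comp_closed KN.a_closed] KL.a_closed fMod_comp_closed)
        (auto simp: fMod_comp_apply fMod_hom_simps c c' s lin_add[OF l])
  next
    case (4 r f g)
    then show ?case
      by (intro fMod_hom_ext[OF fMod_comp_closed KN.smult_closed] LN.smult_closed fMod_comp_closed)
        (auto simp: fMod_comp_apply fMod_hom_simps c c' s e)
  next
    case (5 r f g)
    then show ?case
      by (intro fMod_hom_ext[OF fMod_comp_closed KN.smult_closed] KL.smult_closed fMod_comp_closed)
        (auto simp: fMod_comp_apply fMod_hom_simps c c' s lin_smult[OF l])
  qed
qed

end

lemma fMod_id_closed:
  assumes "filtered_module R K"
  shows "fMod_id K \<in> carrier (fMod_hom R K K 0 0)"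
  using filtered_moduleD(1)[OF assms]
  by (intro fMod_homI) (auto simp: fMod_id_def fil_closed[OF assms] intro!: lin_restrictI)

lemma presented_fMod:
  assumes R: "cring R"
  shows "presented_category R (fMod R) (\<lambda>K L N. fMod_comp K N) fMod_id"
proof (rule presented_category.intro, goal_cases)
  case (4 X Y Z W f p q g s t h k l)
  then have K: "filtered_module R X" "filtered_module R Y" "filtered_module R Z" "filtered_module R W"
    and f: "f \<in> carrier (fMod_hom R Z W p q)" and g: "g \<in> carrier (fMod_hom R Y Z s t)"
    and h: "h \<in> carrier (fMod_hom R X Y k l)"
    by (simp_all add: fMod_def)
  note fg = fMod_comp_closed[OF R K(2,3,4) f g] and gh = fMod_comp_closed[OF R K(1,2,3) g h]
  show ?case
  proof (rule fMod_hom_ext[OF fMod_comp_closed[OF R K(1,2,4) fg h] fMod_comp_closed[OF R K(1,3,4) f gh]])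
    fix m x assume x: "x \<in> carrier (fgr X m)"
    let ?N = "fgr W (m + (q + s' + l) - (p + s + k))"
    have hx: "h m x \<in> carrier (fgr Y (m + l - k))"
      by (rule lin_closed[OF fMod_homD(1)[OF h refl] x])
    have ghx: "g (m + l - k) (h m x) \<in> carrier (fgr Z (m + (t + l) - (s + k)))"
      by (rule lin_closed[OF fMod_homD(1)[OF g] hx]) simp
    have f': "f (m + (t + l) - (s + k)) \<in> lin R (fgr Z (m + (t + l) - (s + k))) (fgr W (m + (q + t + l) - (p + s + k)))"
      by (rule fMod_homD(1)[OF f]) simp
    have fghx: "f (m + (t + l) - (s + k)) (g (m + l - k) (h m x)) \<in> carrier (fgr W (m + (q + t + l) - (p + s + k)))"
      by (rule lin_closed[OF f' ghx])
    have W: "module R (fgr W n)" and Z: "module R (fgr Z n)" for n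
      using K by (auto intro: filtered_moduleD)
    have e: "m + l - k + (q + t) - (p + s) = m + (q + t + l) - (p + s + k)"
      "m + l - k + t - s = m + (t + l) - (s + k)"
      "m + (q + (t + l)) - (p + (s + k)) = m + (q + t + l) - (p + s + k)"
      by auto
    \<comment> \<open>The sign u |g| is additive in the horizontal degree of the left factor and in
      the total degree of the right one, so both bracketings collect the same exponent.\<close>
    have ev: "even ((p + s) * (l - k) + p * (t - s)) = even (p * (t + l - (s + k)) + s * (l - k))"
      by (simp add: algebra_simps)
    show "fMod_comp X W (p + s) (q + t) k l (fMod_comp Y W p q s t f g) h m x =
      fMod_comp X W p q (s + k) (t + l) f (fMod_comp X Z s t k l g h) m x"
      unfolding fMod_comp_apply[OF x] fMod_comp_apply[OF hx] e
      unfolding lin_sign_pow[OF Z W f' ghx] sign_pow_sign_pow[OF W fghx]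
      by (rule sign_pow_cong[OF ev])
  qed
next
  case (5 X)
  then show ?case by (simp add: fMod_def fMod_id_closed)
next
  case (6 X Y f p q)
  then have X: "filtered_module R X" "filtered_module R Y"
    and f: "f \<in> carrier (fMod_hom R X Y p q)" by (auto simp: fMod_def)
  show ?case
    by (rule fMod_hom_ext[OF fMod_comp_closed[OF R X(1,2,2) fMod_id_closed[OF X(2)] f] f])
      (simp add: fMod_comp_apply fMod_id_def lin_closed[OF fMod_homD(1)[OF f refl]])
next
  case (7 X Y f p q)
  then have X: "filtered_module R X" "filtered_module R Y"
    and f: "f \<in> carrier (fMod_hom R X Y p q)" by (auto simp: fMod_def)
  show ?case
    by (rule fMod_hom_ext[OF fMod_comp_closed[OF R X(1,1,2) f fMod_id_closed[OF X(1)]] f])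
      (simp add: fMod_comp_apply fMod_id_def)
qed (auto simp: fMod_def R bigraded_module_fMod_hom fMod_comp_bilinear)

lemma filtered_complexD:
  assumes "filtered_complex R X"
  shows "filtered_module R (fmod X)"
    and "fdiff X \<in> carrier (fMod_hom R (fmod X) (fmod X) 0 1)"
    and "x \<in> carrier (fgr (fmod X) n) \<Longrightarrow> fdiff X (n + 1) (fdiff X n x) = \<zero>\<^bsub>fgr (fmod X) (n + 1 + 1)\<^esub>"
  using assms by (auto simp: filtered_complex_def Let_def image_subset_iff intro!: fMod_homI)

text \<open>Here c(d, f) carries no sign since d has horizontal degree 0, while c(f, d) carries
  (-1)^u since d has total degree 1. So (-1)^v c(f, d) is (-1)^(v+u) f d, and v + u has the parity
  of |f| = v - u.\<close>

lemma fC_diff_eq: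
  assumes R: "cring R" and X: "filtered_complex R X" and Y: "filtered_complex R Y"
    and f: "f \<in> carrier (fMod_hom R (fmod X) (fmod Y) u v)"
  shows "fC_diff R X Y u v f =
    fMod_comp (fmod X) (fmod Y) 0 1 u v (fdiff Y) f
      \<ominus>\<^bsub>fMod_hom R (fmod X) (fmod Y) u (v + 1)\<^esub>
    sign_pow (fMod_hom R (fmod X) (fmod Y) u (v + 1)) v (fMod_comp (fmod X) (fmod Y) u v 0 1 f (fdiff X))"
proof -
  note Xm = filtered_complexD(1)[OF X] and Ym = filtered_complexD(1)[OF Y]
  note dX = filtered_complexD(2)[OF X] and dY = filtered_complexD(2)[OF Y]
  interpret H: module R "fMod_hom R (fmod X) (fmod Y) u (v + 1)"
    by (rule bigraded_moduleD[OF bigraded_module_fMod_hom[OF R Xm Ym]])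
  have df: "fMod_comp (fmod X) (fmod Y) 0 1 u v (fdiff Y) f \<in> carrier (fMod_hom R (fmod X) (fmod Y) u (v + 1))"
    using fMod_comp_closed[OF R Xm Ym Ym dY f] by (simp add: add.commute)
  have fd: "fMod_comp (fmod X) (fmod Y) u v 0 1 f (fdiff X) \<in> carrier (fMod_hom R (fmod X) (fmod Y) u (v + 1))"
    using fMod_comp_closed[OF R Xm Xm Ym f dX] by simp
  note s = sign_pow_closed[OF H.module_axioms]
  have "fC_diff R X Y u v f m x = (fMod_comp (fmod X) (fmod Y) 0 1 u v (fdiff Y) f
      \<ominus>\<^bsub>fMod_hom R (fmod X) (fmod Y) u (v + 1)\<^esub>
    sign_pow (fMod_hom R (fmod X) (fmod Y) u (v + 1)) v (fMod_comp (fmod X) (fmod Y) u v 0 1 f (fdiff X))) m x"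
    (is "_ = ?rhs m x") for m x
  proof (cases "x \<in> carrier (fgr (fmod X) m)")
    case True
    let ?N = "fgr (fmod Y) (m + (v + 1) - u)"
    have N: "module R ?N" by (rule filtered_moduleD[OF Ym])
    have dx: "fdiff X m x \<in> carrier (fgr (fmod X) (m + 1))"
      by (rule lin_closed[OF fMod_homD(1)[OF dX] True]) simp
    have c: "f (m + 1) (fdiff X m x) \<in> carrier ?N"
      by (rule lin_closed[OF fMod_homD(1)[OF f] dx]) simp
    have "?rhs m x = fMod_comp (fmod X) (fmod Y) 0 1 u v (fdiff Y) f m x \<ominus>\<^bsub>?N\<^esub>
        sign_pow ?N v (fMod_comp (fmod X) (fmod Y) u v 0 1 f (fdiff X) m x)"
      by (subst fMod_hom_minus[OF R Xm Ym df s[OF fd] True refl], subst fMod_hom_sign_pow[OF R Xm Ym fd True refl])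
        (rule refl)
    also have "\<dots> = fdiff Y (m + v - u) (f m x) \<ominus>\<^bsub>?N\<^esub> sign_pow ?N (v - u) (f (m + 1) (fdiff X m x))"
      using True
      by (simp add: fMod_comp_apply sign_pow_sign_pow[OF N c] sign_pow_cong[of "v + u" "v - u"] add.commute[of 1 v])
    finally show ?thesis using f True by (simp add: fC_diff_def Let_def)
  next
    \<comment> \<open>Both sides are extensional in the inner argument, hence undefined
      here.\<close>
    case False
    have "?rhs \<in> carrier (fMod_hom R (fmod X) (fmod Y) u (v + 1))"
      by (intro H.M.minus_closed df s fd)
    from lin_extensional[OF fMod_homD(1)[OF this refl]] False
    have "?rhs m x = undefined" by (auto simp: extensional_def)
    then show ?thesis using f False by (simp add: fC_diff_def Let_def)
  qed
  then show ?thesis by (intro ext)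
qed

lemma presented_fC:
  assumes R: "cring R"
  shows "presented_dg_category R (fC R) (\<lambda>X Y Z. fMod_comp (fmod X) (fmod Z)) (\<lambda>X. fMod_id (fmod X)) fdiff"
proof (rule presented_dg_category.intro)
  show "presented_category R (fC R) (\<lambda>X Y Z. fMod_comp (fmod X) (fmod Z)) (\<lambda>X. fMod_id (fmod X))"
    by (rule presented_category.pullback[OF presented_fMod[OF R], where U = fmod])
      (auto simp: fC_def fMod_def filtered_complexD)
  show "presented_dg_category_axioms (fC R) (\<lambda>X Y Z. fMod_comp (fmod X) (fmod Z)) fdiff"
  proof (rule presented_dg_category_axioms.intro, goal_cases)
    case (1 X)
    then show ?case by (auto simp: fC_def fMod_def filtered_complexD)
  next
    case (2 X)
    then have X: "filtered_complex R X" by (simp add: fC_def)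
    show ?case
      using filtered_complexD(3)[OF X]
      by (auto simp: fun_eq_iff fC_def fMod_def fMod_comp_def fMod_hom_simps add.assoc)
  next
    case (3 X Y f u v)
    then show ?case using fC_diff_eq[OF R, of X Y f u v] by (auto simp: fC_def fMod_def)
  next
    case (4 X Y u v)
    then show ?case by (auto simp: fC_def fMod_def fC_diff_def Let_def)
  qed
qed

section \<open>The hom-objects of bigraded modules\<close>

lemma bg_hom_carrier: "f \<in> carrier (bg_hom R A B u v) \<longleftrightarrow> (\<forall>m. f m \<in> bg_maps R A B (u - int m) (v - int m))"
  by (simp add: bg_hom_def)

lemma bg_homD:
  "f \<in> carrier (bg_hom R A B u v) \<Longrightarrow> i' = i + (u - int m) \<Longrightarrow> j' = j + (v - int m) \<Longrightarrow>
    f m i j \<in> lin R (A i j) (B i' j')"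
  by (auto simp: bg_hom_carrier intro: bg_mapsD')

lemma bg_hom_simps:
  "\<zero>\<^bsub>bg_hom R A B u v\<^esub> = (\<lambda>m. bg_zero A B (u - int m) (v - int m))"
  "f \<oplus>\<^bsub>bg_hom R A B u v\<^esub> g = (\<lambda>m i j. \<lambda>x \<in> carrier (A i j).
     f m i j x \<oplus>\<^bsub>B (i + (u - int m)) (j + (v - int m))\<^esub> g m i j x)"
  "r \<odot>\<^bsub>bg_hom R A B u v\<^esub> f = (\<lambda>m i j. \<lambda>x \<in> carrier (A i j).
     r \<odot>\<^bsub>B (i + (u - int m)) (j + (v - int m))\<^esub> f m i j x)"
  by (simp_all add: bg_hom_def)

lemma bg_hom_ext:
  assumes f: "f \<in> carrier (bg_hom R A B u v)" and g: "g \<in> carrier (bg_hom R A B u' v')"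
    and eq: "\<And>m i j x. x \<in> carrier (A i j) \<Longrightarrow> f m i j x = g m i j x"
  shows "f = g"
proof (intro ext)
  fix m i j x
  have "f m i j = g m i j"
    by (rule lin_ext[OF bg_homD[OF f refl refl] bg_homD[OF g refl refl] eq])
  then show "f m i j x = g m i j x" by simp
qed

lemma bigraded_module_bg_hom:
  assumes R: "cring R" and A: "bigraded_module R A" and B: "bigraded_module R B"
  shows "bigraded_module R (bg_hom R A B)"
proof -
  have "module R (bg_hom R A B u v)" for u v
    unfolding bg_hom_def
  proof (rule module_mk_by_evaluations[where K = "{(m, i, j, x). x \<in> carrier (A i j)}"
        and e = "\<lambda>(m, i, j, x) f. f m i j x"
        and N = "\<lambda>(m, i, j, x). B (i + (u - int m)) (j + (v - int m))"], goal_cases)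
    case (3 k f)
    then show ?case by (auto intro: lin_closed bg_mapsD)
  next
    case (4 f g)
    then show ?case
      by (intro bg_hom_ext[of f R A B u v g u v]) (auto simp: bg_hom_def)
  next
    case 5
    show ?case using bg_zero_maps[OF A B] by simp
  next
    case (7 f g)
    then show ?case using bg_maps_add[OF A B] by blast
  next
    case (9 r f)
    then show ?case using bg_maps_smult[OF A B] by blast
  qed (auto simp: R bg_zero_def bigraded_moduleD[OF B])
  then show ?thesis by (simp add: bigraded_module_def)
qed

section \<open>Totalization of bigraded modules\<close>

text \<open>Finitely many nonzero components at positive indices amounts to an upper bound on the
  support. The bound is what the filtration arguments and the cut-off of sums use.\<close>

lemma Tot_gr_carrier:
  "a \<in> carrier (Tot_gr A n) \<longleftrightarrow>
    (\<forall>i. a i \<in> carrier (A i (n + i))) \<and> (\<exists>p. \<forall>i > p. a i = \<zero>\<^bsub>A i (n + i)\<^esub>)"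
proof -
  let ?S = "{i. i > 0 \<and> a i \<noteq> \<zero>\<^bsub>A i (n + i)\<^esub>}"
  have "\<exists>p. \<forall>i > p. a i = \<zero>\<^bsub>A i (n + i)\<^esub>" if "finite ?S"
  \<comment> \<open>Inserting 0 makes the set nonempty and the bound nonnegative, so that only
    positive indices lie above it.\<close>
  proof (rule exI[of _ "Max (insert 0 ?S)"], intro allI impI)
    fix i assume "i > Max (insert 0 ?S)"
    then have "i > 0" "i \<notin> ?S" using that Max_ge[of "insert 0 ?S" i] by auto
    then show "a i = \<zero>\<^bsub>A i (n + i)\<^esub>" by simp
  qed
  moreover have "finite ?S" if "\<forall>i > p. a i = \<zero>\<^bsub>A i (n + i)\<^esub>" for p
    using that by (intro finite_subset[of ?S "{0..p}"]) (auto simp: not_less[symmetric])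
  ultimately show ?thesis by (auto simp: Tot_gr_def)
qed

lemma Tot_gr_simps:
  "\<zero>\<^bsub>Tot_gr A n\<^esub> = (\<lambda>i. \<zero>\<^bsub>A i (n + i)\<^esub>)"
  "a \<oplus>\<^bsub>Tot_gr A n\<^esub> b = (\<lambda>i. a i \<oplus>\<^bsub>A i (n + i)\<^esub> b i)"
  "r \<odot>\<^bsub>Tot_gr A n\<^esub> a = (\<lambda>i. r \<odot>\<^bsub>A i (n + i)\<^esub> a i)"
  by (simp_all add: Tot_gr_def)

lemma Tot_gr_component: "a \<in> carrier (Tot_gr A n) \<Longrightarrow> j = n + i \<Longrightarrow> a i \<in> carrier (A i j)"
  by (simp add: Tot_gr_carrier)

lemma Tot_mod_simps [simp]:
  "fgr (Tot_mod A) = Tot_gr A"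
  "fil (Tot_mod A) p n = {a \<in> carrier (Tot_gr A n). \<forall>i. i > p \<longrightarrow> a i = \<zero>\<^bsub>A i (n + i)\<^esub>}"
  by (simp_all add: Tot_mod_def)

definition Tot_single :: "('r, 'a) bgmod \<Rightarrow> int \<Rightarrow> int \<Rightarrow> 'a \<Rightarrow> int \<Rightarrow> 'a" where
  "Tot_single A n i x = (\<lambda>k. if k = i then x else \<zero>\<^bsub>A k (n + k)\<^esub>)"

context
  fixes R :: "'r ring" and A :: "('r, 'a) bgmod"
  assumes R: "cring R" and A: "bigraded_module R A"
begin

interpretation A: module R "A i j" for i j by (rule bigraded_moduleD[OF A])

lemma module_Tot_gr: "module R (Tot_gr A n)"
proof -
  have eq: "carrier (Tot_gr A n) =
      {a. (\<forall>i. a i \<in> carrier (A i (n + i))) \<and> finite {i. i > 0 \<and> a i \<noteq> \<zero>\<^bsub>A i (n + i)\<^esub>}}"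
    by (simp add: Tot_gr_def)
  have c: "a i \<in> carrier (A i (n + i))" if "a \<in> carrier (Tot_gr A n)" for a i
    using that by (simp add: eq)
  have "module R (mk_module (carrier (Tot_gr A n)) (\<lambda>i. \<zero>\<^bsub>A i (n + i)\<^esub>)
    (\<lambda>a b i. a i \<oplus>\<^bsub>A i (n + i)\<^esub> b i) (\<lambda>r a i. r \<odot>\<^bsub>A i (n + i)\<^esub> a i))"
  proof (rule module_mk_by_evaluations[where K = UNIV and N = "\<lambda>i. A i (n + i)" and e = "\<lambda>i a. a i"], goal_cases)
    case (7 a b)
    then obtain p q where "\<forall>i > p. a i = \<zero>\<^bsub>A i (n + i)\<^esub>" "\<forall>i > q. b i = \<zero>\<^bsub>A i (n + i)\<^esub>"
      by (auto simp: Tot_gr_carrier)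
    then have "\<forall>i > max p q. a i \<oplus>\<^bsub>A i (n + i)\<^esub> b i = \<zero>\<^bsub>A i (n + i)\<^esub>" by simp
    then show ?case using 7 unfolding Tot_gr_carrier by blast
  next
    case (9 r a)
    then obtain p where "\<forall>i > p. a i = \<zero>\<^bsub>A i (n + i)\<^esub>"
      by (auto simp: Tot_gr_carrier)
    then have "\<forall>i > p. r \<odot>\<^bsub>A i (n + i)\<^esub> a i = \<zero>\<^bsub>A i (n + i)\<^esub>" using 9 by simp
    then show ?case using 9 unfolding Tot_gr_carrier by blast
  qed (auto simp: R A.module_axioms c Tot_gr_carrier)
  then show ?thesis by (simp add: Tot_gr_def)
qed

interpretation T: module R "Tot_gr A n" for n by (rule module_Tot_gr)

lemma Tot_component_lin: "(\<lambda>a \<in> carrier (Tot_gr A n). a i) \<in> lin R (Tot_gr A n) (A i (n + i))"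
  by (rule lin_restrictI[OF module_Tot_gr]) (auto simp: Tot_gr_simps Tot_gr_component)

lemma Tot_sign_pow:
  assumes "a \<in> carrier (Tot_gr A n)"
  shows "(sign_pow (Tot_gr A n) m a) i = sign_pow (A i (n + i)) m (a i)"
  using lin_sign_pow[OF module_Tot_gr A.module_axioms Tot_component_lin assms] assms
  by (simp add: sign_pow_closed[OF module_Tot_gr])

text \<open>Exhaustiveness is the upper bound on supports from
  \<open>Tot_gr_carrier\<close>.\<close>

lemma filtered_module_Tot_mod: "filtered_module R (Tot_mod A)"
proof -
  have "submodule (fil (Tot_mod A) p n) R (Tot_gr A n)" for p n
  proof (rule T.submoduleI, goal_cases)
    case (3 a)
    \<comment> \<open>A sign with odd exponent is negation, which is thereby computed
      componentwise.\<close>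
    then have "sign_pow (Tot_gr A n) 1 a i = sign_pow (A i (n + i)) 1 (a i)" for i
      by (intro Tot_sign_pow) simp
    with 3 show ?case by (auto simp: sign_pow_def A.M.minus_equality)
  qed (auto simp: Tot_gr_simps T.a_closed[unfolded Tot_gr_simps] T.zero_closed[unfolded Tot_gr_simps]
    T.smult_closed[unfolded Tot_gr_simps])
  then show ?thesis
    unfolding filtered_module_def
    by (auto simp: module_Tot_gr) (auto simp: Tot_gr_carrier)
qed

lemma Tot_single_lin:
  assumes "j = n + i"
  shows "(\<lambda>x \<in> carrier (A i j). Tot_single A n i x) \<in> lin R (A i j) (Tot_gr A n)"
proof (rule lin_restrictI[OF A.module_axioms])
  fix x assume "x \<in> carrier (A i j)"
  then show "Tot_single A n i x \<in> carrier (Tot_gr A n)"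
    by (auto simp: Tot_gr_carrier Tot_single_def assms intro: exI[of _ i])
qed (auto simp: Tot_single_def Tot_gr_simps fun_eq_iff assms)

lemma Tot_single_closed: "x \<in> carrier (A i (n + i)) \<Longrightarrow> Tot_single A n i x \<in> carrier (Tot_gr A n)"
  using lin_closed[OF Tot_single_lin[OF refl]] by fastforce

end

text \<open>
  The element with the single component \<open>x\<close> at \<open>i\<close> is mapped by \<open>Tot(f)\<close> to an element with
  components \<open>\<plusminus>f\<^sub>m(x)\<close> at \<open>i + u - m\<close>.
\<close>

definition Tot_inv ::
  "('r, 'a) bgmod \<Rightarrow> ('r, 'b) bgmod \<Rightarrow> int \<Rightarrow> int \<Rightarrow> (int \<Rightarrow> (int \<Rightarrow> 'a) \<Rightarrow> int \<Rightarrow> 'b) \<Rightarrow> ('a, 'b) bgseq" where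
  "Tot_inv A B u v F = (\<lambda>m i j. \<lambda>x \<in> carrier (A i j).
     sign_pow (B (i + (u - int m)) (j + (v - int m))) ((int m + u) * (j - i))
       (F (j - i) (Tot_single A (j - i) i x) (i + (u - int m))))"

context
  fixes R :: "'r ring" and A :: "('r, 'a) bgmod" and B :: "('r, 'b) bgmod"
  assumes R: "cring R" and A: "bigraded_module R A" and B: "bigraded_module R B"
begin

interpretation A: module R "A i j" for i j by (rule bigraded_moduleD[OF A])
interpretation B: module R "B i j" for i j by (rule bigraded_moduleD[OF B])
interpretation TA: module R "Tot_gr A n" for n by (rule module_Tot_gr[OF R A])
interpretation TB: module R "Tot_gr B n" for n by (rule module_Tot_gr[OF R B])

text \<open>For component \<open>k\<close> of the image, the part of \<open>a\<close> at indices
  below k - u may be discarded since it is mapped below filtration degree k. Between k - u and the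
  bound of the support lie finitely many indices, which are removed one at a time from the
  top.\<close>

lemma Tot_hom_ext:
  assumes F: "F \<in> carrier (fMod_hom R (Tot_mod A) (Tot_mod B) u v)"
    and G: "G \<in> carrier (fMod_hom R (Tot_mod A) (Tot_mod B) u v)"
    and eq: "\<And>n i x. x \<in> carrier (A i (n + i)) \<Longrightarrow> F n (Tot_single A n i x) = G n (Tot_single A n i x)"
  shows "F = G"
proof (rule fMod_hom_ext[OF F G])
  fix n a assume "a \<in> carrier (fgr (Tot_mod A) n)"
  then have a: "a \<in> carrier (Tot_gr A n)" by simp
  have lin: "H n \<in> lin R (Tot_gr A n) (Tot_gr B (n + v - u))"
    if "H \<in> carrier (fMod_hom R (Tot_mod A) (Tot_mod B) u v)" for H
    using fMod_homD(1)[OF that refl] by simp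
  \<comment> \<open>Elements of F_p land in F_(p+u), so their images have no component at
    \<open>k\<close> beyond p + u.\<close>
  have low: "H n a k = \<zero>\<^bsub>B k (n + v - u + k)\<^esub>"
    if "H \<in> carrier (fMod_hom R (Tot_mod A) (Tot_mod B) u v)" "a \<in> carrier (Tot_gr A n)"
      "\<forall>i > p. a i = \<zero>\<^bsub>A i (n + i)\<^esub>" "p + u < k" for H a p k
    using fMod_homD(2)[OF that(1) refl, of a p n "p + u"] that by auto
  have "F n a k = G n a k"
    if "a \<in> carrier (Tot_gr A n)" "\<forall>i > k - u - 1 + int N. a i = \<zero>\<^bsub>A i (n + i)\<^esub>" for k N
    using that
  proof (induction N arbitrary: a)
    case 0
    then show ?case using low[OF F, of a "k - u - 1" k] low[OF G, of a "k - u - 1" k] by simp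
  next
    case (Suc N)
    \<comment> \<open>The highest index at which \<open>a\<close> can be nonzero in the step for
      \<open>Suc N\<close>.\<close>
    let ?i = "k - u + int N"
    define b where "b = a(?i := \<zero>\<^bsub>A ?i (n + ?i)\<^esub>)"
    have ai: "a ?i \<in> carrier (A ?i (n + ?i))" using Suc.prems(1) by (rule Tot_gr_component) simp
    have b: "b \<in> carrier (Tot_gr A n)"
      unfolding Tot_gr_carrier
    proof (intro conjI allI exI[of _ ?i] impI)
      show "b i \<in> carrier (A i (n + i))" for i using Suc.prems(1) by (simp add: b_def Tot_gr_carrier)
      show "b i = \<zero>\<^bsub>A i (n + i)\<^esub>" if "i > ?i" for i using Suc.prems(2) that by (simp add: b_def)
    qed
    have "\<forall>i > k - u - 1 + int N. b i = \<zero>\<^bsub>A i (n + i)\<^esub>"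
      using Suc.prems(2) by (auto simp: b_def)
    from Suc.IH[OF b this] have "F n b k = G n b k" .
    moreover have "F n (Tot_single A n ?i (a ?i)) k = G n (Tot_single A n ?i (a ?i)) k"
      using eq[OF ai] by simp
    moreover have "a = b \<oplus>\<^bsub>Tot_gr A n\<^esub> Tot_single A n ?i (a ?i)"
      using Suc.prems(1) by (auto simp: fun_eq_iff Tot_gr_simps Tot_single_def b_def Tot_gr_carrier)
    ultimately show ?case
      using lin_add[OF lin[OF F] b Tot_single_closed[OF R A ai]]
        lin_add[OF lin[OF G] b Tot_single_closed[OF R A ai]]
      by (simp add: Tot_gr_simps)
  qed
  note * = this
  show "F n a = G n a"
  proof
    fix k
    obtain p where p: "\<forall>i > p. a i = \<zero>\<^bsub>A i (n + i)\<^esub>" using a by (auto simp: Tot_gr_carrier)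
    then show "F n a k = G n a k"
      \<comment> \<open>With this \<open>N\<close> the cut-off k - u - 1 + N is at least the bound
        \<open>p\<close>.\<close>
      by (intro *[OF a, where N = "nat (p - (k - u - 1))"]) auto
  qed
qed

private abbreviation "tt u v f n a k m \<equiv> sign_pow (B k (n + v - u + k)) ((int m + u) * n)
  (f m (k - u + int m) (n + (k - u + int m)) (a (k - u + int m)))"

context
  fixes u v f
  assumes f: "f \<in> carrier (bg_hom R A B u v)"
begin

private lemma f_lin: "f m (k - u + int m) (n + (k - u + int m)) \<in>
    lin R (A (k - u + int m) (n + (k - u + int m))) (B k (n + v - u + k))"
  by (rule bg_homD[OF f]) auto

private lemma tt_closed: "a \<in> carrier (Tot_gr A n) \<Longrightarrow> tt u v f n a k m \<in> carrier (B k (n + v - u + k))"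
  by (intro sign_pow_closed[OF B.module_axioms] lin_closed[OF f_lin]) (simp add: Tot_gr_component)

text \<open>The index set in \<open>Tot_map\<close> depends on \<open>a\<close>; zero components
  contribute zero, so any finite superset serves.\<close>

lemma Tot_map_superset:
  assumes a: "a \<in> carrier (Tot_gr A n)" and T: "finite T"
    "\<And>m. a (k - u + int m) \<noteq> \<zero>\<^bsub>A (k - u + int m) (n + (k - u + int m))\<^esub> \<Longrightarrow> m \<in> T"
  shows "Tot_map A B u v f n a k = (\<Oplus>\<^bsub>B k (n + v - u + k)\<^esub> m \<in> T. tt u v f n a k m)"
proof -
  have "Tot_map A B u v f n a k = (\<Oplus>\<^bsub>B k (n + v - u + k)\<^esub>
      m \<in> {m. a (k - u + int m) \<noteq> \<zero>\<^bsub>A (k - u + int m) (n + (k - u + int m))\<^esub>}. tt u v f n a k m)"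
    using a by (simp only: Tot_map_def Let_def restrict_apply if_True diff_add_cancel)
  also have "\<dots> = (\<Oplus>\<^bsub>B k (n + v - u + k)\<^esub> m \<in> T. tt u v f n a k m)"
    using T a
    by (intro B.finsum_mono_neutral)
      (auto simp: tt_closed lin_zero[OF A.module_axioms B.module_axioms f_lin] sign_pow_zero[OF B.module_axioms])
  finally show ?thesis .
qed

lemma Tot_map_atMost:
  assumes "a \<in> carrier (Tot_gr A n)" "\<forall>i > p. a i = \<zero>\<^bsub>A i (n + i)\<^esub>" "p \<le> k - u + int N"
  shows "Tot_map A B u v f n a k = (\<Oplus>\<^bsub>B k (n + v - u + k)\<^esub> m \<in> {..N}. tt u v f n a k m)"
proof (rule Tot_map_superset[OF assms(1)])
  fix m assume "a (k - u + int m) \<noteq> \<zero>\<^bsub>A (k - u + int m) (n + (k - u + int m))\<^esub>"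
  then have "\<not> k - u + int m > p" using assms(2) by blast
  then show "m \<in> {..N}" using assms(3) by simp
qed simp

text \<open>All indices k - u + m lie above the bound \<open>p\<close>, so the sum is empty. This is
  compatibility with the filtration.\<close>

lemma Tot_map_above:
  assumes "a \<in> carrier (Tot_gr A n)" "\<forall>i > p. a i = \<zero>\<^bsub>A i (n + i)\<^esub>" "p + u < k"
  shows "Tot_map A B u v f n a k = \<zero>\<^bsub>B k (n + v - u + k)\<^esub>"
proof -
  have "Tot_map A B u v f n a k = (\<Oplus>\<^bsub>B k (n + v - u + k)\<^esub> m \<in> {}. tt u v f n a k m)"
  proof (rule Tot_map_superset[OF assms(1)])
    fix m assume "a (k - u + int m) \<noteq> \<zero>\<^bsub>A (k - u + int m) (n + (k - u + int m))\<^esub>"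
    then have "\<not> k - u + int m > p" using assms(2) by blast
    then show "m \<in> {}" using assms(3) by simp
  qed simp
  then show ?thesis by simp
qed

text \<open>Only the summand with k - u + m = i survives, that is m = i + u - k, and it exists only
  for k at most i + u.\<close>

lemma Tot_map_single:
  assumes x: "x \<in> carrier (A i (n + i))"
  shows "Tot_map A B u v f n (Tot_single A n i x) k =
    (if k \<le> i + u then sign_pow (B k (n + v - u + k)) ((i + u - k + u) * n) (f (nat (i + u - k)) i (n + i) x)
     else \<zero>\<^bsub>B k (n + v - u + k)\<^esub>)"
proof (cases "k \<le> i + u")
  case True
  let ?m = "nat (i + u - k)"
  have m: "int ?m = i + u - k" using True by simp
  have "Tot_map A B u v f n (Tot_single A n i x) k =
      (\<Oplus>\<^bsub>B k (n + v - u + k)\<^esub> m \<in> {?m}. tt u v f n (Tot_single A n i x) k m)"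
    by (rule Tot_map_superset[OF Tot_single_closed[OF R A x]])
      (auto simp: Tot_single_def split: if_splits)
  also have "\<dots> = tt u v f n (Tot_single A n i x) k ?m"
    using tt_closed[OF Tot_single_closed[OF R A x], of k ?m] by (subst B.finsum_insert) auto
  finally show ?thesis using True by (simp add: m Tot_single_def)
next
  case False
  then show ?thesis
    using Tot_map_above[OF Tot_single_closed[OF R A x], of i k] by (simp add: Tot_single_def)
qed

private lemma Tot_map_sum_lin:
  "(\<lambda>a \<in> carrier (Tot_gr A n). \<Oplus>\<^bsub>B k (n + v - u + k)\<^esub> m \<in> {..N}. tt u v f n a k m)
    \<in> lin R (Tot_gr A n) (B k (n + v - u + k))"
  by (intro lin_sum lin_restrictI TA.module_axioms B.module_axioms)
    (simp_all add: tt_closed Tot_gr_simps Tot_gr_component lin_add[OF f_lin] lin_smult[OF f_lin]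
      lin_closed[OF f_lin] sign_pow_add[OF B.module_axioms] sign_pow_smult[OF B.module_axioms])

lemma Tot_map_hom: "Tot_map A B u v f \<in> carrier (fMod_hom R (Tot_mod A) (Tot_mod B) u v)"
proof (rule fMod_homI)
  fix n
  have closed: "Tot_map A B u v f n a \<in> carrier (Tot_gr B (n + v - u))" if a: "a \<in> carrier (Tot_gr A n)" for a
  proof -
    obtain p where p: "\<forall>i > p. a i = \<zero>\<^bsub>A i (n + i)\<^esub>" using a by (auto simp: Tot_gr_carrier)
    have "Tot_map A B u v f n a k \<in> carrier (B k (n + v - u + k))" for k
    proof -
      have "Tot_map A B u v f n a k = (\<Oplus>\<^bsub>B k (n + v - u + k)\<^esub> m \<in> {..nat (p - (k - u))}. tt u v f n a k m)"
        by (rule Tot_map_atMost[OF a p]) simp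
      then show ?thesis by (simp add: tt_closed[OF a] B.finsum_closed)
    qed
    moreover have "\<forall>k > p + u. Tot_map A B u v f n a k = \<zero>\<^bsub>B k (n + v - u + k)\<^esub>"
      using Tot_map_above[OF a p] by blast
    ultimately show ?thesis unfolding Tot_gr_carrier by blast
  qed
  show "Tot_map A B u v f n \<in> lin R (fgr (Tot_mod A) n) (fgr (Tot_mod B) (n + v - u))"
    unfolding Tot_mod_simps
  proof (rule linI, goal_cases)
    case 1
    show ?case by (auto simp: Tot_map_def Let_def)
  next
    case (2 a)
    then show ?case by (rule closed)
  next
    case (3 a b)
    obtain p q where p: "\<forall>i > p. a i = \<zero>\<^bsub>A i (n + i)\<^esub>" and q: "\<forall>i > q. b i = \<zero>\<^bsub>A i (n + i)\<^esub>"
      using 3 by (auto simp: Tot_gr_carrier)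
    have ab: "a \<oplus>\<^bsub>Tot_gr A n\<^esub> b \<in> carrier (Tot_gr A n)" using 3 by simp
    have pq: "\<forall>i > max p q. (a \<oplus>\<^bsub>Tot_gr A n\<^esub> b) i = \<zero>\<^bsub>A i (n + i)\<^esub>"
      using p q by (simp add: Tot_gr_simps)
    have "Tot_map A B u v f n (a \<oplus>\<^bsub>Tot_gr A n\<^esub> b) k =
        Tot_map A B u v f n a k \<oplus>\<^bsub>B k (n + v - u + k)\<^esub> Tot_map A B u v f n b k" for k
    proof -
      \<comment> \<open>One cut-off for both arguments and their sum, so that the linear map
        \<open>Tot_map_sum_lin\<close> computes all three values.\<close>
      define N where "N = nat (max p q - (k - u))"
      have N: "p \<le> k - u + int N" "q \<le> k - u + int N" "max p q \<le> k - u + int N" by (auto simp: N_def)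
      show ?thesis
        using lin_add[OF Tot_map_sum_lin[where n = n and k = k and N = N] 3] 3 ab
        by (simp add: Tot_map_atMost[OF _ p N(1)] Tot_map_atMost[OF _ q N(2)] Tot_map_atMost[OF _ pq N(3)])
    qed
    then show ?case by (simp add: fun_eq_iff Tot_gr_simps)
  next
    case (4 r a)
    obtain p where p: "\<forall>i > p. a i = \<zero>\<^bsub>A i (n + i)\<^esub>" using 4 by (auto simp: Tot_gr_carrier)
    have ra: "r \<odot>\<^bsub>Tot_gr A n\<^esub> a \<in> carrier (Tot_gr A n)" using 4 by simp
    have p': "\<forall>i > p. (r \<odot>\<^bsub>Tot_gr A n\<^esub> a) i = \<zero>\<^bsub>A i (n + i)\<^esub>" using p 4 by (simp add: Tot_gr_simps)
    have "Tot_map A B u v f n (r \<odot>\<^bsub>Tot_gr A n\<^esub> a) k =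
        r \<odot>\<^bsub>B k (n + v - u + k)\<^esub> Tot_map A B u v f n a k" for k
    proof -
      define N where "N = nat (p - (k - u))"
      have N: "p \<le> k - u + int N" by (auto simp: N_def)
      show ?thesis
        using lin_smult[OF Tot_map_sum_lin[where n = n and k = k and N = N] 4] 4 ra
        by (simp add: Tot_map_atMost[OF _ p N] Tot_map_atMost[OF _ p' N])
    qed
    then show ?case by (simp add: fun_eq_iff Tot_gr_simps)
  qed
  show "Tot_map A B u v f n a \<in> fil (Tot_mod B) (q + u) (n + v - u)" if "a \<in> fil (Tot_mod A) q n" for q a
    using that closed Tot_map_above[of a n q] by simp
qed

end

text \<open>Component i + u - m of the image of a single element is f_m up to a sign, which
  \<open>Tot_inv\<close> applies a second time.\<close>

lemma Tot_inv_Tot_map: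
  assumes f: "f \<in> carrier (bg_hom R A B u v)"
  shows "Tot_inv A B u v (Tot_map A B u v f) = f"
proof (intro ext)
  fix m i j x
  note l = bg_homD[OF f refl refl, of m i j]
  show "Tot_inv A B u v (Tot_map A B u v f) m i j x = f m i j x"
  proof (cases "x \<in> carrier (A i j)")
    case True
    have e: "j - i + v - u + (i + (u - int m)) = j + (v - int m)" "i + u - (i + (u - int m)) = int m"
      by auto
    have "Tot_map A B u v f (j - i) (Tot_single A (j - i) i x) (i + (u - int m)) =
        sign_pow (B (i + (u - int m)) (j + (v - int m))) ((int m + u) * (j - i)) (f m i j x)"
      using Tot_map_single[OF f, of x i "j - i" "i + (u - int m)"] True unfolding e by simp
    then show ?thesis
      using True lin_closed[OF l True]
      by (simp add: Tot_inv_def sign_pow_sign_pow[OF B.module_axioms] sign_pow_def)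
  next
    case False
    then show ?thesis using lin_extensional[OF l] by (simp add: Tot_inv_def extensional_def)
  qed
qed

context
  fixes u v F
  assumes F: "F \<in> carrier (fMod_hom R (Tot_mod A) (Tot_mod B) u v)"
begin

lemma Tot_inv_closed: "Tot_inv A B u v F \<in> carrier (bg_hom R A B u v)"
  unfolding bg_hom_carrier
proof (intro allI bg_mapsI)
  fix m i j
  let ?M = "B (i + (u - int m)) (j + (v - int m))"
  have F': "F (j - i) \<in> lin R (Tot_gr A (j - i)) (Tot_gr B (j - i + v - u))"
    using fMod_homD(1)[OF F refl] by simp
  have e: "j - i + v - u + (i + (u - int m)) = j + (v - int m)" by simp
  note S = Tot_single_lin[OF R A, of j "j - i" i, simplified]
  \<comment> \<open>\<open>Tot_inv\<close> in degree \<open>m\<close> is the composite of four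
    linear maps: inclusion as a single component, \<open>F\<close>, projection to a component, and a
    sign.\<close>
  note l = lin_compose[OF A.module_axioms lin_compose[OF A.module_axioms lin_compose[OF A.module_axioms S F']
        Tot_component_lin[OF R B, where n = "j - i + v - u" and i = "i + (u - int m)", unfolded e]]
        sign_pow_lin[OF B.module_axioms, of _ _ "(int m + u) * (j - i)"]]
  have "Tot_inv A B u v F m i j = compose (carrier (A i j)) (\<lambda>x \<in> carrier ?M. sign_pow ?M ((int m + u) * (j - i)) x)
     (compose (carrier (A i j)) (\<lambda>a \<in> carrier (Tot_gr B (j - i + v - u)). a (i + (u - int m)))
       (compose (carrier (A i j)) (F (j - i)) (\<lambda>x \<in> carrier (A i j). Tot_single A (j - i) i x)))"
    unfolding Tot_inv_def compose_def
    by (rule restrict_ext)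
      (use e lin_closed[OF S] lin_closed[OF F'] in
        \<open>simp add: Tot_gr_component[of _ B "j - i + v - u"]\<close>)
  then show "Tot_inv A B u v F m i j \<in> lin R (A i j) (B (i + (u - int m)) (j + (v - int m)))"
    using l by simp
qed

lemma Tot_map_Tot_inv: "Tot_map A B u v (Tot_inv A B u v F) = F"
proof (rule Tot_hom_ext[OF Tot_map_hom[OF Tot_inv_closed] F], rule ext)
  fix n i x k assume x: "x \<in> carrier (A i (n + i))"
  note s = Tot_single_closed[OF R A x]
  have Fs: "F n (Tot_single A n i x) \<in> carrier (Tot_gr B (n + v - u))"
    using lin_closed[OF fMod_homD(1)[OF F refl]] s by simp
  show "Tot_map A B u v (Tot_inv A B u v F) n (Tot_single A n i x) k = F n (Tot_single A n i x) k"
  proof (cases "k \<le> i + u")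
    case True
    have e: "i + (u - (i + u - k)) = k" "n + i + (v - (i + u - k)) = n + v - u + k" by auto
    have m: "int (nat (i + u - k)) = i + u - k" using True by simp
    have inv: "Tot_inv A B u v F (nat (i + u - k)) i (n + i) x =
        sign_pow (B k (n + v - u + k)) ((i + u - k + u) * n) (F n (Tot_single A n i x) k)"
      using x by (simp only: Tot_inv_def m e restrict_apply) (simp add: algebra_simps)
    show ?thesis
      using Fs True unfolding Tot_map_single[OF Tot_inv_closed x] inv
      by (simp add: sign_pow_sign_pow[OF B.module_axioms] Tot_gr_component sign_pow_def)
  next
    case False
    \<comment> \<open>Here \<open>F\<close> has to respect the filtration: \<open>Tot_map\<close>
      has no terms that raise the index by more than \<open>u\<close>, so \<open>F\<close> must have
      none either.\<close>
    have "Tot_single A n i x \<in> fil (Tot_mod A) i n" using s by (simp add: Tot_single_def)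
    then have "F n (Tot_single A n i x) \<in> fil (Tot_mod B) (i + u) (n + v - u)"
      by (rule fMod_homD(2)[OF F refl _ refl])
    then show ?thesis using False by (simp add: Tot_map_single[OF Tot_inv_closed x])
  qed
qed

end

lemma bij_betw_Tot_map:
  "bij_betw (Tot_map A B u v) (carrier (bg_hom R A B u v)) (carrier (fMod_hom R (Tot_mod A) (Tot_mod B) u v))"
  by (rule bij_betwI[where g = "Tot_inv A B u v"])
    (auto simp: Tot_map_hom Tot_inv_closed Tot_inv_Tot_map Tot_map_Tot_inv)

text \<open>Linearity in the map is easier for this direction, since \<open>Tot_inv\<close> only
  evaluates at single elements; \<open>lin_inverse\<close> then gives it for
  \<open>Tot_hom\<close>.\<close>

lemma Tot_inv_lin:
  "(\<lambda>F \<in> carrier (fMod_hom R (Tot_mod A) (Tot_mod B) u v). Tot_inv A B u v F)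
    \<in> lin R (fMod_hom R (Tot_mod A) (Tot_mod B) u v) (bg_hom R A B u v)"
proof -
  note M = bigraded_moduleD[OF bigraded_module_fMod_hom[OF R filtered_module_Tot_mod[OF R A] filtered_module_Tot_mod[OF R B]]]
  interpret M: module R "fMod_hom R (Tot_mod A) (Tot_mod B) u v" by (rule M)
  interpret H: module R "bg_hom R A B u v" by (rule bigraded_moduleD[OF bigraded_module_bg_hom[OF R A B]])
  have s: "Tot_single A (j - i) i x \<in> carrier (Tot_gr A (j - i))" if "x \<in> carrier (A i j)" for i j x
    using Tot_single_closed[OF R A, of x i "j - i"] that by simp
  have c: "F (j - i) (Tot_single A (j - i) i x) (i + (u - int m)) \<in> carrier (B (i + (u - int m)) (j + (v - int m)))"
    if "F \<in> carrier (fMod_hom R (Tot_mod A) (Tot_mod B) u v)" "x \<in> carrier (A i j)" for F m i j x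
    by (rule Tot_gr_component[OF lin_closed[OF fMod_homD(1)[OF that(1) refl], unfolded Tot_mod_simps, OF s[OF that(2)]]])
      simp
  have e: "j - i + v - u + (i + (u - int m)) = j + (v - int m)" for i j m by simp
  show ?thesis
  proof (rule lin_restrictI[OF M], goal_cases)
    case (1 F)
    then show ?case by (rule Tot_inv_closed)
  next
    case (2 F G)
    then show ?case
      by (intro bg_hom_ext[OF Tot_inv_closed H.a_closed] M.a_closed Tot_inv_closed)
        (simp_all only: Tot_inv_def bg_hom_simps fMod_hom_simps Tot_gr_simps Tot_mod_simps restrict_apply
          s c e if_True sign_pow_add[OF B.module_axioms])
  next
    case (3 r F)
    then show ?case
      by (intro bg_hom_ext[OF Tot_inv_closed H.smult_closed] M.smult_closed Tot_inv_closed)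
        (simp_all only: Tot_inv_def bg_hom_simps fMod_hom_simps Tot_gr_simps Tot_mod_simps restrict_apply
          s c e if_True sign_pow_smult[OF B.module_axioms])
  qed
qed

lemma Tot_hom_lin: "Tot_hom R A B u v \<in> lin R (bg_hom R A B u v) (fMod_hom R (Tot_mod A) (Tot_mod B) u v)"
  unfolding Tot_hom_def
  by (rule lin_inverse[OF _ _ Tot_inv_lin])
    (auto simp: Tot_map_hom Tot_inv_closed Tot_inv_Tot_map Tot_map_Tot_inv filtered_module_Tot_mod R A B
      intro!: bigraded_moduleD bigraded_module_bg_hom bigraded_module_fMod_hom)

end

text \<open>Injective linear maps \<open>T\<close> that respect composition and identities reflect
  every equational law of \<open>D\<close>. In particular bilinearity and associativity in
  \<open>C\<close> need no computation with the formula for \<open>c\<close>; its closure is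
  enough.\<close>

lemma presented_category_transport:
  fixes C :: "('o, 'r, 'h, 'y) bg_cat_scheme" and D :: "('p, 'r, 'k, 'z) bg_cat_scheme"
  assumes D: "presented_category R D c' e'"
    and ob: "\<And>X. X \<in> Ob C \<Longrightarrow> F X \<in> Ob D"
    and hom: "\<And>X Y. X \<in> Ob C \<Longrightarrow> Y \<in> Ob C \<Longrightarrow> bigraded_module R (Hom C X Y)"
    and T: "\<And>X Y p q. X \<in> Ob C \<Longrightarrow> Y \<in> Ob C \<Longrightarrow> T X Y p q \<in> lin R (Hom C X Y p q) (Hom D (F X) (F Y) p q)"
    and inj: "\<And>X Y p q. X \<in> Ob C \<Longrightarrow> Y \<in> Ob C \<Longrightarrow> inj_on (T X Y p q) (carrier (Hom C X Y p q))"
    and c: "\<And>X Y Z p q s t f g. X \<in> Ob C \<Longrightarrow> Y \<in> Ob C \<Longrightarrow> Z \<in> Ob C \<Longrightarrow>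
      f \<in> carrier (Hom C Y Z p q) \<Longrightarrow> g \<in> carrier (Hom C X Y s t) \<Longrightarrow>
      c X Y Z p q s t f g \<in> carrier (Hom C X Z (p + s) (q + t))"
    and Tc: "\<And>X Y Z p q s t f g. X \<in> Ob C \<Longrightarrow> Y \<in> Ob C \<Longrightarrow> Z \<in> Ob C \<Longrightarrow>
      f \<in> carrier (Hom C Y Z p q) \<Longrightarrow> g \<in> carrier (Hom C X Y s t) \<Longrightarrow>
      T X Z (p + s) (q + t) (c X Y Z p q s t f g) = c' (F X) (F Y) (F Z) p q s t (T Y Z p q f) (T X Y s t g)"
    and e: "\<And>X. X \<in> Ob C \<Longrightarrow> e X \<in> carrier (Hom C X X 0 0)"
    and Te: "\<And>X. X \<in> Ob C \<Longrightarrow> T X X 0 0 (e X) = e' (F X)"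
    and Comp: "\<And>X Y Z. X \<in> Ob C \<Longrightarrow> Y \<in> Ob C \<Longrightarrow> Z \<in> Ob C \<Longrightarrow>
      Comp C X Y Z = bg_lift R (Hom C Y Z) (Hom C X Y) (Hom C X Z) 0 0 (c X Y Z)"
    and Unit: "\<And>X. X \<in> Ob C \<Longrightarrow> Unit C X = bg_elem R (Hom C X X) (e X)"
  shows "presented_category R C c e"
proof -
  interpret D: presented_category R D c' e' by (rule D)
  have eqI: "f = g" if "X \<in> Ob C" "Y \<in> Ob C" "f \<in> carrier (Hom C X Y p q)" "g \<in> carrier (Hom C X Y p q)"
    "T X Y p q f = T X Y p q g" for X Y p q f g
    using inj_onD[OF inj[OF that(1,2)] that(5,3,4)] .
  note Tcl = lin_closed[OF T]
  show ?thesis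
  proof (rule presented_category.intro, goal_cases)
    case (3 X Y Z p q s t)
    note X = 3(1) and Y = 3(2) and Z = 3(3)
    interpret YZ: module R "Hom C Y Z p q" by (rule bigraded_moduleD[OF hom[OF Y Z]])
    interpret XY: module R "Hom C X Y s t" by (rule bigraded_moduleD[OF hom[OF X Y]])
    interpret XZ: module R "Hom C X Z (p + s) (q + t)" by (rule bigraded_moduleD[OF hom[OF X Z]])
    note b = bilinearD[OF D.c_bilinear[OF ob[OF X] ob[OF Y] ob[OF Z]]]
    note eqI' = eqI[OF X Z, of _ "p + s" "q + t"]
    show ?case
      by (rule bilinearI; (rule eqI')?)
        (simp_all add: c[OF X Y Z] Tc[OF X Y Z] b Tcl X Y Z lin_add[OF T[OF X Y]] lin_add[OF T[OF Y Z]]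
          lin_add[OF T[OF X Z]] lin_smult[OF T[OF X Y]] lin_smult[OF T[OF Y Z]] lin_smult[OF T[OF X Z]])
  next
    case (4 X Y Z W f p q g s t h k l)
    note X = 4(1) and Y = 4(2) and Z = 4(3) and W = 4(4) and f = 4(5) and g = 4(6) and h = 4(7)
    show ?case
    proof (rule eqI[OF X W c[OF X Y W c[OF Y Z W f g] h]])
      show "c X Z W p q (s + k) (t + l) f (c X Y Z s t k l g h) \<in> carrier (Hom C X W (p + s + k) (q + t + l))"
        using c[OF X Z W f c[OF X Y Z g h]] by (simp add: add.assoc)
      have "T X W (p + s + k) (q + t + l) (c X Z W p q (s + k) (t + l) f (c X Y Z s t k l g h)) =
          c' (F X) (F Z) (F W) p q (s + k) (t + l) (T Z W p q f)
            (c' (F X) (F Y) (F Z) s t k l (T Y Z s t g) (T X Y k l h))"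
        using Tc[OF X Z W f c[OF X Y Z g h]] Tc[OF X Y Z g h] by (simp add: add.assoc)
      then show "T X W (p + s + k) (q + t + l) (c X Y W (p + s) (q + t) k l (c Y Z W p q s t f g) h) =
          T X W (p + s + k) (q + t + l) (c X Z W p q (s + k) (t + l) f (c X Y Z s t k l g h))"
        using Tc[OF X Y W c[OF Y Z W f g] h] Tc[OF Y Z W f g]
          D.c_assoc[OF ob[OF X] ob[OF Y] ob[OF Z] ob[OF W] Tcl[OF Z W f] Tcl[OF Y Z g] Tcl[OF X Y h]]
        by simp
    qed
  next
    case (6 X Y f p q)
    then show ?case
      using c[OF 6(1,2,2) e[OF 6(2)] 6(3)] Tc[OF 6(1,2,2) e[OF 6(2)] 6(3)]
      by (intro eqI[OF 6(1,2)]) (simp_all add: Te D.c_left ob Tcl)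
  next
    case (7 X Y f p q)
    then show ?case
      using c[OF 7(1,1,2) 7(3) e[OF 7(1)]] Tc[OF 7(1,1,2) 7(3) e[OF 7(1)]]
      by (intro eqI[OF 7(1,2)]) (simp_all add: Te D.c_right ob Tcl)
  qed (simp_all add: D.R hom e Comp Unit)
qed

section \<open>Totalization and composition\<close>

context
  fixes R :: "'r ring" and A :: "('r, 'a) bgmod" and B :: "('r, 'b) bgmod" and C :: "('r, 'c) bgmod"
  assumes R: "cring R" and A: "bigraded_module R A" and B: "bigraded_module R B" and C: "bigraded_module R C"
begin

context
  fixes u v u' v' f g
  assumes f: "f \<in> carrier (bg_hom R B C u v)" and g: "g \<in> carrier (bg_hom R A B u' v')"
begin

interpretation A: module R "A i j" for i j by (rule bigraded_moduleD[OF A])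
interpretation B: module R "B i j" for i j by (rule bigraded_moduleD[OF B])
interpretation C: module R "C i j" for i j by (rule bigraded_moduleD[OF C])

text \<open>This computation explains the twisted composition. Start from \<open>x\<close> at index
  \<open>i\<close> and read component i + u + u' - m: the m steps are split into m - l steps by
  \<open>g\<close> and l steps by \<open>f\<close>, for each l up to m.\<close>

private lemma Tot_inv_comp:
  "Tot_inv A C (u + u') (v + v') (fMod_comp (Tot_mod A) (Tot_mod C) u v u' v'
      (Tot_map B C u v f) (Tot_map A B u' v' g)) = bg_hom_comp A C u v u' v' f g"
proof (intro ext)
  fix m i j x
  let ?h = "fMod_comp (Tot_mod A) (Tot_mod C) u v u' v' (Tot_map B C u v f) (Tot_map A B u' v' g)"
  show "Tot_inv A C (u + u') (v + v') ?h m i j x = bg_hom_comp A C u v u' v' f g m i j x"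
  proof (cases "x \<in> carrier (A i j)")
    case x: True
    define n where "n = j - i"
    define k where "k = i + (u + u' - int m)"
    define M where "M = C k (j + (v + v' - int m))"
    define s where "s = Tot_single A n i x"
    define b where "b = Tot_map A B u' v' g n s"
    have j: "n + i = j" by (simp add: n_def)
    have x': "x \<in> carrier (A i (n + i))" using x j by simp
    have s: "s \<in> carrier (Tot_gr A n)"
      unfolding s_def by (rule Tot_single_closed[OF R A x'])
    have b: "b \<in> carrier (Tot_gr B (n + v' - u'))"
      using lin_closed[OF fMod_homD(1)[OF Tot_map_hom[OF R A B g] refl]] s by (simp add: b_def)
    \<comment> \<open>This bound equals k - u + m, so the sum for the outer map stops exactly at
      m.\<close>
    have b0: "\<forall>l > i + u'. b l = \<zero>\<^bsub>B l (n + v' - u' + l)\<^esub>"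
      by (simp add: b_def s_def Tot_map_single[OF R A B g x'])
    have fb: "Tot_map B C u v f (n + v' - u') b \<in> carrier (Tot_gr C (n + (v + v') - (u + u')))"
      using lin_closed[OF fMod_homD(1)[OF Tot_map_hom[OF R B C f], of "n + (v + v') - (u + u')" "n + v' - u'"]] b
      by simp
    have M: "C k (n + v' - u' + v - u + k) = M" "C k (n + (v + v') - (u + u') + k) = M"
    proof -
      have "n + v' - u' + v - u + k = j + (v + v' - int m)" "n + (v + v') - (u + u') + k = j + (v + v' - int m)"
        by (auto simp: k_def n_def)
      then show "C k (n + v' - u' + v - u + k) = M" "C k (n + (v + v') - (u + u') + k) = M"
        by (simp_all only: M_def)
    qed
    \<comment> \<open>The two totalization signs: \<open>f\<close> acts in degree n + v' - u', and
      \<open>g\<close> acts in degree n.\<close>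
    define \<epsilon> where "\<epsilon> l = (int l + u) * (n + v' - u') + (int (m - l) + u') * n" for l
    define I where "I l = i + (u' - int (m - l))" for l
    define J where "J l = j + (v' - int (m - l))" for l
    define z where "z l = f l (I l) (J l) (g (m - l) i j x)" for l
    have gx: "g (m - l) i j x \<in> carrier (B (I l) (J l))" for l
      unfolding I_def J_def by (rule lin_closed[OF bg_homD[OF g refl refl] x])
    have fl: "f l (I l) (J l) \<in> lin R (B (I l) (J l)) M" if "l \<le> m" for l
      unfolding M_def k_def I_def J_def by (rule bg_homD[OF f]) (use that in auto)
    have z: "z l \<in> carrier M" if "l \<le> m" for l
      using lin_closed[OF fl[OF that] gx] by (simp add: z_def)
    have summand: "sign_pow M ((int l + u) * (n + v' - u')) (f l (k - u + int l) (n + v' - u' + (k - u + int l))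
          (b (k - u + int l))) =
        sign_pow M (\<epsilon> l) (z l)" if l: "l \<le> m" for l
    proof -
      have e: "k - u + int l = I l" "n + v' - u' + I l = J l" "i + u' - I l = int (m - l)"
        using l by (auto simp: k_def n_def I_def J_def)
      have I_le: "I l \<le> i + u'" by (simp add: I_def)
      have "b (I l) = sign_pow (B (I l) (J l)) ((int (m - l) + u') * n) (g (m - l) i j x)"
        unfolding b_def s_def Tot_map_single[OF R A B g x'] e(2,3) using I_le by (simp add: j)
      then show ?thesis
        using z[OF l] lin_sign_pow[OF B.module_axioms _ fl[OF l] gx]
        by (simp add: e z_def \<epsilon>_def M_def C.module_axioms sign_pow_sign_pow[OF C.module_axioms])
    qed
    \<comment> \<open>The exponent from \<open>Tot_inv\<close>, the one from composition of filtered
      maps and the two in \<open>\<epsilon>\<close> add up. The l n terms cancel, and all that is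
      left besides l (v' - u') occurs twice.\<close>
    have sg: "(int m + (u + u')) * n + (u * (v' - u') + (\<epsilon> l)) =
        int l * (v' - u') + 2 * ((int m + u + u') * n + u * (v' - u'))" if "l \<le> m" for l
      using that by (simp add: \<epsilon>_def algebra_simps of_nat_diff)
    have Mm: "module R M" by (simp add: M_def C.module_axioms)
    interpret M: module R M by (rule Mm)
    have "Tot_inv A C (u + u') (v + v') ?h m i j x = sign_pow M ((int m + (u + u')) * n) (?h n s k)"
      using x by (simp add: Tot_inv_def M_def k_def n_def s_def)
    also have "?h n s k = sign_pow M (u * (v' - u')) (Tot_map B C u v f (n + v' - u') b k)"
      using s Tot_sign_pow[OF R C fb, of "u * (v' - u')" k] by (simp add: fMod_comp_def M b_def)
    also have "Tot_map B C u v f (n + v' - u') b k = (\<Oplus>\<^bsub>M\<^esub> l \<in> {..m}.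
        sign_pow M ((int l + u) * (n + v' - u')) (f l (k - u + int l) (n + v' - u' + (k - u + int l))
          (b (k - u + int l))))"
      using Tot_map_atMost[OF R B C f b b0, of k m] unfolding M by (simp add: k_def)
    also have "\<dots> = (\<Oplus>\<^bsub>M\<^esub> l \<in> {..m}. sign_pow M (\<epsilon> l) (z l))"
      by (rule M.finsum_cong') (auto simp: summand z sign_pow_closed[OF Mm])
    also have "sign_pow M ((int m + (u + u')) * n) (sign_pow M (u * (v' - u')) \<dots>) =
        (\<Oplus>\<^bsub>M\<^esub> l \<in> {..m}. sign_pow M ((int m + (u + u')) * n) (sign_pow M (u * (v' - u'))
          (sign_pow M (\<epsilon> l) (z l))))"
      by (subst sign_pow_finsum[OF Mm], use z in \<open>force intro: sign_pow_closed[OF Mm]\<close>)+ (rule refl)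
    also have "\<dots> = (\<Oplus>\<^bsub>M\<^esub> l \<in> {..m}. sign_pow M (int l * (v' - u')) (z l))"
    proof (rule M.finsum_cong'[OF refl])
      fix l assume "l \<in> {..m}"
      then have l: "l \<le> m" by simp
      show "sign_pow M ((int m + (u + u')) * n) (sign_pow M (u * (v' - u'))
          (sign_pow M (\<epsilon> l) (z l))) =
        sign_pow M (int l * (v' - u')) (z l)"
        unfolding sign_pow_sign_pow[OF Mm z[OF l]] sign_pow_sign_pow[OF Mm sign_pow_closed[OF Mm z[OF l]]] sg[OF l]
        by (rule sign_pow_cong) simp
    qed (auto simp: z sign_pow_closed[OF Mm])
    also have "\<dots> = bg_hom_comp A C u v u' v' f g m i j x"
      using x by (simp add: bg_hom_comp_def M_def k_def z_def I_def J_def Let_def)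
    finally show ?thesis .
  next
    case False
    then show ?thesis by (simp add: Tot_inv_def bg_hom_comp_def)
  qed
qed

private lemma comp_hom: "fMod_comp (Tot_mod A) (Tot_mod C) u v u' v' (Tot_map B C u v f) (Tot_map A B u' v' g)
    \<in> carrier (fMod_hom R (Tot_mod A) (Tot_mod C) (u + u') (v + v'))"
  by (rule fMod_comp_closed[OF R filtered_module_Tot_mod[OF R A] filtered_module_Tot_mod[OF R B]
        filtered_module_Tot_mod[OF R C] Tot_map_hom[OF R B C f] Tot_map_hom[OF R A B g]])

text \<open>The composite is the sequence extracted from a filtered map, so it lies in the
  hom-object without inspection of its defining sum.\<close>

lemma bg_hom_comp_closed: "bg_hom_comp A C u v u' v' f g \<in> carrier (bg_hom R A C (u + u') (v + v'))"
  using Tot_inv_closed[OF R A C comp_hom] by (simp add: Tot_inv_comp)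

lemma Tot_map_bg_hom_comp:
  "Tot_map A C (u + u') (v + v') (bg_hom_comp A C u v u' v' f g) =
    fMod_comp (Tot_mod A) (Tot_mod C) u v u' v' (Tot_map B C u v f) (Tot_map A B u' v' g)"
  using Tot_map_Tot_inv[OF R A C comp_hom] by (simp add: Tot_inv_comp)

end

end

context
  fixes R :: "'r ring" and A :: "('r, 'a) bgmod"
  assumes R: "cring R" and A: "bigraded_module R A"
begin

lemma bg_hom_id_closed: "bg_hom_id A \<in> carrier (bg_hom R A A 0 0)"
  using A by (auto simp: bg_hom_carrier bg_hom_id_def bg_zero_maps)

lemma Tot_map_bg_hom_id: "Tot_map A A 0 0 (bg_hom_id A) = fMod_id (Tot_mod A)"
proof (rule Tot_hom_ext[OF R A A Tot_map_hom[OF R A A bg_hom_id_closed]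
      fMod_id_closed[OF filtered_module_Tot_mod[OF R A]]])
  interpret A: module R "A i j" for i j by (rule bigraded_moduleD[OF A])
  fix n i x assume x: "x \<in> carrier (A i (n + i))"
  show "Tot_map A A 0 0 (bg_hom_id A) n (Tot_single A n i x) = fMod_id (Tot_mod A) n (Tot_single A n i x)"
  proof
    fix k
    have "k < i \<Longrightarrow> A (i + (k - i)) (n + i + (k - i)) = A k (n + k)" by simp
    then show "Tot_map A A 0 0 (bg_hom_id A) n (Tot_single A n i x) k =
        fMod_id (Tot_mod A) n (Tot_single A n i x) k"
      unfolding Tot_map_single[OF R A A bg_hom_id_closed x]
      using x Tot_single_closed[OF R A x]
      by (auto simp: fMod_id_def Tot_single_def bg_hom_id_def bg_id_def bg_zero_def sign_pow_zero[OF A.module_axioms])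
  qed
qed

end

lemma Tot_hom_apply: "f \<in> carrier (bg_hom R A B u v) \<Longrightarrow> Tot_hom R A B u v f = Tot_map A B u v f"
  by (simp add: Tot_hom_def)

lemma bij_betw_Tot_hom:
  assumes "cring R" "bigraded_module R A" "bigraded_module R B"
  shows "bij_betw (Tot_hom R A B u v) (carrier (bg_hom R A B u v))
    (carrier (fMod_hom R (Tot_mod A) (Tot_mod B) u v))"
  using bij_betw_Tot_map[OF assms] by (subst bij_betw_cong[OF Tot_hom_apply])

lemma Tot_hom_maps:
  assumes "cring R" "bigraded_module R A" "bigraded_module R B"
  shows "Tot_hom R A B \<in> bg_maps R (bg_hom R A B) (fMod_hom R (Tot_mod A) (Tot_mod B)) 0 0"
  using Tot_hom_lin[OF assms] by (simp add: bg_maps_def)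

lemma Tot_hom_comp:
  assumes "cring R" "bigraded_module R A" "bigraded_module R B" "bigraded_module R C"
    and "f \<in> carrier (bg_hom R B C u v)" "g \<in> carrier (bg_hom R A B u' v')"
  shows "Tot_hom R A C (u + u') (v + v') (bg_hom_comp A C u v u' v' f g) =
    fMod_comp (Tot_mod A) (Tot_mod C) u v u' v' (Tot_hom R B C u v f) (Tot_hom R A B u' v' g)"
  using Tot_map_bg_hom_comp[OF assms] bg_hom_comp_closed[OF assms] assms(5,6) by (simp add: Tot_hom_apply)

lemma Tot_hom_id:
  assumes "cring R" "bigraded_module R A"
  shows "Tot_hom R A A 0 0 (bg_hom_id A) = fMod_id (Tot_mod A)"
  using Tot_map_bg_hom_id[OF assms] bg_hom_id_closed[OF assms] by (simp add: Tot_hom_apply)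

section \<open>The enriched categories of bigraded modules and of twisted complexes\<close>

lemma presented_bgMod:
  assumes R: "cring R"
  shows "presented_category R (bgMod_cat R) (\<lambda>A B C. bg_hom_comp A C) bg_hom_id"
  by (rule presented_category_transport[OF presented_fMod[OF R], where F = Tot_mod and T = "Tot_hom R"])
    (auto simp: bgMod_cat_def fMod_def R filtered_module_Tot_mod bigraded_module_bg_hom Tot_hom_lin
      bij_betw_imp_inj_on[OF bij_betw_Tot_hom] bg_hom_comp_closed[OF R] Tot_hom_comp bg_hom_id_closed Tot_hom_id)

text \<open>For the right factor d of bidegree (0, 1) the composition sign k (v' - u') is k, so the
  relations of a twisted complex are the components of c(d, d) = 0.\<close>

lemma twisted_complex_iff:
  "twisted_complex R T \<longleftrightarrow> bigraded_module R (tmod T) \<and>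
    tdiff T \<in> carrier (bg_hom R (tmod T) (tmod T) 0 1) \<and>
    bg_hom_comp (tmod T) (tmod T) 0 1 0 1 (tdiff T) (tdiff T) = \<zero>\<^bsub>bg_hom R (tmod T) (tmod T) 0 2\<^esub>"
proof -
  define A where "A = tmod T"
  define d where "d = tdiff T"
  have e1: "0 - int m = - int m" "1 - int m = - int m + 1" for m by auto
  have e: "p + (0 - int m) = p - int m"
    "q + (1 - int m) = q - int m + 1" "p + (0 + 0 - int m) = p - int m" "q + (1 + 1 - int m) = q - int m + 2"
    "p + (0 - int m) = p - int m" "q + (2 - int m) = q - int m + 2" for p q :: int and m
    by auto
  have "bg_hom_comp A A 0 1 0 1 d d = \<zero>\<^bsub>bg_hom R A A 0 2\<^esub> \<longleftrightarrow>
    (\<forall>m p q x. bg_hom_comp A A 0 1 0 1 d d m p q x = \<zero>\<^bsub>bg_hom R A A 0 2\<^esub> m p q x)"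
    by (simp add: fun_eq_iff)
  also have "\<dots> \<longleftrightarrow> (\<forall>m p q. \<forall>x \<in> carrier (A p q). (let M = A (p - int m) (q - int m + 2) in
        (\<Oplus>\<^bsub>M\<^esub> i \<in> {..m}. sign_pow M (int i)
           (d i (p - int (m - i)) (q - int (m - i) + 1) (d (m - i) p q x))) = \<zero>\<^bsub>M\<^esub>))"
    unfolding bg_hom_comp_def bg_hom_simps bg_zero_def e Let_def by auto
  finally show ?thesis
    unfolding twisted_complex_def Let_def A_def[symmetric] d_def[symmetric] bg_hom_carrier e1 by blast
qed

lemma presented_tC:
  assumes R: "cring R"
  shows "presented_dg_category R (tC R) (\<lambda>S T V. bg_hom_comp (tmod S) (tmod V)) (\<lambda>T. bg_hom_id (tmod T)) tdiff"
proof (rule presented_dg_category.intro)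
  show "presented_category R (tC R) (\<lambda>S T V. bg_hom_comp (tmod S) (tmod V)) (\<lambda>T. bg_hom_id (tmod T))"
    by (rule presented_category.pullback[OF presented_bgMod[OF R], where U = tmod])
      (auto simp: tC_def bgMod_cat_def twisted_complex_iff)
  show "presented_dg_category_axioms (tC R) (\<lambda>S T V. bg_hom_comp (tmod S) (tmod V)) tdiff"
    by (rule presented_dg_category_axioms.intro)
      (auto simp: tC_def bgMod_cat_def twisted_complex_iff tC_diff_def Let_def)
qed

text \<open>For (u, v) = (0, 1) the sign exponent (m + u) n is the m n of the differential.\<close>

lemma Tot_diff_eq: "Tot_diff T = Tot_map (tmod T) (tmod T) 0 1 (tdiff T)"
  by (intro ext) (simp add: Tot_diff_def Tot_map_def Let_def restrict_def)

lemma filtered_complex_iff: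
  "filtered_complex R X \<longleftrightarrow> filtered_module R (fmod X) \<and>
    fdiff X \<in> carrier (fMod_hom R (fmod X) (fmod X) 0 1) \<and>
    fMod_comp (fmod X) (fmod X) 0 1 0 1 (fdiff X) (fdiff X) = \<zero>\<^bsub>fMod_hom R (fmod X) (fmod X) 0 2\<^esub>"
proof -
  have "fMod_comp (fmod X) (fmod X) 0 1 0 1 (fdiff X) (fdiff X) = \<zero>\<^bsub>fMod_hom R (fmod X) (fmod X) 0 2\<^esub> \<longleftrightarrow>
    (\<forall>m x. fMod_comp (fmod X) (fmod X) 0 1 0 1 (fdiff X) (fdiff X) m x =
      \<zero>\<^bsub>fMod_hom R (fmod X) (fmod X) 0 2\<^esub> m x)"
    by (simp add: fun_eq_iff)
  also have "\<dots> \<longleftrightarrow> (\<forall>m. \<forall>x \<in> carrier (fgr (fmod X) m). fdiff X (m + 1) (fdiff X m x) = \<zero>\<^bsub>fgr (fmod X) (m + 1 + 1)\<^esub>)"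
    by (auto simp: fMod_comp_def fMod_hom_simps add.assoc)
  finally show ?thesis
    unfolding filtered_complex_def Let_def by (simp add: fMod_hom_def conj_ac)
qed

lemma Tot_hom_zero:
  assumes "cring R" "bigraded_module R A" "bigraded_module R B"
  shows "Tot_hom R A B u v \<zero>\<^bsub>bg_hom R A B u v\<^esub> = \<zero>\<^bsub>fMod_hom R (Tot_mod A) (Tot_mod B) u v\<^esub>"
  using assms
  by (intro lin_zero[OF _ _ Tot_hom_lin])
    (auto intro!: bigraded_moduleD bigraded_module_bg_hom bigraded_module_fMod_hom filtered_module_Tot_mod)

lemma Tot_diff_hom:
  "twisted_complex R T \<Longrightarrow> Tot_diff T = Tot_hom R (tmod T) (tmod T) 0 1 (tdiff T)"
  by (simp add: Tot_diff_eq Tot_hom_apply twisted_complex_iff)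

text \<open>Totalization is injective and respects composition and zero, so c(d, d) vanishes if and
  only if c(Tot d, Tot d) does. The direction towards twisted complexes is what makes the inverse on
  objects possible.\<close>

lemma filtered_complex_Tot_complex:
  assumes R: "cring R" and A: "bigraded_module R (tmod T)"
    and d: "tdiff T \<in> carrier (bg_hom R (tmod T) (tmod T) 0 1)"
  shows "filtered_complex R (Tot_complex T) \<longleftrightarrow> twisted_complex R T"
proof -
  let ?A = "tmod T" and ?d = "tdiff T"
  have c: "bg_hom_comp ?A ?A 0 1 0 1 ?d ?d \<in> carrier (bg_hom R ?A ?A 0 2)"
    using bg_hom_comp_closed[OF R A A A d d] by simp
  interpret H: module R "bg_hom R ?A ?A 0 2" by (rule bigraded_moduleD[OF bigraded_module_bg_hom[OF R A A]])
  have "twisted_complex R T \<longleftrightarrow> Tot_hom R ?A ?A 0 2 (bg_hom_comp ?A ?A 0 1 0 1 ?d ?d) =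
      Tot_hom R ?A ?A 0 2 \<zero>\<^bsub>bg_hom R ?A ?A 0 2\<^esub>"
    using inj_on_eq_iff[OF bij_betw_imp_inj_on[OF bij_betw_Tot_hom[OF R A A]] c H.zero_closed]
    by (simp add: twisted_complex_iff A d)
  also have "\<dots> \<longleftrightarrow> fMod_comp (Tot_mod ?A) (Tot_mod ?A) 0 1 0 1 (Tot_diff T) (Tot_diff T) =
      \<zero>\<^bsub>fMod_hom R (Tot_mod ?A) (Tot_mod ?A) 0 2\<^esub>"
    using Tot_hom_comp[OF R A A A d d] by (simp add: Tot_hom_zero[OF R A A] Tot_hom_apply[OF d] Tot_diff_eq)
  also have "\<dots> \<longleftrightarrow> filtered_complex R (Tot_complex T)"
    using Tot_map_hom[OF R A A d]
    by (simp add: filtered_complex_iff Tot_complex_def filtered_module_Tot_mod[OF R A] Tot_diff_eq)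
  finally show ?thesis by simp
qed

section \<open>Split filtered modules and complexes\<close>

lemma presented_sfMod:
  assumes R: "cring R"
  shows "presented_category R (sfMod R) (\<lambda>X Y Z. fMod_comp (fst X) (fst Z)) (\<lambda>X. fMod_id (fst X))"
  by (rule presented_category.pullback[OF presented_fMod[OF R], where U = fst])
    (auto simp: sfMod_def bg_full_on_def fMod_def)

lemma presented_sfC:
  assumes R: "cring R"
  shows "presented_dg_category R (sfC R) (\<lambda>X Y Z. fMod_comp (fmod (fst X)) (fmod (fst Z)))
    (\<lambda>X. fMod_id (fmod (fst X))) (\<lambda>X. fdiff (fst X))"
proof -
  interpret F: presented_dg_category R "fC R" "\<lambda>X Y Z. fMod_comp (fmod X) (fmod Z)" "\<lambda>X. fMod_id (fmod X)" fdiff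
    by (rule presented_fC[OF R])
  have ob: "X \<in> Ob (sfC R) \<Longrightarrow> fst X \<in> Ob (fC R)" for X
    by (auto simp: sfC_def vb_full_on_def fC_def)
  show ?thesis
  proof (rule presented_dg_category.intro)
    show "presented_category R (sfC R) (\<lambda>X Y Z. fMod_comp (fmod (fst X)) (fmod (fst Z))) (\<lambda>X. fMod_id (fmod (fst X)))"
      by (rule F.pullback[where U = fst]) (auto simp: ob, auto simp: sfC_def vb_full_on_def)
    show "presented_dg_category_axioms (sfC R) (\<lambda>X Y Z. fMod_comp (fmod (fst X)) (fmod (fst Z))) (\<lambda>X. fdiff (fst X))"
      using F.d_closed[OF ob] F.d_d[OF ob] F.HDiff_eq[OF ob ob] F.HDiff_extensional[OF ob ob]
      by (intro presented_dg_category_axioms.intro) (simp_all add: sfC_def vb_full_on_def)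
  qed
qed

lemma Ob_bgMod: "A \<in> Ob (bgMod_cat R) \<longleftrightarrow> bigraded_module R A"
  and Ob_tC: "T \<in> Ob (tC R) \<longleftrightarrow> twisted_complex R T"
  and Ob_fMod: "K \<in> Ob (fMod R) \<longleftrightarrow> filtered_module R K"
  and Ob_fC: "X \<in> Ob (fC R) \<longleftrightarrow> filtered_complex R X"
  and Ob_sfMod: "P \<in> Ob (sfMod R) \<longleftrightarrow>
    filtered_module R (fst P) \<and> bigraded_module R (snd P) \<and> fst P = Tot_mod (snd P)"
  and Ob_sfC: "Q \<in> Ob (sfC R) \<longleftrightarrow>
    filtered_complex R (fst Q) \<and> bigraded_module R (snd Q) \<and> fmod (fst Q) = Tot_mod (snd Q)"
  by (auto simp: bgMod_cat_def tC_def fMod_def fC_def sfMod_def sfC_def bg_full_on_def vb_full_on_def)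

lemma Hom_simps:
  "Hom (bgMod_cat R) A B = bg_hom R A B"
  "Hom (tC R) S T = bg_hom R (tmod S) (tmod T)"
  "Hom (fMod R) K L = fMod_hom R K L"
  "Hom (fC R) X Y = fMod_hom R (fmod X) (fmod Y)"
  "Hom (sfMod R) P P' = fMod_hom R (fst P) (fst P')"
  "Hom (sfC R) Q Q' = fMod_hom R (fmod (fst Q)) (fmod (fst Q'))"
  by (auto simp: bgMod_cat_def tC_def fMod_def fC_def sfMod_def sfC_def bg_full_on_def vb_full_on_def)

lemma Tot_functor_simps:
  "FOb (Tot_bgMod R) A = Tot_mod A" "FHom (Tot_bgMod R) A B = Tot_hom R A B"
  "FOb (Tot_tC R) T = Tot_complex T" "FHom (Tot_tC R) S T = Tot_hom R (tmod S) (tmod T)"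
  "FOb (corestrict F s) X = (FOb F X, s X)" "FHom (corestrict F s) X Y = FHom F X Y"
  "fmod (Tot_complex T) = Tot_mod (tmod T)" "fdiff (Tot_complex T) = Tot_diff T"
  by (simp_all add: Tot_bgMod_def Tot_tC_def corestrict_def Tot_complex_def)

lemma twisted_complexD:
  assumes "twisted_complex R T"
  shows "bigraded_module R (tmod T)"
    and "tdiff T \<in> carrier (bg_hom R (tmod T) (tmod T) 0 1)"
  using assms by (auto simp: twisted_complex_iff)

lemma tdiff_tC_of_bgmod: "tdiff (tC_of_bgmod A) = \<zero>\<^bsub>bg_hom R A A 0 1\<^esub>"
  by (simp add: tC_of_bgmod_def bg_hom_simps fun_eq_iff bg_zero_def)

lemma tmod_tC_of_bgmod: "tmod (tC_of_bgmod A) = A"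
  by (simp add: tC_of_bgmod_def)

lemma fdiff_fC_of_fmodule: "fdiff (fC_of_fmodule K) = \<zero>\<^bsub>fMod_hom R K K 0 1\<^esub>"
  by (simp add: fC_of_fmodule_def fMod_hom_simps)

lemma fmod_fC_of_fmodule: "fmod (fC_of_fmodule K) = K"
  by (simp add: fC_of_fmodule_def)

definition Tot_complex_inv :: "('r, int \<Rightarrow> 'a) fcomplex \<times> ('r, 'a) bgmod \<Rightarrow> ('r, 'a) tcomplex" where
  "Tot_complex_inv P = \<lparr>tmod = snd P, tdiff = Tot_inv (snd P) (snd P) 0 1 (fdiff (fst P))\<rparr>"

context
  fixes R :: "'r ring"
  assumes R: "cring R"
begin

lemma filtered_complex_Tot: "twisted_complex R T \<Longrightarrow> filtered_complex R (Tot_complex T)"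
  using filtered_complex_Tot_complex[OF R] by (auto dest: twisted_complexD)

text \<open>The differential of a split filtered complex is a filtered map of bidegree (0, 1)
  between totalizations, hence the totalization of the sequence extracted by \<open>Tot_inv\<close>;
  that its square vanishes makes this sequence a twisted structure.\<close>

lemma Tot_complex_Tot_complex_inv:
  fixes P :: "('r, int \<Rightarrow> 'a) fcomplex \<times> ('r, 'a) bgmod"
  assumes P: "P \<in> Ob (sfC R)"
  shows "Tot_complex (Tot_complex_inv P) = fst P" and "Tot_complex_inv P \<in> Ob (tC R)"
proof -
  obtain K A where KA: "P = (K, A)" by fastforce
  have K: "filtered_complex R K" and A: "bigraded_module R A" and fK: "fmod K = Tot_mod A"
    using P by (auto simp: Ob_sfC KA)
  have dK: "fdiff K \<in> carrier (fMod_hom R (Tot_mod A) (Tot_mod A) 0 1)"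
    using filtered_complexD(2)[OF K] by (simp add: fK)
  note closed = Tot_inv_closed[OF R A A dK]
  show eq: "Tot_complex (Tot_complex_inv P) = fst P"
    using Tot_map_Tot_inv[OF R A A dK]
    by (simp add: Tot_complex_def Tot_diff_eq Tot_complex_inv_def KA fK[symmetric])
  show "Tot_complex_inv P \<in> Ob (tC R)"
    using filtered_complex_Tot_complex[OF R, of "Tot_complex_inv P"] A closed K
    by (simp add: Ob_tC eq) (simp add: Tot_complex_inv_def KA)
qed

lemma Tot_complex_inv_Tot_complex:
  assumes "twisted_complex R T"
  shows "Tot_complex_inv (Tot_complex T, tmod T) = T"
  using Tot_inv_Tot_map[OF R twisted_complexD(1)[OF assms] twisted_complexD(1)[OF assms] twisted_complexD(2)[OF assms]]
  by (simp add: Tot_complex_inv_def Tot_complex_def Tot_diff_eq)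

lemmas Tot_hom_comp_tC = Tot_hom_comp[OF R twisted_complexD(1) twisted_complexD(1) twisted_complexD(1)]

lemma presented_functor_Tot_tC:
  "presented_functor R (tC R) (\<lambda>S T V. bg_hom_comp (tmod S) (tmod V)) (\<lambda>T. bg_hom_id (tmod T))
    (fC R) (\<lambda>X Y Z. fMod_comp (fmod X) (fmod Z)) (\<lambda>X. fMod_id (fmod X)) (Tot_tC R)"
  using presented_tC[OF R] presented_fC[OF R]
  by (intro presented_functor.intro presented_functor_axioms.intro)
    (auto simp: presented_dg_category_def Ob_tC Ob_fC Hom_simps Tot_functor_simps filtered_complex_Tot
      Tot_hom_maps R Tot_hom_id twisted_complexD intro: Tot_hom_comp_tC)

lemma vb_functor_Tot_tC: "vb_functor R (tC R) (fC R) (Tot_tC R)"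
  by (rule vb_functorI[OF presented_tC[OF R] presented_fC[OF R] presented_functor_Tot_tC])
    (simp add: Ob_tC Tot_functor_simps Tot_diff_hom)

lemma presented_isomorphism_Tot_tC:
  "presented_isomorphism R (tC R) (\<lambda>S T V. bg_hom_comp (tmod S) (tmod V)) (\<lambda>T. bg_hom_id (tmod T))
    (sfC R) (\<lambda>X Y Z. fMod_comp (fmod (fst X)) (fmod (fst Z))) (\<lambda>X. fMod_id (fmod (fst X)))
    (corestrict (Tot_tC R) tmod) (Tot_complex_inv :: _ \<Rightarrow> ('r, 'a) tcomplex)"
  using presented_tC[OF R] presented_sfC[OF R]
proof (intro presented_isomorphism.intro presented_functor.intro presented_functor_axioms.intro
    presented_isomorphism_axioms.intro)
  fix P :: "('r, int \<Rightarrow> 'a) fcomplex \<times> ('r, 'a) bgmod"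
  assume P: "P \<in> Ob (sfC R)"
  show "Tot_complex_inv P \<in> Ob (tC R)" by (rule Tot_complex_Tot_complex_inv(2)[OF P])
  show "FOb (corestrict (Tot_tC R) tmod) (Tot_complex_inv P) = P"
    by (simp add: Tot_functor_simps Tot_complex_Tot_complex_inv(1)[OF P]) (simp add: Tot_complex_inv_def)
qed (auto simp: presented_dg_category_def Ob_tC Ob_sfC Hom_simps Tot_functor_simps filtered_complex_Tot
    Tot_hom_maps R Tot_hom_id twisted_complexD Tot_complex_inv_Tot_complex bij_betw_Tot_hom
    intro: Tot_hom_comp_tC)

lemma vb_isomorphism_Tot: "vb_isomorphism R (tC R) (sfC R) (corestrict (Tot_tC R) tmod)"
  by (rule vb_isomorphismI[OF presented_tC[OF R] presented_sfC[OF R] presented_isomorphism_Tot_tC])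
    (simp add: Ob_tC Tot_functor_simps Tot_diff_hom)

text \<open>The isomorphism is onto the split objects, and \<open>fst\<close> forgets the bigraded
  module that belongs to their data.\<close>

lemma image_Tot_tC:
  "FOb (Tot_tC R) ` Ob (tC R :: (('r, 'a) tcomplex, 'r, ('a, 'a) bgseq) vb_cat) = fst ` Ob (sfC R)"
  unfolding presented_isomorphism.FOb_image[OF presented_isomorphism_Tot_tC, symmetric]
  by (simp add: image_image Tot_functor_simps)

lemma bg_functor_Tot_bgMod: "bg_functor R (bgMod_cat R) (fMod R) (Tot_bgMod R)"
  by (rule presented_functor.bg_functor[OF presented_functor.intro[OF presented_bgMod[OF R] presented_fMod[OF R]]],
      rule presented_functor_axioms.intro)
    (auto simp: Ob_bgMod Ob_fMod Hom_simps Tot_functor_simps R filtered_module_Tot_mod Tot_hom_maps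
      Tot_hom_comp Tot_hom_id)

lemma presented_isomorphism_Tot_bgMod:
  "presented_isomorphism R (bgMod_cat R) (\<lambda>A B C. bg_hom_comp A C) bg_hom_id
    (sfMod R) (\<lambda>X Y Z. fMod_comp (fst X) (fst Z)) (\<lambda>X. fMod_id (fst X)) (corestrict (Tot_bgMod R) id) snd"
  by (rule presented_isomorphism.intro[OF presented_functor.intro[OF presented_bgMod[OF R] presented_sfMod[OF R]]];
      intro presented_functor_axioms.intro presented_isomorphism_axioms.intro)
    (auto simp: Ob_bgMod Ob_sfMod Hom_simps Tot_functor_simps R filtered_module_Tot_mod Tot_hom_maps
      Tot_hom_comp Tot_hom_id bij_betw_Tot_hom)

lemmas bg_isomorphism_Tot = presented_isomorphism.bg_isomorphism[OF presented_isomorphism_Tot_bgMod]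

lemma image_Tot_bgMod:
  "FOb (Tot_bgMod R) ` Ob (bgMod_cat R :: (('r, 'a) bgmod, 'r, ('a, 'a) bgseq) bg_cat) = fst ` Ob (sfMod R)"
  unfolding presented_isomorphism.FOb_image[OF presented_isomorphism_Tot_bgMod, symmetric]
  by (simp add: image_image Tot_functor_simps)

section \<open>Modules as complexes with zero differential\<close>

text \<open>The relation c(0, 0) = 0 is bilinearity of composition.\<close>

lemma twisted_complex_tC_of_bgmod:
  fixes A :: "('r, 'a) bgmod"
  assumes A: "bigraded_module R A"
  shows "twisted_complex R (tC_of_bgmod A)"
proof -
  interpret P: presented_category R "bgMod_cat R :: (('r, 'a) bgmod, 'r, ('a, 'a) bgseq) bg_cat"
    "\<lambda>A B C. bg_hom_comp A C" bg_hom_id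
    by (rule presented_bgMod[OF R])
  have ob: "A \<in> Ob (bgMod_cat R)" using A by (simp add: Ob_bgMod)
  note H = bigraded_moduleD[OF bigraded_module_bg_hom[OF R A A]]
  interpret H: module R "bg_hom R A A 0 1" by (rule H)
  show ?thesis
    using bilinear_zero_left[OF H H P.c_bilinear[OF ob ob ob, unfolded Hom_simps], of _ 0 1 0 1]
    by (simp add: twisted_complex_iff tmod_tC_of_bgmod tdiff_tC_of_bgmod[where R = R] A)
qed

lemma HDiff_tC_of_bgmod:
  fixes A B :: "('r, 'a) bgmod"
  assumes "bigraded_module R A" "bigraded_module R B"
  shows "HDiff (tC R) (tC_of_bgmod A) (tC_of_bgmod B) = bg_zero (bg_hom R A B) (bg_hom R A B) 0 1"
  using presented_dg_category.HDiff_zero[OF presented_tC[OF R], of "tC_of_bgmod A" "tC_of_bgmod B"] assms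
  by (simp add: Ob_tC twisted_complex_tC_of_bgmod Hom_simps tmod_tC_of_bgmod tdiff_tC_of_bgmod[where R = R])

lemma full_zero_embedding_bgMod:
  "full_zero_embedding (bgMod_cat R :: (('r, 'a) bgmod, 'r, ('a, 'a) bgseq) bg_cat) (tC R) tC_of_bgmod"
  unfolding full_zero_embedding_def
proof (intro conjI ballI)
  show "inj_on tC_of_bgmod (Ob (bgMod_cat R :: (('r, 'a) bgmod, 'r, ('a, 'a) bgseq) bg_cat))"
    by (rule inj_on_inverseI[where g = tmod]) (rule tmod_tC_of_bgmod)
qed (auto simp: HDiff_tC_of_bgmod Ob_bgMod Ob_tC twisted_complex_tC_of_bgmod Hom_simps tmod_tC_of_bgmod,
    simp_all add: tC_def bgMod_cat_def tmod_tC_of_bgmod)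

lemma filtered_complex_fC_of_fmodule:
  assumes K: "filtered_module R K"
  shows "filtered_complex R (fC_of_fmodule K)"
proof -
  note Km = filtered_moduleD(1)[OF K]
  interpret K: module R "fgr K n" for n by (rule Km)
  show ?thesis
    by (auto simp: filtered_complex_iff fmod_fC_of_fmodule fdiff_fC_of_fmodule[where R = R] K fMod_hom_closed[OF R K K])
      (auto simp: fMod_comp_def fMod_hom_simps add.assoc fun_eq_iff)
qed

lemma HDiff_fC_of_fmodule:
  fixes K L :: "('r, 'k) fmodule"
  assumes "filtered_module R K" "filtered_module R L"
  shows "HDiff (fC R) (fC_of_fmodule K) (fC_of_fmodule L) = bg_zero (fMod_hom R K L) (fMod_hom R K L) 0 1"
  using presented_dg_category.HDiff_zero[OF presented_fC[OF R], of "fC_of_fmodule K" "fC_of_fmodule L"] assms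
  by (simp add: Ob_fC filtered_complex_fC_of_fmodule Hom_simps fmod_fC_of_fmodule fdiff_fC_of_fmodule[where R = R])

lemma full_zero_embedding_fMod:
  "full_zero_embedding (fMod R :: (('r, 'k) fmodule, 'r, int \<Rightarrow> 'k \<Rightarrow> 'k) bg_cat) (fC R) fC_of_fmodule"
  unfolding full_zero_embedding_def
proof (intro conjI ballI)
  show "inj_on fC_of_fmodule (Ob (fMod R :: (('r, 'k) fmodule, 'r, int \<Rightarrow> 'k \<Rightarrow> 'k) bg_cat))"
    by (rule inj_on_inverseI[where g = fmod]) (rule fmod_fC_of_fmodule)
qed (auto simp: HDiff_fC_of_fmodule Ob_fMod Ob_fC filtered_complex_fC_of_fmodule Hom_simps fmod_fC_of_fmodule,
    simp_all add: fC_def fMod_def fmod_fC_of_fmodule)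

text \<open>Totalization is linear on hom-objects, so zero structure maps give the zero
  differential. Hence the functor on complexes restricts to the one on modules.\<close>

lemma Tot_complex_tC_of_bgmod:
  fixes A :: "('r, 'a) bgmod"
  assumes A: "bigraded_module R A"
  shows "Tot_complex (tC_of_bgmod A) = fC_of_fmodule (Tot_mod A)"
proof -
  have "Tot_diff (tC_of_bgmod A) = fdiff (fC_of_fmodule (Tot_mod A))"
    using Tot_hom_zero[OF R A A, of 0 1]
    by (simp add: Tot_diff_hom[OF twisted_complex_tC_of_bgmod[OF A]] tmod_tC_of_bgmod
        tdiff_tC_of_bgmod[where R = R] fdiff_fC_of_fmodule[where R = R])
  then show ?thesis
    by (simp add: Tot_complex_def tmod_tC_of_bgmod) (simp add: fC_of_fmodule_def)
qed

end

theorem theorem4p39: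
  fixes R :: "'r ring"
  assumes "cring R"
  shows
    "let TC = tC R :: (('r, 'a) tcomplex, 'r, ('a, 'a) bgseq) vb_cat;
         FC = fC R :: (('r, int \<Rightarrow> 'a) fcomplex, 'r, int \<Rightarrow> (int \<Rightarrow> 'a) \<Rightarrow> (int \<Rightarrow> 'a)) vb_cat;
         BM = bgMod_cat R :: (('r, 'a) bgmod, 'r, ('a, 'a) bgseq) bg_cat;
         FM = fMod R :: (('r, int \<Rightarrow> 'a) fmodule, 'r, int \<Rightarrow> (int \<Rightarrow> 'a) \<Rightarrow> (int \<Rightarrow> 'a)) bg_cat
     in
       vb_functor R TC FC (Tot_tC R) \<and>
       vb_isomorphism R TC (sfC R) (corestrict (Tot_tC R) tmod) \<and>
       FOb (Tot_tC R) ` Ob TC = fst ` Ob (sfC R) \<and>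
       full_zero_embedding BM TC tC_of_bgmod \<and>
       full_zero_embedding FM FC fC_of_fmodule \<and>
       (\<forall>A \<in> Ob BM. FOb (Tot_tC R) (tC_of_bgmod A) = fC_of_fmodule (FOb (Tot_bgMod R) A)) \<and>
       (\<forall>A \<in> Ob BM. \<forall>B \<in> Ob BM.
          FHom (Tot_tC R) (tC_of_bgmod A) (tC_of_bgmod B) = FHom (Tot_bgMod R) A B) \<and>
       bg_functor R BM FM (Tot_bgMod R) \<and>
       bg_isomorphism R BM (sfMod R) (corestrict (Tot_bgMod R) id) \<and>
       FOb (Tot_bgMod R) ` Ob BM = fst ` Ob (sfMod R)"
  unfolding Let_def
  by (intro conjI ballI vb_functor_Tot_tC vb_isomorphism_Tot image_Tot_tC full_zero_embedding_bgMod
      full_zero_embedding_fMod bg_functor_Tot_bgMod bg_isomorphism_Tot image_Tot_bgMod assms)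
    (simp_all add: Tot_functor_simps Tot_complex_tC_of_bgmod[OF assms] Ob_bgMod tmod_tC_of_bgmod)

end
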